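(* For any integer $m \ge 0$ and any composition $\alpha=(\alpha_1,\dots,\alpha_\ell)$ of $n$, the power series $$\mathrm{Hilb}(S^{P_\alpha},t)=\prod_{i=1}^\ell\prod_{j=0}^{\alpha_i-1}\frac{1}{1-t^{q^{A_i}-q^{A_{i-1}+j}}}$$ is congruent in $\mathbb{Z}[[t]]/(t^{q^m})$ to the polynomial $$C_{\alpha,m}(t)=\sum_{\substack{\beta:\ \beta\le\alpha\\ |\beta|\le m}} t^{e(m,\alpha,\beta)}\begin{bmatrix} m\\ \beta,\,m-|\beta|\end{bmatrix}_{q,t},\qquad e(m,\alpha,\beta)=\sum_{i=1}^\ell(\alpha_i-\beta_i)(q^m-q^{B_i}).$$
   Context: $q$ is a prime power and $n\ge 1$. A composition $\alpha=(\alpha_1,\dots,\alpha_\ell)$ of $n$ has positive integer parts summing to $n$; $A_i=\alpha_1+\cdots+\alpha_i$, $A_0=0$. The sum runs over weak compositions $\beta=(\beta_1,\dots,\beta_\ell)$ (nonnegative integers, same length $\ell$) with $\beta_i\le\alpha_i$ for all $i$ (written $\beta\le\alpha$) and $|\beta|=\beta_1+\cdots+\beta_\ell\le m$; $B_i=\beta_1+\cdots+\beta_i$, $B_0=0$. The $(q,t)$-multinomial coefficient is the polynomial in $t$ $$\begin{bmatrix} m\\ \beta,\,m-|\beta|\end{bmatrix}_{q,t}=\frac{\prod_{j=0}^{|\beta|-1}(1-t^{q^m-q^j})}{\prod_{i=1}^{\ell}\prod_{j=0}^{\beta_i-1}\bigl(1-t^{q^{B_i}-q^{B_{i-1}+j}}\bigr)}.$$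 Here $S=\mathbb{F}_q[x_1,\dots,x_n]$ and $P_\alpha\subset GL_n(\mathbb{F}_q)$ is the group of block upper-triangular invertible matrices with diagonal blocks of sizes $\alpha_1,\dots,\alpha_\ell$, acting by linear substitutions $g(x_j)=\sum_i g_{ij}x_i$; the displayed product formula for the Hilbert series $\mathrm{Hilb}(S^{P_\alpha},t)=\sum_d \dim_{\mathbb{F}_q}(S^{P_\alpha})_d\,t^d$ is a known theorem (Kuhn--Mitchell, Mui, Hewett). *)

theory Defs
  imports
    "Jordan_Normal_Form.Matrix"
    "HOL-Library.Poly_Mapping"
    "HOL-Computational_Algebra.Polynomial_FPS"
begin

text \<open>
  Indices start at 0: the parts of a composition are \<open>\<alpha> ! 0, \<dots>, \<alpha> ! (\<ell> - 1)\<close> with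
  \<open>\<ell> = length \<alpha>\<close>, the variables of \<open>S\<close> are \<open>x\<^sub>0, \<dots>, x\<^sub>n\<^sub>-\<^sub>1\<close>, and matrices are indexed
  accordingly.
\<close>

definition composition :: "nat list \<Rightarrow> nat \<Rightarrow> bool" where
  "composition \<alpha> n \<longleftrightarrow> (\<forall>i<length \<alpha>. 1 \<le> \<alpha> ! i) \<and> sum_list \<alpha> = n"

text \<open>\<open>psum \<alpha> i\<close> is \<open>A\<^sub>i\<close>, and \<open>psum \<beta> i\<close> is \<open>B\<^sub>i\<close>.\<close>

definition psum :: "nat list \<Rightarrow> nat \<Rightarrow> nat" where
  "psum \<alpha> i = sum_list (take i \<alpha>)"


section \<open>Polynomials in several variables and linear substitutions\<close>

text \<open>
  Polynomials in \<open>x\<^sub>0, x\<^sub>1, \<dots>\<close>: a monomial is its finitely supported exponent vector, and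
  multiplication is the convolution product of \<^typ>\<open>'b \<Rightarrow>\<^sub>0 'a\<close>.
\<close>

type_synonym 'a mpoly = "(nat \<Rightarrow>\<^sub>0 nat) \<Rightarrow>\<^sub>0 'a"

definition mconst :: "'a::zero \<Rightarrow> 'a mpoly" where
  "mconst c = Poly_Mapping.single 0 c"

definition mvar :: "nat \<Rightarrow> 'a::zero_neq_one mpoly" where
  "mvar i = Poly_Mapping.single (Poly_Mapping.single i 1) 1"

definition mpoly_scale :: "'a::field \<Rightarrow> 'a mpoly \<Rightarrow> 'a mpoly" where
  "mpoly_scale c f = mconst c * f"

global_interpretation mpoly: vector_space mpoly_scale
  by unfold_locales
    (simp_all add: mpoly_scale_def mconst_def algebra_simps single_add mult_single
      flip: mult.assoc)

definition mono_degree :: "(nat \<Rightarrow>\<^sub>0 nat) \<Rightarrow> nat" where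
  "mono_degree e = (\<Sum>i\<in>Poly_Mapping.keys e. Poly_Mapping.lookup e i)"

definition homogeneous :: "nat \<Rightarrow> 'a::zero mpoly \<Rightarrow> bool" where
  "homogeneous d f \<longleftrightarrow> (\<forall>e\<in>Poly_Mapping.keys f. mono_degree e = d)"

text \<open>The ring \<open>S\<close> of polynomials in \<open>x\<^sub>0, \<dots>, x\<^sub>n\<^sub>-\<^sub>1\<close>.\<close>

definition poly_ring :: "nat \<Rightarrow> 'a::zero mpoly set" where
  "poly_ring n = {f. \<forall>e\<in>Poly_Mapping.keys f. Poly_Mapping.keys e \<subseteq> {..<n}}"

text \<open>The substitution \<open>x\<^sub>j \<mapsto> \<Sum>\<^sub>i g\<^sub>i\<^sub>j x\<^sub>i\<close>, extended to an algebra endomorphism of \<open>S\<close>.\<close>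

definition lin_subst :: "nat \<Rightarrow> 'a::field mat \<Rightarrow> 'a mpoly \<Rightarrow> 'a mpoly" where
  "lin_subst n g f =
     (\<Sum>e\<in>Poly_Mapping.keys f. mconst (Poly_Mapping.lookup f e) *
        (\<Prod>j<n. (\<Sum>i<n. mconst (g $$ (i, j)) * mvar i) ^ Poly_Mapping.lookup e j))"

definition invariants :: "nat \<Rightarrow> 'a::field mat set \<Rightarrow> 'a mpoly set" where
  "invariants n G = {f \<in> poly_ring n. \<forall>g\<in>G. lin_subst n g f = f}"

definition hilbert_series :: "'a::field mpoly set \<Rightarrow> int fps" where
  "hilbert_series R = Abs_fps (\<lambda>d. int (mpoly.dim {f \<in> R. homogeneous d f}))"


section \<open>Parabolic subgroups\<close>

definition block :: "nat list \<Rightarrow> nat \<Rightarrow> nat set" where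
  "block \<alpha> u = {psum \<alpha> u..<psum \<alpha> (Suc u)}"

definition parabolic :: "nat list \<Rightarrow> 'a::field mat set" where
  "parabolic \<alpha> =
     {g \<in> carrier_mat (sum_list \<alpha>) (sum_list \<alpha>). invertible_mat g \<and>
        (\<forall>u v i j. u < v \<and> v < length \<alpha> \<and> i \<in> block \<alpha> v \<and> j \<in> block \<alpha> u \<longrightarrow> g $$ (i, j) = 0)}"


section \<open>The two sides of the congruence\<close>

text \<open>
  The reciprocal in \<open>\<int>[[t]]\<close> of a power series with constant coefficient 1. The library's
  \<^const>\<open>inverse\<close> on power series requires an inverse on the coefficients, hence is not
  available over \<^typ>\<open>int\<close>.
\<close>

definition fps_recip :: "int fps \<Rightarrow> int fps" where
  "fps_recip f = fps_right_inverse f 1"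

lemma fps_recip: "fps_nth f 0 = 1 \<Longrightarrow> f * fps_recip f = 1"
  unfolding fps_recip_def by (rule fps_right_inverse) simp

definition hilbert_product :: "nat \<Rightarrow> nat list \<Rightarrow> int fps" where
  "hilbert_product q \<alpha> =
     (\<Prod>i<length \<alpha>. \<Prod>j<\<alpha> ! i.
        fps_recip (1 - fps_X ^ (q ^ psum \<alpha> (Suc i) - q ^ (psum \<alpha> i + j))))"

text \<open>
  The quotient defining the \<open>(q,t)\<close>-multinomial coefficient is taken in \<open>\<int>[t]\<close>, where the
  denominator divides the numerator. For \<open>sum_list \<beta> \<le> m\<close> none of the subtractions of natural
  numbers truncates.
\<close>

definition qt_multinomial :: "nat \<Rightarrow> nat \<Rightarrow> nat list \<Rightarrow> int poly" where
  "qt_multinomial q m \<beta> =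
     (\<Prod>j<sum_list \<beta>. 1 - monom 1 (q ^ m - q ^ j)) div
     (\<Prod>i<length \<beta>. \<Prod>j<\<beta> ! i. 1 - monom 1 (q ^ psum \<beta> (Suc i) - q ^ (psum \<beta> i + j)))"

definition e_exponent :: "nat \<Rightarrow> nat \<Rightarrow> nat list \<Rightarrow> nat list \<Rightarrow> nat" where
  "e_exponent q m \<alpha> \<beta> =
     (\<Sum>i<length \<alpha>. (\<alpha> ! i - \<beta> ! i) * (q ^ m - q ^ psum \<beta> (Suc i)))"

definition weak_comps_below :: "nat list \<Rightarrow> nat \<Rightarrow> nat list set" where
  "weak_comps_below \<alpha> m =
     {\<beta>. length \<beta> = length \<alpha> \<and> (\<forall>i<length \<alpha>. \<beta> ! i \<le> \<alpha> ! i) \<and> sum_list \<beta> \<le> m}"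

lemma finite_weak_comps_below: "finite (weak_comps_below \<alpha> m)"
proof (rule finite_subset)
  show "weak_comps_below \<alpha> m \<subseteq> {\<beta>. set \<beta> \<subseteq> {..m} \<and> length \<beta> = length \<alpha>}"
    using member_le_sum_list by (fastforce simp: weak_comps_below_def)
qed (simp add: finite_lists_length_eq)

definition C_poly :: "nat \<Rightarrow> nat list \<Rightarrow> nat \<Rightarrow> int poly" where
  "C_poly q \<alpha> m =
     (\<Sum>\<beta>\<in>weak_comps_below \<alpha> m. monom 1 (e_exponent q m \<alpha> \<beta>) * qt_multinomial q m \<beta>)"

end

theory Submission
  imports Defs "HOL-Library.Cardinality"
begin

text \<open>
  Hilbert series. Let \<open>\<rho>\<close> set the first variable to zero. If \<open>f\<close> is invariant under the parabolic
  group, then \<open>\<rho> f\<close> is the \<open>q\<close>-th power of an invariant of the parabolic group in one variable less,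
  because \<open>f\<close> is invariant under all \<open>x\<^sub>j \<mapsto> x\<^sub>j + c x\<^sub>0\<close> and \<open>\<Prod>\<^sub>c (x\<^sub>j + c x\<^sub>0)\<close> becomes \<open>x\<^sub>j^q\<close>. The kernel
  of \<open>\<rho>\<close> on the invariants is generated by the product \<open>L\<close> of all nonzero linear forms in the
  variables of the first block: an invariant that is divisible by \<open>x\<^sub>0\<close> is divisible by \<open>x\<^sub>0^(q - 1)\<close>, and
  the group moves \<open>x\<^sub>0\<close> to every nonzero linear form of that block. Finally the Dickson invariants of
  the sets of variables that are unions of initial blocks lift the \<open>q\<close>-th powers of their
  analogues in one variable less. So a basis in degree \<open>d\<close> consists of \<open>L\<close> times a basis in degree
  \<open>d - deg L\<close> and of lifts of a basis in degree \<open>d / q\<close> for one variable less, which is the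
  recursion satisfied by the product formula.

  Congruence. Process the parts of \<open>\<alpha>\<close> from left to right. Modulo \<open>t^(q^m)\<close> a summand vanishes as
  soon as two factors \<open>t^(q^m - q^B)\<close> with \<open>B < m\<close> occur, so at each part at most two choices of
  \<open>\<beta>\<^sub>i\<close> survive, and these add up to the factor of the product formula.
\<close>

section \<open>Truncated power series and the congruence\<close>

text \<open>Removing \<open>x_0\<close> lowers the first part of a composition by one and may delete
  it; for a flag it only shifts the function \<epsilon>, so the induction runs over flags. The first
  variable is the one to remove because it lies in every member of the flag: all translations by
  multiples of \<open>x_0\<close> then belong to the group. Degrees fit because
  \<open>q ^ (a + 1) - q ^ (k + 1)\<close> is \<open>q\<close> times \<open>q ^ a - q ^ k\<close>:
  apart from the factor of \<open>x_0\<close>, the product formula is that of the smaller flag in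
  \<open>t ^ q\<close>, while taking q-th roots of invariants divides degrees by \<open>q\<close>.
  As \<open>c ^ q = c\<close> in the field, taking these roots is compatible with linear
  combinations, so spanning and independence can be carried through the induction together, degree
  by degree.

  For the congruence, the estimate \<open>2 * q ^ (m - 1) \<le> q ^ m\<close> is what makes two
  exponents \<open>q ^ m - q ^ B\<close> with \<open>B < m\<close> add up to at least
  \<open>q ^ m\<close>. The claim is generalized to a list of parts behind an arbitrary offset
  \<open>B\<close>, because after the choice of \<open>b\<close> the remaining parts see the offset
  \<open>B + b\<close> and not \<open>B + a\<close>.\<close>

definition fps_cong :: "nat \<Rightarrow> int fps \<Rightarrow> int fps \<Rightarrow> bool" where
  "fps_cong N f g \<longleftrightarrow> fps_X ^ N dvd f - g"

lemma fps_cong_refl [simp]: "fps_cong N f f"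
  by (simp add: fps_cong_def)

lemma fps_cong_sym: "fps_cong N f g \<Longrightarrow> fps_cong N g f"
  unfolding fps_cong_def by (subst minus_diff_eq[symmetric], subst dvd_minus_iff)

lemma fps_cong_trans [trans]: "fps_cong N f g \<Longrightarrow> fps_cong N g h \<Longrightarrow> fps_cong N f h"
  unfolding fps_cong_def using dvd_add[of _ "f - g" "g - h"] by simp

lemma fps_cong_add: "fps_cong N f g \<Longrightarrow> fps_cong N f' g' \<Longrightarrow> fps_cong N (f + f') (g + g')"
  unfolding fps_cong_def by (simp add: add_diff_add dvd_add)

lemma fps_cong_diff: "fps_cong N f g \<Longrightarrow> fps_cong N f' g' \<Longrightarrow> fps_cong N (f - f') (g - g')"
proof -
  assume "fps_cong N f g" "fps_cong N f' g'"
  moreover have "f - f' - (g - g') = (f - g) - (f' - g')"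
    by (simp add: algebra_simps)
  ultimately show ?thesis
    unfolding fps_cong_def by (metis dvd_diff)
qed

lemma fps_cong_mult: "fps_cong N f g \<Longrightarrow> fps_cong N f' g' \<Longrightarrow> fps_cong N (f * f') (g * g')"
proof -
  assume a: "fps_cong N f g" "fps_cong N f' g'"
  have "f * f' - g * g' = (f - g) * f' + g * (f' - g')"
    by (simp add: algebra_simps)
  then show ?thesis
    using a unfolding fps_cong_def by (metis dvd_add dvd_mult dvd_mult2)
qed

lemma fps_cong_prod: "(\<And>i. i \<in> A \<Longrightarrow> fps_cong N (f i) (g i)) \<Longrightarrow> fps_cong N (prod f A) (prod g A)"
  by (induction A rule: infinite_finite_induct) (auto intro: fps_cong_mult)

lemma fps_cong_sum: "(\<And>i. i \<in> A \<Longrightarrow> fps_cong N (f i) (g i)) \<Longrightarrow> fps_cong N (sum f A) (sum g A)"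
  by (induction A rule: infinite_finite_induct) (auto intro: fps_cong_add)

lemma fps_cong_le: "fps_cong N f g \<Longrightarrow> M \<le> N \<Longrightarrow> fps_cong M f g"
  unfolding fps_cong_def by (meson dvd_trans le_imp_power_dvd)

lemma fps_cong_X_power_0: "N \<le> k \<Longrightarrow> fps_cong N (fps_X ^ k * f) 0"
  unfolding fps_cong_def by (simp add: dvd_mult2 le_imp_power_dvd)

lemma fps_cong_X_power_mult: "fps_cong N f g \<Longrightarrow> fps_cong (k + N) (fps_X ^ k * f) (fps_X ^ k * g)"
  unfolding fps_cong_def by (simp add: power_add mult_dvd_mono flip: right_diff_distrib)

lemma fps_nth_one_minus_X_power: "k > 0 \<Longrightarrow> fps_nth (1 - fps_X ^ k :: int fps) 0 = 1"
  by simp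

lemma fps_recip_unique: "fps_nth f 0 = 1 \<Longrightarrow> f * g = 1 \<Longrightarrow> g = fps_recip f"
  by (metis fps_recip mult.assoc mult.commute mult.right_neutral)

lemma fps_recip_cong_1:
  assumes "fps_nth f 0 = 1" "fps_cong N f 1"
  shows "fps_cong N (fps_recip f) 1"
proof -
  have "fps_cong N (1 * fps_recip f) (f * fps_recip f)"
    using assms(2) by (intro fps_cong_mult) (auto intro: fps_cong_sym)
  then show ?thesis
    using fps_recip[OF assms(1)] by simp
qed

lemma fps_recip_X_power_cong_1:
  "0 < k \<Longrightarrow> N \<le> k \<Longrightarrow> fps_cong N (fps_recip (1 - fps_X ^ k)) 1"
  by (rule fps_recip_cong_1) (auto simp: fps_cong_def le_imp_power_dvd)

text \<open>Only the constant and the linear terms of the expansion survive, since any two exponents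
  together reach \<open>N\<close>.\<close>

lemma prod_one_minus_X_power_cong:
  assumes "finite A" "\<And>i j. i \<in> A \<Longrightarrow> j \<in> A \<Longrightarrow> N \<le> e i + e j"
  shows "fps_cong N (\<Prod>j\<in>A. 1 - fps_X ^ e j) (1 - (\<Sum>j\<in>A. fps_X ^ e j))"
  using assms
proof (induction A rule: finite_induct)
  case (insert x A)
  have "fps_cong N ((1 - fps_X ^ e x) * (\<Prod>j\<in>A. 1 - fps_X ^ e j))
      ((1 - fps_X ^ e x) * (1 - (\<Sum>j\<in>A. fps_X ^ e j)))"
    using insert by (intro fps_cong_mult) auto
  also have "(1 - fps_X ^ e x) * (1 - (\<Sum>j\<in>A. fps_X ^ e j)) =
      1 - (\<Sum>j\<in>insert x A. fps_X ^ e j) + (\<Sum>j\<in>A. fps_X ^ (e x + e j) * (1 :: int fps))"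
    using insert
    by (simp add: left_diff_distrib right_diff_distrib sum_distrib_left sum_subtractf power_add)
  also have "fps_cong N \<dots> (1 - (\<Sum>j\<in>insert x A. fps_X ^ e j) + (\<Sum>j\<in>A. 0))"
    using insert.prems by (intro fps_cong_add fps_cong_sum fps_cong_X_power_0) auto
  finally show ?case
    using insert by simp
qed simp

section \<open>Estimates for the exponents\<close>

lemma power_diff_ge:
  fixes q :: nat
  assumes "2 \<le> q" "y < x"
  shows "q ^ (x - 1) \<le> q ^ x - q ^ y"
proof -
  have "q ^ y \<le> q ^ (x - 1)"
    using assms by (intro power_increasing) auto
  moreover have "2 * q ^ (x - 1) \<le> q ^ x"
    using assms by (cases x) auto
  ultimately show ?thesis
    by linarith
qed

lemma power_diff_pos:
  fixes q :: nat
  assumes "2 \<le> q" "y < x"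
  shows "0 < q ^ x - q ^ y"
  using power_diff_ge[OF assms] assms by (meson less_le_trans zero_less_power pos2)

text \<open>Both \<open>q ^ y\<close> and \<open>q ^ z\<close> are at most half of
  \<open>q ^ x\<close>. This is the main source of vanishing modulo
  \<open>t ^ (q ^ m)\<close>.\<close>

lemma power_diff_double_ge:
  fixes q :: nat
  assumes "2 \<le> q" "y < x" "z < x"
  shows "q ^ x \<le> (q ^ x - q ^ y) + (q ^ x - q ^ z)"
proof -
  have "q ^ y \<le> q ^ (x - 1)" "q ^ z \<le> q ^ (x - 1)"
    using assms by (auto intro!: power_increasing)
  moreover have "2 * q ^ (x - 1) \<le> q ^ x"
    using assms by (cases x) auto
  ultimately show ?thesis
    by linarith
qed

text \<open>The quotient series \<open>hilb_factor q B a\<close> collects the factors contributed by a block of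
  size \<open>a\<close> that is preceded by \<open>B\<close> variables.\<close>

definition hilb_factor :: "nat \<Rightarrow> nat \<Rightarrow> nat \<Rightarrow> int fps" where
  "hilb_factor q B a = (\<Prod>j<a. fps_recip (1 - fps_X ^ (q ^ (B + a) - q ^ (B + j))))"

fun hilb_from :: "nat \<Rightarrow> nat \<Rightarrow> nat list \<Rightarrow> int fps" where
  "hilb_from q B [] = 1"
| "hilb_from q B (a # r) = hilb_factor q B a * hilb_from q (B + a) r"

lemma psum_Cons_Suc: "psum (a # r) (Suc i) = a + psum r i"
  by (simp add: psum_def)

lemma psum_0 [simp]: "psum r 0 = 0"
  by (simp add: psum_def)

lemma hilb_from_eq_prod:
  "hilb_from q B \<alpha> = (\<Prod>i<length \<alpha>. \<Prod>j<\<alpha> ! i.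
     fps_recip (1 - fps_X ^ (q ^ (B + psum \<alpha> (Suc i)) - q ^ (B + psum \<alpha> i + j))))"
proof (induction \<alpha> arbitrary: B)
  case (Cons a r)
  show ?case
    by (simp add: Cons hilb_factor_def psum_Cons_Suc prod.lessThan_Suc_shift add.assoc
      del: prod.lessThan_Suc)
qed simp

lemma hilbert_product_eq_hilb_from: "hilbert_product q \<alpha> = hilb_from q 0 \<alpha>"
  by (simp add: hilbert_product_def hilb_from_eq_prod)

lemma hilb_factor_cong_1:
  assumes "2 \<le> q" "N \<le> q ^ (B + a - 1)"
  shows "fps_cong N (hilb_factor q B a) 1"
proof -
  have "fps_cong N (hilb_factor q B a) (\<Prod>j<a. 1)"
    unfolding hilb_factor_def
    using assms power_diff_ge[OF assms(1), of "B + _" "B + a"]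
    by (intro fps_cong_prod fps_recip_X_power_cong_1) (auto intro: power_diff_pos order_trans)
  then show ?thesis by simp
qed

text \<open>Every exponent has the form \<open>q ^ (B' + a) - q ^ (B' + j)\<close> with
  \<open>j < a\<close> and \<open>B \<le> B'\<close>, hence is at least \<open>q ^ B\<close>. So
  parts behind the offset \<open>B\<close> are invisible below degree \<open>q ^ B\<close>.\<close>

lemma hilb_from_cong_1:
  assumes "2 \<le> q"
  shows "fps_cong (q ^ B) (hilb_from q B r) 1"
proof (induction r arbitrary: B)
  case (Cons a r)
  have "fps_cong (q ^ B) (hilb_factor q B a) 1"
  proof (cases a)
    case 0
    then show ?thesis by (simp add: hilb_factor_def)
  next
    case (Suc k)
    then show ?thesis
      using assms by (intro hilb_factor_cong_1) (auto intro!: power_increasing)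
  qed
  moreover have "fps_cong (q ^ B) (hilb_from q (B + a) r) 1"
    using assms by (intro fps_cong_le[OF Cons]) (auto intro!: power_increasing)
  ultimately show ?case
    using fps_cong_mult by fastforce
qed simp

text \<open>The slice of the numerator of the multinomial that belongs to one part: its indices are
  the \<open>b\<close> numbers from \<open>B\<close> on.\<close>

definition numer_factor :: "nat \<Rightarrow> nat \<Rightarrow> nat \<Rightarrow> nat \<Rightarrow> int fps" where
  "numer_factor q m B b = (\<Prod>j<b. 1 - fps_X ^ (q ^ m - q ^ (B + j)))"

text \<open>The parts can be summed one after the other because the multinomial splits into one
  quotient per part, which depends on the earlier choices only through their sum \<open>B\<close>.
  The restriction \<open>B + b \<le> m\<close> encodes the bound on the size of \<beta>.\<close>

fun C_from :: "nat \<Rightarrow> nat \<Rightarrow> nat \<Rightarrow> nat list \<Rightarrow> int fps" where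
  "C_from q m B [] = 1"
| "C_from q m B (a # r) = (\<Sum>b | b \<le> a \<and> B + b \<le> m.
     fps_X ^ ((a - b) * (q ^ m - q ^ (B + b))) *
     (numer_factor q m B b * hilb_factor q B b * C_from q m (B + b) r))"

lemma hilb_factor_inverse:
  assumes "2 \<le> q"
  shows "(\<Prod>j<a. 1 - fps_X ^ (q ^ (B + a) - q ^ (B + j))) * hilb_factor q B a = 1"
  using assms by (simp add: hilb_factor_def flip: prod.distrib)
    (intro prod.neutral ballI fps_recip fps_nth_one_minus_X_power power_diff_pos, auto)

text \<open>If \<open>B + a > m\<close>, only the summand with \<open>B + b = m\<close> survives modulo \<open>t^(q^m)\<close>, because
  every other one carries at least two factors \<open>t^(q^m - q^(B + b))\<close>. If \<open>B + a \<le> m\<close>, the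
  summands \<open>b = a\<close> and \<open>b = a - 1\<close> survive, and the latter cancels the error made by dropping the
  numerator in the former.\<close>

lemma C_from_cong_hilb_from_step:
  assumes q: "2 \<le> q" and a: "1 \<le> a" "B + a \<le> m"
  shows "fps_cong (q ^ m)
    (numer_factor q m B a * hilb_factor q B a * hilb_from q (B + a) r +
     fps_X ^ (q ^ m - q ^ (B + (a - 1))) *
       (numer_factor q m B (a - 1) * hilb_factor q B (a - 1) * hilb_from q (B + (a - 1)) r))
    (hilb_factor q B a * hilb_from q (B + a) r)"
proof -
  obtain c where c: "a = Suc c"
    using a by (cases a) auto
  \<comment> \<open>\<open>K\<close> is the exponent in front of the summand
    \<open>b = a - 1\<close>. As \<open>K + M = q ^ m\<close>, whatever is multiplied by
    \<open>t ^ K\<close> matters only modulo \<open>t ^ M\<close>.\<close>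
  define M where "M = q ^ (B + c)"
  define K where "K = q ^ m - M"
  have "M \<le> q ^ m"
    using a q by (auto simp: M_def c intro!: power_increasing)
  then have KM: "K + M = q ^ m"
    by (simp add: K_def)
  define S :: "int fps" where "S = (\<Sum>j<c. fps_X ^ (M - q ^ (B + j)))"
  have dbl: "M \<le> (M - q ^ (B + i)) + (M - q ^ (B + j))" if "i < c" "j < c" for i j
    unfolding M_def using q that by (intro power_diff_double_ge) auto
  \<comment> \<open>Modulo \<open>t ^ M\<close> the denominator is \<open>1 - S\<close> and
    \<open>S * S\<close> vanishes, so the reciprocal is \<open>1 + S\<close>.\<close>
  have inv: "fps_cong M (hilb_factor q B c) (1 + S)"
  proof -
    define P :: "int fps" where "P = (\<Prod>j<c. 1 - fps_X ^ (q ^ (B + c) - q ^ (B + j)))"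
    have P: "fps_cong M P (1 - S)"
      unfolding S_def P_def M_def[symmetric]
      using dbl by (intro prod_one_minus_X_power_cong) auto
    have "fps_cong M (P * (1 + S)) ((1 - S) * (1 + S))"
      using P by (intro fps_cong_mult) auto
    also have "(1 - S) * (1 + S) = 1 - S * S"
      by (simp add: algebra_simps)
    also have "S * S = (\<Sum>i<c. \<Sum>j<c. fps_X ^ ((M - q ^ (B + i)) + (M - q ^ (B + j))) * 1)"
      by (simp add: S_def sum_product power_add)
    also have "fps_cong M (1 - \<dots>) (1 - (\<Sum>i<c. \<Sum>j<c. 0))"
      using dbl by (intro fps_cong_diff fps_cong_sum fps_cong_X_power_0 fps_cong_refl) auto
    finally have "fps_cong M (hilb_factor q B c * (P * (1 + S))) (hilb_factor q B c * 1)"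
      by (intro fps_cong_mult) auto
    moreover have "hilb_factor q B c * (P * (1 + S)) = (P * hilb_factor q B c) * (1 + S)"
      by (simp only: ac_simps)
    moreover have "P * hilb_factor q B c = 1"
      unfolding P_def by (rule hilb_factor_inverse[OF q])
    ultimately show ?thesis
      by (auto intro: fps_cong_sym)
  qed
  have numer': "fps_cong M (numer_factor q m B c) 1"
  proof -
    have "fps_cong M (numer_factor q m B c) (\<Prod>j<c. 1 - 0)"
      unfolding numer_factor_def
    proof (intro fps_cong_prod fps_cong_diff)
      fix j assume "j \<in> {..<c}"
      then have "q ^ (m - 1) \<le> q ^ m - q ^ (B + j)"
        using q a by (intro power_diff_ge) (auto simp: c)
      moreover have "M \<le> q ^ (m - 1)"
        unfolding M_def using q a c by (intro power_increasing) auto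
      ultimately show "fps_cong M (fps_X ^ (q ^ m - q ^ (B + j))) 0"
        using fps_cong_X_power_0[of M _ 1] by simp
    qed simp
    then show ?thesis by simp
  qed
  have second: "fps_cong (K + M)
      (fps_X ^ K * (numer_factor q m B c * hilb_factor q B c * hilb_from q (B + c) r))
      (fps_X ^ K * (1 * (1 + S) * 1))"
    using numer' inv hilb_from_cong_1[OF q, of "B + c" r]
    by (intro fps_cong_X_power_mult fps_cong_mult) (auto simp: M_def)
  define DH where "DH = hilb_factor q B a * hilb_from q (B + a) r"
  have DH: "fps_cong M DH (1 * 1)"
    unfolding DH_def
  proof (rule fps_cong_mult)
    show "fps_cong M (hilb_factor q B a) 1"
      using q by (intro hilb_factor_cong_1) (simp_all add: c M_def)
    show "fps_cong M (hilb_from q (B + a) r) 1"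
      using q by (intro fps_cong_le[OF hilb_from_cong_1]) (auto simp: M_def c)
  qed
  \<comment> \<open>After extracting \<open>t ^ K\<close>, the factor \<open>j = c\<close>
    contributes the 1 in \<open>1 + S\<close> and the others contribute \<open>S\<close>. Thus the
    numerator falls short of 1 by exactly the second summand.\<close>
  have numer: "fps_cong (K + M) (numer_factor q m B a) (1 - fps_X ^ K * (1 + S))"
  proof -
    have "fps_cong (K + M) (numer_factor q m B a) (1 - (\<Sum>j<a. fps_X ^ (q ^ m - q ^ (B + j))))"
      unfolding numer_factor_def KM using q a
      by (intro prod_one_minus_X_power_cong power_diff_double_ge) auto
    also have "(\<Sum>j<a. fps_X ^ (q ^ m - q ^ (B + j)) :: int fps) = fps_X ^ K * (1 + S)"
    proof -
      have "q ^ m - q ^ (B + j) = K + (M - q ^ (B + j))" if "j \<le> c" for j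
      proof -
        have "q ^ (B + j) \<le> M"
          unfolding M_def using that q by (intro power_increasing) auto
        then show ?thesis using KM by linarith
      qed
      then have "(\<Sum>j<a. fps_X ^ (q ^ m - q ^ (B + j)) :: int fps) =
          (\<Sum>j<a. fps_X ^ K * fps_X ^ (M - q ^ (B + j)))"
        by (intro sum.cong) (auto simp: c power_add)
      also have "\<dots> = fps_X ^ K * (1 + S)"
        by (simp add: c S_def M_def sum_distrib_left distrib_left)
      finally show ?thesis .
    qed
    finally show ?thesis .
  qed
  \<comment> \<open>\<open>DH\<close> is kept in the main term and replaced by 1 only where it
    stands next to \<open>t ^ K\<close>.\<close>
  have "fps_cong (K + M) (numer_factor q m B a * DH) ((1 - fps_X ^ K * (1 + S)) * DH)"
    using numer by (intro fps_cong_mult) auto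
  also have "(1 - fps_X ^ K * (1 + S)) * DH = DH - fps_X ^ K * ((1 + S) * DH)"
    by (simp add: algebra_simps)
  also have "fps_cong (K + M) \<dots> (DH - fps_X ^ K * ((1 + S) * (1 * 1)))"
    using DH by (intro fps_cong_diff fps_cong_X_power_mult fps_cong_mult) auto
  finally have "fps_cong (K + M)
      (numer_factor q m B a * DH +
        fps_X ^ K * (numer_factor q m B c * hilb_factor q B c * hilb_from q (B + c) r))
      (DH - fps_X ^ K * ((1 + S) * (1 * 1)) + fps_X ^ K * (1 * (1 + S) * 1))"
    using second by (rule fps_cong_add)
  then show ?thesis
    unfolding KM by (simp add: DH_def c K_def M_def mult.assoc)
qed

lemma C_from_cong_hilb_from:
  assumes q: "2 \<le> q" and "B \<le> m" and "\<forall>a\<in>set r. 1 \<le> a"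
  shows "fps_cong (q ^ m) (C_from q m B r) (hilb_from q B r)"
  using assms(2,3)
proof (induction r arbitrary: B)
  case (Cons a r)
  define T where "T = (\<lambda>b. fps_X ^ ((a - b) * (q ^ m - q ^ (B + b))) *
     (numer_factor q m B b * hilb_factor q B b * C_from q m (B + b) r))"
  define I where "I = {b. b \<le> a \<and> B + b \<le> m}"
  have fin: "finite I"
    unfolding I_def by (rule finite_subset[of _ "{..a}"]) auto
  have CT: "C_from q m B (a # r) = sum T I"
    by (simp add: T_def I_def)
  have vanish: "fps_cong (q ^ m) (T b) 0" if "b + 2 \<le> a" "B + b < m" for b
    unfolding T_def
  proof (rule fps_cong_X_power_0)
    have "q ^ m \<le> 2 * (q ^ m - q ^ (B + b))"
      using power_diff_double_ge[OF q that(2) that(2)] by simp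
    also have "\<dots> \<le> (a - b) * (q ^ m - q ^ (B + b))"
      using that by (intro mult_right_mono) auto
    finally show "q ^ m \<le> (a - b) * (q ^ m - q ^ (B + b))" .
  qed
  have IH: "fps_cong (q ^ m) (C_from q m (B + b) r) (hilb_from q (B + b) r)" if "B + b \<le> m" for b
    using Cons that by auto
  show ?case
  proof (cases "B + a \<le> m")
    case False
    \<comment> \<open>The largest admissible choice: its exponent contains the factor
      \<open>q ^ m - q ^ m = 0\<close>, and its numerator equals its denominator.\<close>
    define b where "b = m - B"
    have b: "B + b = m" "b < a"
      using False Cons.prems by (auto simp: b_def)
    have "numer_factor q m B b * hilb_factor q B b = 1"
      using hilb_factor_inverse[OF q, where a = b and B = B] b by (simp add: numer_factor_def)
    then have Tb: "T b = C_from q m m r"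
      by (simp add: T_def b)
    have "sum T I = T b + sum T (I - {b})"
      using b fin by (intro sum.remove) (auto simp: I_def)
    also have "fps_cong (q ^ m) \<dots> (hilb_from q m r + (\<Sum>b\<in>I - {b}. 0))"
    proof (intro fps_cong_add fps_cong_sum)
      show "fps_cong (q ^ m) (T b) (hilb_from q m r)"
        unfolding Tb using IH[of b] b by simp
      show "fps_cong (q ^ m) (T i) 0" if "i \<in> I - {b}" for i
        using that b by (intro vanish) (auto simp: I_def)
    qed
    also have "fps_cong (q ^ m) (hilb_from q m r + (\<Sum>b\<in>I - {b}. 0)) 1"
      using hilb_from_cong_1[OF q] by simp
    \<comment> \<open>Here \<open>m \<le> B + a - 1\<close>, so all exponents of the product formula
      are at least \<open>q ^ m\<close>.\<close>
    also have "fps_cong (q ^ m) 1 (hilb_from q B (a # r))"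
    proof (rule fps_cong_sym)
      have "fps_cong (q ^ m) (hilb_from q B (a # r)) (1 * 1)"
        unfolding hilb_from.simps
      proof (rule fps_cong_mult)
        show "fps_cong (q ^ m) (hilb_factor q B a) 1"
          using q False by (intro hilb_factor_cong_1) (auto intro!: power_increasing)
        show "fps_cong (q ^ m) (hilb_from q (B + a) r) 1"
          using q False by (intro fps_cong_le[OF hilb_from_cong_1]) (auto intro!: power_increasing)
      qed
      then show "fps_cong (q ^ m) (hilb_from q B (a # r)) 1" by simp
    qed
    finally show ?thesis unfolding CT .
  next
    case True
    have a: "1 \<le> a"
      using Cons.prems by auto
    have "sum T I = T a + (T (a - 1) + sum T (I - {a} - {a - 1}))"
      using True fin a
      by (subst sum.remove[of I a], simp, simp add: I_def, subst sum.remove[of "I - {a}" "a - 1"])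
        (auto simp: I_def)
    also have "fps_cong (q ^ m) \<dots>
       (numer_factor q m B a * hilb_factor q B a * hilb_from q (B + a) r +
       (fps_X ^ (q ^ m - q ^ (B + (a - 1))) *
         (numer_factor q m B (a - 1) * hilb_factor q B (a - 1) * hilb_from q (B + (a - 1)) r) +
       (\<Sum>b\<in>I - {a} - {a - 1}. 0)))"
    proof (intro fps_cong_add fps_cong_sum)
      show "fps_cong (q ^ m) (T a) (numer_factor q m B a * hilb_factor q B a * hilb_from q (B + a) r)"
        using IH[of a] True by (auto simp: T_def intro!: fps_cong_mult)
      show "fps_cong (q ^ m) (T (a - 1)) (fps_X ^ (q ^ m - q ^ (B + (a - 1))) *
         (numer_factor q m B (a - 1) * hilb_factor q B (a - 1) * hilb_from q (B + (a - 1)) r))"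
        using IH[of "a - 1"] True a by (auto simp: T_def intro!: fps_cong_mult)
      show "fps_cong (q ^ m) (T i) 0" if "i \<in> I - {a} - {a - 1}" for i
        using that True by (intro vanish) (auto simp: I_def)
    qed
    also have "fps_cong (q ^ m) \<dots> (hilb_from q B (a # r))"
      using C_from_cong_hilb_from_step[OF q a True, of r] by simp
    finally show ?thesis unfolding CT .
  qed
qed simp

section \<open>Divisibility behind the multinomial coefficients\<close>

lemma prod_lessThan_add:
  fixes f :: "nat \<Rightarrow> 'b::comm_monoid_mult"
  shows "(\<Prod>k<a + b. f k) = (\<Prod>k<a. f k) * (\<Prod>j<b. f (a + j))"
  by (induction b) (simp_all add: mult.assoc)

lemma psum_Suc: "i < length r \<Longrightarrow> psum r (Suc i) = psum r i + r ! i"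
  by (simp add: psum_def take_Suc_conv_app_nth)

lemma psum_length [simp]: "psum r (length r) = sum_list r"
  by (simp add: psum_def)

lemma prod_lessThan_psum:
  fixes f :: "nat \<Rightarrow> 'b::comm_monoid_mult"
  shows "n \<le> length r \<Longrightarrow> (\<Prod>k<psum r n. f k) = (\<Prod>i<n. \<Prod>j<r ! i. f (psum r i + j))"
  by (induction n) (simp_all add: psum_Suc prod_lessThan_add)

text \<open>A Pascal recursion. Splitting off the factor \<open>i = 0\<close> replaces
  \<open>t\<close> by \<open>t ^ q\<close> in the remaining ones, which is why the exponents carry
  the scale \<open>s\<close>; the scale later also accounts for the parts that precede a given
  one.\<close>

lemma qt_binomial_dvd:
  fixes t :: "'b::comm_ring_1" and q :: nat
  assumes "k \<le> m"
  shows "(\<Prod>i<k. 1 - t ^ (s * (q ^ k - q ^ i))) dvd (\<Prod>i<k. 1 - t ^ (s * (q ^ m - q ^ i)))"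
  using assms
proof (induction m arbitrary: k s)
  case (Suc m)
  show ?case
  proof (cases "k = 0 \<or> k = Suc m")
    case False
    then obtain l where l: "k = Suc l" "Suc l \<le> m"
      using Suc.prems by (cases k) auto
    define N where "N = (\<lambda>s k m. \<Prod>i<k. 1 - t ^ (s * (q ^ m - q ^ i)))"
    have shift: "N s (Suc k) (Suc m) = (1 - t ^ (s * (q ^ Suc m - 1))) * N (s * q) k m" for s k m
      by (simp add: N_def prod.lessThan_Suc_shift right_diff_distrib' mult.assoc
        del: prod.lessThan_Suc)
    \<comment> \<open>This is \<open>1 - x * y = (1 - x) + x * (1 - y)\<close>, where
      \<open>1 - y\<close> is the factor that extends \<open>N (s * q) l m\<close> to
      \<open>N (s * q) k m\<close>.\<close>
    have split: "1 - t ^ (s * (q ^ Suc m - 1)) =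
        (1 - t ^ (s * (q ^ Suc l - 1))) + t ^ (s * (q ^ Suc l - 1)) * (1 - t ^ (s * q * (q ^ m - q ^ l)))"
    proof (cases "q = 0")
      case False
      then have "1 \<le> q ^ Suc l" "q ^ Suc l \<le> q ^ Suc m"
        using l by (auto intro!: power_increasing simp: Suc_le_eq simp del: power_Suc)
      then have "q ^ Suc m - 1 = (q ^ Suc l - 1) + q * (q ^ m - q ^ l)"
        by (simp add: right_diff_distrib')
      then show ?thesis
        by (simp add: right_diff_distrib power_add distrib_left mult.assoc)
    qed (use l in \<open>simp add: power_0_left\<close>)
    have "N s k (Suc m) = N s k k * 0 + (1 - t ^ (s * (q ^ Suc l - 1))) * N (s * q) l m +
        t ^ (s * (q ^ Suc l - 1)) * N (s * q) k m"
      unfolding l shift split by (simp add: N_def algebra_simps)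
    moreover have "N s k k dvd (1 - t ^ (s * (q ^ Suc l - 1))) * N (s * q) l m"
      unfolding l shift using Suc.IH[of l "s * q"] l by (intro mult_dvd_mono) (auto simp: N_def)
    moreover have "N s k k dvd t ^ (s * (q ^ Suc l - 1)) * N (s * q) k m"
    proof -
      have "N s k k dvd N (s * q) k k"
        unfolding N_def
      proof (rule prod_dvd_prod)
        fix i
        have "s * q * (q ^ k - q ^ i) = s * (q ^ k - q ^ i) * q" by simp
        then show "1 - t ^ (s * (q ^ k - q ^ i)) dvd 1 - t ^ (s * q * (q ^ k - q ^ i))"
          by (simp only: power_mult one_diff_power_eq[of "_ ^ _" q] dvd_triv_left)
      qed
      also have "N (s * q) k k dvd N (s * q) k m"
        using Suc.IH[of k "s * q"] l by (simp add: N_def)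
      finally show ?thesis by simp
    qed
    ultimately have "N s k k dvd N s k (Suc m)"
      by (metis add.commute add_0 dvd_add mult_zero_right)
    then show ?thesis by (simp add: N_def)
  qed auto
qed simp

lemma fps_of_poly_prod: "fps_of_poly (prod f A) = (\<Prod>i\<in>A. fps_of_poly (f i :: 'b::comm_ring_1 poly))"
  by (induction A rule: infinite_finite_induct) (simp_all add: fps_of_poly_mult)

lemma fps_of_poly_one_minus_monom:
  "fps_of_poly (1 - monom 1 k :: int poly) = 1 - fps_X ^ k"
  by (simp add: fps_of_poly_diff fps_of_poly_monom)

text \<open>The definition divides in \<open>int poly\<close>, so exact divisibility has to come
  first. It holds part by part: behind the partial sum \<open>P\<close>, one part contributes a
  binomial quotient in \<open>t ^ (q ^ P)\<close> with \<open>m - P\<close> in place of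
  \<open>m\<close>.\<close>

lemma fps_of_poly_qt_multinomial:
  assumes q: "2 \<le> q" and le: "sum_list \<beta> \<le> m"
  shows "fps_of_poly (qt_multinomial q m \<beta>) =
    (\<Prod>i<length \<beta>. numer_factor q m (psum \<beta> i) (\<beta> ! i) * hilb_factor q (psum \<beta> i) (\<beta> ! i))"
proof -
  define num :: "nat \<Rightarrow> int poly" where
    "num i = (\<Prod>j<\<beta> ! i. 1 - monom 1 (q ^ m - q ^ (psum \<beta> i + j)))" for i
  define den :: "nat \<Rightarrow> int poly" where
    "den i = (\<Prod>j<\<beta> ! i. 1 - monom 1 (q ^ psum \<beta> (Suc i) - q ^ (psum \<beta> i + j)))" for i
  have num: "fps_of_poly (num i) = numer_factor q m (psum \<beta> i) (\<beta> ! i)" for i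
    by (simp add: num_def numer_factor_def fps_of_poly_prod fps_of_poly_one_minus_monom)
  have den: "fps_of_poly (den i) * hilb_factor q (psum \<beta> i) (\<beta> ! i) = 1" if "i < length \<beta>" for i
    using hilb_factor_inverse[OF q] that
    by (simp add: den_def fps_of_poly_prod fps_of_poly_one_minus_monom psum_Suc)
  have "den i dvd num i" if i: "i < length \<beta>" for i
  proof -
    define P where "P = psum \<beta> i"
    have "P + \<beta> ! i \<le> sum_list \<beta>"
    proof -
      have "sum_list \<beta> = psum \<beta> (Suc i) + sum_list (drop (Suc i) \<beta>)"
        by (metis append_take_drop_id psum_def sum_list_append)
      then show ?thesis using i by (simp add: psum_Suc P_def)
    qed
    then have "\<beta> ! i \<le> m - P" and m: "m = P + (m - P)"
      using le by auto
    then have "(\<Prod>j<\<beta> ! i. 1 - monom 1 1 ^ (q ^ P * (q ^ (\<beta> ! i) - q ^ j))) dvd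
        (\<Prod>j<\<beta> ! i. 1 - (monom 1 1 :: int poly) ^ (q ^ P * (q ^ (m - P) - q ^ j)))"
      by (intro qt_binomial_dvd)
    moreover have "q ^ P * (q ^ (m - P) - q ^ j) = q ^ m - q ^ (P + j)" for j
      using m by (metis power_add right_diff_distrib')
    moreover have "q ^ P * (q ^ (\<beta> ! i) - q ^ j) = q ^ (P + \<beta> ! i) - q ^ (P + j)" for j
      by (simp add: power_add right_diff_distrib')
    ultimately show ?thesis
      using i by (simp add: den_def num_def P_def psum_Suc monom_power)
  qed
  then have "(\<Prod>i<length \<beta>. den i) dvd (\<Prod>i<length \<beta>. num i)"
    by (intro prod_dvd_prod) auto
  moreover have "(\<Prod>j<sum_list \<beta>. 1 - monom 1 (q ^ m - q ^ j)) = (\<Prod>i<length \<beta>. num i)"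
    using prod_lessThan_psum[of "length \<beta>" \<beta>] by (simp add: num_def)
  ultimately have "(\<Prod>i<length \<beta>. num i) = (\<Prod>i<length \<beta>. den i) * qt_multinomial q m \<beta>"
    by (simp add: qt_multinomial_def den_def)
  then have "(\<Prod>i<length \<beta>. numer_factor q m (psum \<beta> i) (\<beta> ! i)) =
      (\<Prod>i<length \<beta>. fps_of_poly (den i)) * fps_of_poly (qt_multinomial q m \<beta>)"
    unfolding num[symmetric] by (simp flip: fps_of_poly_prod fps_of_poly_mult)
  then have "(\<Prod>i<length \<beta>. numer_factor q m (psum \<beta> i) (\<beta> ! i) * hilb_factor q (psum \<beta> i) (\<beta> ! i)) =
      (\<Prod>i<length \<beta>. fps_of_poly (den i) * hilb_factor q (psum \<beta> i) (\<beta> ! i)) *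
      fps_of_poly (qt_multinomial q m \<beta>)"
    by (simp add: prod.distrib)
  also have "(\<Prod>i<length \<beta>. fps_of_poly (den i) * hilb_factor q (psum \<beta> i) (\<beta> ! i)) = 1"
    using den by (intro prod.neutral) auto
  finally show ?thesis by simp
qed

section \<open>The sum over weak compositions, one part at a time\<close>

text \<open>For \<open>B = 0\<close> this is the summand of \<open>C_poly\<close> at \<beta> as a
  power series. The product over parts and the offset are chosen so that removing the first part
  leaves a term of the same shape.\<close>

definition C_term :: "nat \<Rightarrow> nat \<Rightarrow> nat \<Rightarrow> nat list \<Rightarrow> nat list \<Rightarrow> int fps" where
  "C_term q m B \<alpha> \<beta> = (\<Prod>i<length \<alpha>.
     fps_X ^ ((\<alpha> ! i - \<beta> ! i) * (q ^ m - q ^ (B + psum \<beta> (Suc i)))) *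
     (numer_factor q m (B + psum \<beta> i) (\<beta> ! i) * hilb_factor q (B + psum \<beta> i) (\<beta> ! i)))"

lemma C_term_Cons:
  "C_term q m B (a # r) (b # \<beta>) = fps_X ^ ((a - b) * (q ^ m - q ^ (B + b))) *
     (numer_factor q m B b * hilb_factor q B b * C_term q m (B + b) r \<beta>)"
  by (simp add: C_term_def prod.lessThan_Suc_shift psum_Cons_Suc add.assoc mult.assoc
    del: prod.lessThan_Suc)

lemma weak_comps_below_Cons:
  "weak_comps_below (a # r) m = (\<Union>b\<in>{b. b \<le> a \<and> b \<le> m}. (#) b ` weak_comps_below r (m - b))"
proof (intro equalityI subsetI)
  fix \<gamma> assume g: "\<gamma> \<in> weak_comps_below (a # r) m"
  then obtain b \<beta> where c: "\<gamma> = b # \<beta>"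
    by (cases \<gamma>) (auto simp: weak_comps_below_def)
  have "b \<le> a" "\<forall>i<length r. \<beta> ! i \<le> r ! i"
    using g by (force simp: weak_comps_below_def c)+
  then show "\<gamma> \<in> (\<Union>b\<in>{b. b \<le> a \<and> b \<le> m}. (#) b ` weak_comps_below r (m - b))"
    using g by (force simp: weak_comps_below_def c)+
next
  fix \<gamma> assume "\<gamma> \<in> (\<Union>b\<in>{b. b \<le> a \<and> b \<le> m}. (#) b ` weak_comps_below r (m - b))"
  then show "\<gamma> \<in> weak_comps_below (a # r) m"
    by (auto simp: weak_comps_below_def less_Suc_eq_0_disj)
qed

lemma C_from_eq_sum:
  assumes "B \<le> m"
  shows "C_from q m B \<alpha> = (\<Sum>\<beta>\<in>weak_comps_below \<alpha> (m - B). C_term q m B \<alpha> \<beta>)"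
  using assms
proof (induction \<alpha> arbitrary: B)
  case Nil
  have "weak_comps_below [] (m - B) = {[]}"
    by (auto simp: weak_comps_below_def)
  then show ?case by (simp add: C_term_def)
next
  case (Cons a r)
  define I where "I = {b. b \<le> a \<and> b \<le> m - B}"
  have I: "{b. b \<le> a \<and> B + b \<le> m} = I" "finite I"
    using Cons.prems by (auto simp: I_def)
  have "(\<Sum>\<beta>\<in>weak_comps_below (a # r) (m - B). C_term q m B (a # r) \<beta>) =
      (\<Sum>b\<in>I. \<Sum>\<beta>\<in>(#) b ` weak_comps_below r (m - B - b). C_term q m B (a # r) \<beta>)"
    unfolding weak_comps_below_Cons I_def[symmetric]
    using I by (intro sum.UNION_disjoint) (auto simp: finite_weak_comps_below)
  also have "\<dots> = (\<Sum>b\<in>I. \<Sum>\<beta>\<in>weak_comps_below r (m - (B + b)). C_term q m B (a # r) (b # \<beta>))"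
    by (rule sum.cong) (simp_all add: sum.reindex)
  also have "\<dots> = (\<Sum>b\<in>I. fps_X ^ ((a - b) * (q ^ m - q ^ (B + b))) *
     (numer_factor q m B b * hilb_factor q B b * C_from q m (B + b) r))"
    unfolding C_term_Cons using Cons.IH Cons.prems
    by (intro sum.cong) (auto simp: I_def sum_distrib_left)
  finally show ?case
    using I by simp
qed

lemma fps_of_poly_C_poly:
  assumes "2 \<le> q"
  shows "fps_of_poly (C_poly q \<alpha> m) = C_from q m 0 \<alpha>"
proof -
  have "fps_of_poly (C_poly q \<alpha> m) = (\<Sum>\<beta>\<in>weak_comps_below \<alpha> m.
      fps_of_poly (monom 1 (e_exponent q m \<alpha> \<beta>) * qt_multinomial q m \<beta>))"
    by (simp add: C_poly_def fps_of_poly_sum)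
  also have "\<dots> = (\<Sum>\<beta>\<in>weak_comps_below \<alpha> m. C_term q m 0 \<alpha> \<beta>)"
  proof (intro sum.cong refl)
    fix \<beta> assume "\<beta> \<in> weak_comps_below \<alpha> m"
    then have b: "length \<beta> = length \<alpha>" "sum_list \<beta> \<le> m"
      by (auto simp: weak_comps_below_def)
    show "fps_of_poly (monom 1 (e_exponent q m \<alpha> \<beta>) * qt_multinomial q m \<beta>) = C_term q m 0 \<alpha> \<beta>"
      using b by (simp add: fps_of_poly_mult fps_of_poly_monom fps_of_poly_qt_multinomial[OF assms]
        C_term_def e_exponent_def power_sum prod.distrib)
  qed
  finally show ?thesis
    by (simp add: C_from_eq_sum)
qed

lemma hilbert_product_cong_C_poly:
  assumes "2 \<le> q" "composition \<alpha> n"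
  shows "fps_X ^ (q ^ m) dvd hilbert_product q \<alpha> - fps_of_poly (C_poly q \<alpha> m)"
proof -
  have "fps_cong (q ^ m) (C_from q m 0 \<alpha>) (hilb_from q 0 \<alpha>)"
    using assms by (intro C_from_cong_hilb_from) (auto simp: composition_def in_set_conv_nth)
  then show ?thesis
    unfolding hilbert_product_eq_hilb_from fps_of_poly_C_poly[OF assms(1)]
    using fps_cong_sym by (simp add: fps_cong_def)
qed

section \<open>Substitutions\<close>

lemma mconst_0 [simp]: "mconst 0 = 0"
  by (simp add: mconst_def)

lemma mconst_1 [simp]: "mconst (1 :: 'a::comm_semiring_1) = 1"
  by (simp add: mconst_def)

lemma mconst_add: "mconst (a + b :: 'a::comm_monoid_add) = mconst a + mconst b"
  by (simp add: mconst_def single_add)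

lemma mconst_mult: "mconst (a * b :: 'a::comm_semiring_1) = mconst a * mconst b"
  by (simp add: mconst_def mult_single)

lemma mconst_power: "mconst (a ^ k :: 'a::comm_semiring_1) = mconst a ^ k"
  by (induction k) (simp_all add: mconst_mult)

lemma mconst_uminus: "mconst (- a :: 'a::ab_group_add) = - mconst a"
  by (simp add: mconst_def single_uminus)

lemma mconst_eq_0_iff [simp]: "mconst a = 0 \<longleftrightarrow> a = 0"
proof
  assume "mconst a = 0"
  then have "Poly_Mapping.lookup (mconst a) 0 = 0" by simp
  then show "a = 0" by (simp add: mconst_def)
qed simp

lemma mconst_diff: "mconst (a - b :: 'a::ab_group_add) = mconst a - mconst b"
  by (simp add: mconst_def single_diff)

lemma mconst_inject [simp]: "mconst a = mconst b \<longleftrightarrow> a = (b :: 'a::ab_group_add)"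
  using mconst_eq_0_iff[of "a - b"] unfolding mconst_diff by simp

lemma mconst_eq_1_iff [simp]: "mconst a = 1 \<longleftrightarrow> a = (1 :: 'a::comm_ring_1)"
  using mconst_inject[of a 1] by simp

lemma single_eq_mconst_mult:
  "Poly_Mapping.single e (c :: 'a::comm_semiring_1) = mconst c * Poly_Mapping.single e 1"
  by (simp add: mconst_def mult_single)

lemma sum_single_lookup:
  fixes f :: "'b \<Rightarrow>\<^sub>0 'c::comm_monoid_add"
  assumes "finite A" "Poly_Mapping.keys f \<subseteq> A"
  shows "(\<Sum>e\<in>A. Poly_Mapping.single e (Poly_Mapping.lookup f e)) = f"
proof (rule poly_mapping_eqI)
  fix e
  have "Poly_Mapping.lookup (\<Sum>e\<in>A. Poly_Mapping.single e (Poly_Mapping.lookup f e)) e =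
      (\<Sum>e'\<in>A. if e' = e then Poly_Mapping.lookup f e else 0)"
    by (auto simp: lookup_sum lookup_single when_def intro!: sum.cong)
  also have "\<dots> = Poly_Mapping.lookup f e"
    using assms by (auto simp: not_in_keys_iff_lookup_eq_zero)
  finally show "Poly_Mapping.lookup (\<Sum>e\<in>A. Poly_Mapping.single e (Poly_Mapping.lookup f e)) e =
      Poly_Mapping.lookup f e" .
qed

lemma poly_mapping_induct_single [case_names single add]:
  fixes f :: "'b \<Rightarrow>\<^sub>0 'c::comm_monoid_add"
  assumes single: "\<And>e c. P (Poly_Mapping.single e c)"
    and add: "\<And>f g. P f \<Longrightarrow> P g \<Longrightarrow> P (f + g)"
  shows "P f"
proof -
  have "P (\<Sum>e\<in>A. Poly_Mapping.single e (Poly_Mapping.lookup f e))" if "finite A" for A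
    using that single[of undefined 0] by (induction A rule: finite_induct) (auto intro: assms)
  from this[of "Poly_Mapping.keys f"] show ?thesis
    by (simp add: sum_single_lookup)
qed

section \<open>Endomorphisms given by the images of the variables\<close>

definition mono_eval :: "(nat \<Rightarrow> 'b::comm_monoid_mult) \<Rightarrow> (nat \<Rightarrow>\<^sub>0 nat) \<Rightarrow> 'b" where
  "mono_eval h e = (\<Prod>j\<in>Poly_Mapping.keys e. h j ^ Poly_Mapping.lookup e j)"

lemma mono_eval_superset:
  "finite A \<Longrightarrow> Poly_Mapping.keys e \<subseteq> A \<Longrightarrow> mono_eval h e = (\<Prod>j\<in>A. h j ^ Poly_Mapping.lookup e j)"
  unfolding mono_eval_def
  by (rule prod.mono_neutral_left) (auto simp: not_in_keys_iff_lookup_eq_zero)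

lemma mono_eval_0 [simp]: "mono_eval h 0 = 1"
  by (simp add: mono_eval_def)

lemma mono_eval_single [simp]: "mono_eval h (Poly_Mapping.single i k) = h i ^ k"
  by (simp add: mono_eval_def)

lemma mono_eval_add: "mono_eval h (a + b) = mono_eval h a * mono_eval h b"
proof -
  let ?A = "Poly_Mapping.keys a \<union> Poly_Mapping.keys b"
  show ?thesis
    using keys_add[of a b]
    by (simp add: mono_eval_superset[of ?A] lookup_add power_add prod.distrib)
qed

lemma mono_eval_cong:
  "(\<And>j. j \<in> Poly_Mapping.keys e \<Longrightarrow> h j = k j) \<Longrightarrow> mono_eval h e = mono_eval k e"
  by (simp add: mono_eval_def)

lemma mono_eval_mvar: "mono_eval mvar e = (Poly_Mapping.single e 1 :: 'a::comm_semiring_1 mpoly)"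
proof -
  have var: "mvar i ^ k = (Poly_Mapping.single (Poly_Mapping.single i k) 1 :: 'a mpoly)" for i k
    by (induction k) (simp_all add: mvar_def mult_single flip: single_add)
  have "(\<Prod>j\<in>A. mvar j ^ Poly_Mapping.lookup e j) =
      (Poly_Mapping.single (\<Sum>j\<in>A. Poly_Mapping.single j (Poly_Mapping.lookup e j)) 1 :: 'a mpoly)"
    if "finite A" for A
    using that by (induction A rule: finite_induct) (simp_all add: var mult_single)
  then show ?thesis
    by (simp add: mono_eval_def sum_single_lookup)
qed

text \<open>Unlike in \<open>lin_subst\<close>, the images of the variables are arbitrary
  polynomials. Matrices, the removal of a variable and the retractions along linear forms are all of
  this kind, and so are their composites.\<close>

definition subst :: "(nat \<Rightarrow> 'a mpoly) \<Rightarrow> 'a::comm_ring_1 mpoly \<Rightarrow> 'a mpoly" where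
  "subst h f = (\<Sum>e\<in>Poly_Mapping.keys f. mconst (Poly_Mapping.lookup f e) * mono_eval h e)"

lemma subst_superset:
  "finite A \<Longrightarrow> Poly_Mapping.keys f \<subseteq> A \<Longrightarrow>
    subst h f = (\<Sum>e\<in>A. mconst (Poly_Mapping.lookup f e) * mono_eval h e)"
  unfolding subst_def
  by (rule sum.mono_neutral_left) (auto simp: not_in_keys_iff_lookup_eq_zero)

lemma subst_single [simp]: "subst h (Poly_Mapping.single e c) = mconst c * mono_eval h e"
  by (simp add: subst_def)

lemma subst_add: "subst h (f + g) = subst h f + subst h g"
proof -
  let ?A = "Poly_Mapping.keys f \<union> Poly_Mapping.keys g"
  show ?thesis
    using keys_add[of f g]
    by (simp add: subst_superset[of ?A] lookup_add mconst_add distrib_right sum.distrib)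
qed

lemma subst_0 [simp]: "subst h 0 = 0"
  by (simp add: subst_def)

lemma subst_mconst [simp]: "subst h (mconst c) = mconst c"
  unfolding mconst_def[of c] subst_single by (simp add: mconst_def)

lemma subst_1 [simp]: "subst h 1 = 1"
  using subst_mconst[of h 1] by simp

lemma subst_mvar [simp]: "subst h (mvar i) = h i"
  by (simp add: mvar_def)

lemma subst_mult: "subst h (f * g) = subst h f * subst h g"
proof (induction f rule: poly_mapping_induct_single)
  case (single e c)
  show ?case
  proof (induction g rule: poly_mapping_induct_single)
    case (single e' c')
    show ?case by (simp add: mult_single mono_eval_add mconst_mult)
  qed (simp add: distrib_left subst_add)
qed (simp add: distrib_right subst_add)

lemma subst_uminus: "subst h (- f) = - subst h f"
  using subst_add[of h f "- f"] minus_unique[of "subst h f" "subst h (- f)"] by simp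

lemma subst_diff: "subst h (f - g) = subst h f - subst h g"
  using subst_add[of h f "- g"] by (simp add: subst_uminus)

lemma subst_sum: "subst h (sum f A) = (\<Sum>x\<in>A. subst h (f x))"
  by (induction A rule: infinite_finite_induct) (simp_all add: subst_add)

lemma subst_prod: "subst h (prod f A) = (\<Prod>x\<in>A. subst h (f x))"
  by (induction A rule: infinite_finite_induct) (simp_all add: subst_mult)

lemma subst_power: "subst h (f ^ k) = subst h f ^ k"
  by (induction k) (simp_all add: subst_mult)

lemmas subst_simps = subst_add subst_mult subst_uminus subst_diff subst_sum subst_prod subst_power

text \<open>Constants and variables generate the ring, so identities between substitutions only have
  to be checked on variables.\<close>

lemma mpoly_induct [case_names const var add mult]:
  fixes f :: "'a::comm_ring_1 mpoly"
  assumes const: "\<And>c. P (mconst c)" and var: "\<And>i. P (mvar i)"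
    and add: "\<And>f g. P f \<Longrightarrow> P g \<Longrightarrow> P (f + g)" and mult: "\<And>f g. P f \<Longrightarrow> P g \<Longrightarrow> P (f * g)"
  shows "P f"
proof (induction f rule: poly_mapping_induct_single)
  case (single e c)
  have power: "P (mvar i ^ k)" for i k
    using const[of 1] by (induction k) (auto intro: var mult)
  have "P (\<Prod>j\<in>A. mvar j ^ Poly_Mapping.lookup e j)" if "finite A" for A
    using that const[of 1] by (induction A rule: finite_induct) (auto intro: power mult)
  then have "P (mono_eval mvar e)"
    by (simp add: mono_eval_def)
  then show ?case
    using const mult unfolding single_eq_mconst_mult[of e c] mono_eval_mvar by blast
qed (rule add)

lemma subst_subst: "subst h (subst k f) = subst (\<lambda>i. subst h (k i)) f"
  by (induction f rule: mpoly_induct) (simp_all add: subst_simps)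

lemma subst_subst_eq: "(\<And>i. subst h (k i) = l i) \<Longrightarrow> subst h (subst k f) = subst l f"
  by (simp add: subst_subst)

lemma subst_id [simp]: "subst mvar f = f"
  by (induction f rule: mpoly_induct) (simp_all add: subst_simps)

text \<open>Modulo \<open>a\<close> both substitutions are homomorphisms that agree on the
  generators; the product case telescopes.\<close>

lemma dvd_subst_diff:
  assumes "\<And>i. a dvd h i - k i"
  shows "a dvd subst h f - subst k f"
proof (induction f rule: mpoly_induct)
  case (add f g)
  then show ?case by (simp add: subst_add add_diff_add)
next
  case (mult f g)
  have "subst h (f * g) - subst k (f * g) =
      (subst h f - subst k f) * subst h g + subst k f * (subst h g - subst k g)"
    by (simp add: subst_mult algebra_simps)
  then show ?case using mult by simp
qed (use assms in simp_all)

lemma dvd_subst_self_diff: "(\<And>i. a dvd h i - mvar i) \<Longrightarrow> a dvd subst h f - f"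
  using dvd_subst_diff[of a h mvar f] by simp

section \<open>Subrings on finitely many variables\<close>

lemma poly_ring_subst_cong:
  assumes "f \<in> poly_ring n" "\<And>i. i < n \<Longrightarrow> h i = k i"
  shows "subst h f = subst k f"
  unfolding subst_def using assms
  by (intro sum.cong refl arg_cong2[of _ _ _ _ "(*)"] mono_eval_cong) (auto simp: poly_ring_def)

lemma poly_ring_add: "f \<in> poly_ring n \<Longrightarrow> g \<in> poly_ring n \<Longrightarrow> f + g \<in> poly_ring n"
  using keys_add[of f g] by (auto simp: poly_ring_def)

lemma poly_ring_mult:
  fixes f g :: "'a::comm_ring_1 mpoly"
  shows "f \<in> poly_ring n \<Longrightarrow> g \<in> poly_ring n \<Longrightarrow> f * g \<in> poly_ring n"
  unfolding poly_ring_def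
proof safe
  fix e i
  assume f: "\<forall>e\<in>Poly_Mapping.keys f. Poly_Mapping.keys e \<subseteq> {..<n}"
    and g: "\<forall>e\<in>Poly_Mapping.keys g. Poly_Mapping.keys e \<subseteq> {..<n}"
    and "e \<in> Poly_Mapping.keys (f * g)" and i: "i \<in> Poly_Mapping.keys e"
  then obtain a b where "e = a + b" "a \<in> Poly_Mapping.keys f" "b \<in> Poly_Mapping.keys g"
    using keys_mult[of f g] by blast
  then show "i < n"
    using f g i keys_add[of a b] by blast
qed

lemma poly_ring_mconst [simp]: "mconst c \<in> poly_ring n"
  by (simp add: poly_ring_def mconst_def)

lemma poly_ring_0 [simp]: "0 \<in> poly_ring n"
  by (simp add: poly_ring_def)

lemma poly_ring_1 [simp]: "(1 :: 'a::comm_ring_1 mpoly) \<in> poly_ring n"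
  by (simp add: poly_ring_def)

lemma poly_ring_mvar [simp]: "i < n \<Longrightarrow> (mvar i :: 'a::comm_ring_1 mpoly) \<in> poly_ring n"
  by (simp add: poly_ring_def mvar_def)

lemma poly_ring_sum:
  "(\<And>x. x \<in> A \<Longrightarrow> f x \<in> poly_ring n) \<Longrightarrow> sum f A \<in> poly_ring n"
  by (induction A rule: infinite_finite_induct) (auto intro: poly_ring_add)

lemma poly_ring_power: "f \<in> poly_ring n \<Longrightarrow> f ^ k \<in> poly_ring n"
  for f :: "'a::comm_ring_1 mpoly"
  by (induction k) (auto intro: poly_ring_mult)

lemma poly_ring_prod:
  fixes f :: "'b \<Rightarrow> 'a::comm_ring_1 mpoly"
  shows "(\<And>x. x \<in> A \<Longrightarrow> f x \<in> poly_ring n) \<Longrightarrow> prod f A \<in> poly_ring n"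
  by (induction A rule: infinite_finite_induct) (auto intro: poly_ring_mult)

lemma poly_ring_mono: "m \<le> n \<Longrightarrow> poly_ring m \<subseteq> poly_ring n"
  unfolding poly_ring_def by force

lemma poly_ring_subst:
  assumes "f \<in> poly_ring m" "\<And>i. i < m \<Longrightarrow> h i \<in> poly_ring n"
  shows "subst h f \<in> poly_ring n"
  unfolding subst_def mono_eval_def
proof (intro poly_ring_sum poly_ring_mult poly_ring_prod poly_ring_power poly_ring_mconst)
  fix e i assume "e \<in> Poly_Mapping.keys f" "i \<in> Poly_Mapping.keys e"
  then have "i < m"
    using assms(1) by (auto simp: poly_ring_def)
  then show "h i \<in> poly_ring n" by (rule assms(2))
qed

text \<open>Membership becomes a fixed-point equation for a ring endomorphism, and such an equation
  passes to cofactors in a domain. The backward direction uses that every polynomial lies in some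
  \<open>poly_ring m\<close>.\<close>

lemma poly_ring_iff_subst:
  fixes f :: "'a::comm_ring_1 mpoly"
  shows "f \<in> poly_ring n \<longleftrightarrow> subst (\<lambda>i. if i < n then mvar i else 0) f = f"
proof
  assume "f \<in> poly_ring n"
  then have "subst (\<lambda>i. if i < n then mvar i else 0) f = subst mvar f"
    by (rule poly_ring_subst_cong) simp
  then show "subst (\<lambda>i. if i < n then mvar i else 0) f = f" by simp
next
  have "\<exists>m. f \<in> poly_ring m"
  proof (induction f rule: mpoly_induct)
    case (var i)
    then show ?case using poly_ring_mvar[of i "Suc i"] by blast
  next
    case (add f g)
    then obtain m k where "f \<in> poly_ring m" "g \<in> poly_ring k" by blast
    then have "f \<in> poly_ring (max m k)" "g \<in> poly_ring (max m k)"
      using poly_ring_mono[of m "max m k"] poly_ring_mono[of k "max m k"] by auto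
    then show ?case by (blast intro: poly_ring_add)
  next
    case (mult f g)
    then obtain m k where "f \<in> poly_ring m" "g \<in> poly_ring k" by blast
    then have "f \<in> poly_ring (max m k)" "g \<in> poly_ring (max m k)"
      using poly_ring_mono[of m "max m k"] poly_ring_mono[of k "max m k"] by auto
    then show ?case by (blast intro: poly_ring_mult)
  qed auto
  then obtain m where "f \<in> poly_ring m" by blast
  then have "subst (\<lambda>i. if i < n then mvar i else 0) f \<in> poly_ring n"
    by (rule poly_ring_subst) auto
  moreover assume "subst (\<lambda>i. if i < n then mvar i else 0) f = f"
  ultimately show "f \<in> poly_ring n" by simp
qed

lemma poly_ring_cancel:
  fixes f g :: "'a::field mpoly"
  assumes "f * g \<in> poly_ring n" "f \<in> poly_ring n" "f \<noteq> 0"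
  shows "g \<in> poly_ring n"
proof -
  let ?s = "subst (\<lambda>i. if i < n then mvar i else 0)"
  have "f * ?s g = ?s f * ?s g"
    using assms(2) by (simp add: poly_ring_iff_subst)
  also have "\<dots> = f * g"
    using assms(1) by (simp add: poly_ring_iff_subst subst_mult)
  finally show ?thesis
    using assms(3) by (simp add: poly_ring_iff_subst)
qed

section \<open>Degrees and homogeneous components\<close>

lemma mono_degree_superset:
  "finite A \<Longrightarrow> Poly_Mapping.keys e \<subseteq> A \<Longrightarrow> mono_degree e = (\<Sum>j\<in>A. Poly_Mapping.lookup e j)"
  unfolding mono_degree_def
  by (rule sum.mono_neutral_left) (auto simp: not_in_keys_iff_lookup_eq_zero)

lemma mono_degree_add: "mono_degree (a + b) = mono_degree a + mono_degree b"
proof -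
  let ?A = "Poly_Mapping.keys a \<union> Poly_Mapping.keys b"
  show ?thesis
    using keys_add[of a b]
    by (simp add: mono_degree_superset[of ?A] lookup_add sum.distrib)
qed

lemma mono_degree_0 [simp]: "mono_degree 0 = 0"
  by (simp add: mono_degree_def)

lemma mono_degree_single [simp]: "mono_degree (Poly_Mapping.single i k) = k"
  by (simp add: mono_degree_def)

lemma homogeneous_0 [simp]: "homogeneous d 0"
  by (simp add: homogeneous_def)

lemma homogeneous_single: "homogeneous (mono_degree e) (Poly_Mapping.single e c)"
  by (simp add: homogeneous_def)

lemma homogeneous_mconst [simp]: "homogeneous 0 (mconst c)"
  using homogeneous_single[of 0 c] by (simp add: mconst_def)

lemma homogeneous_1 [simp]: "homogeneous 0 (1 :: 'a::comm_ring_1 mpoly)"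
  using homogeneous_mconst[of "1 :: 'a"] by simp

lemma homogeneous_mvar [simp]: "homogeneous (Suc 0) (mvar i)"
  using homogeneous_single[of "Poly_Mapping.single i 1" 1] by (simp add: mvar_def)

lemma homogeneous_add: "homogeneous d f \<Longrightarrow> homogeneous d g \<Longrightarrow> homogeneous d (f + g)"
  using keys_add[of f g] by (auto simp: homogeneous_def)

lemma homogeneous_sum: "(\<And>x. x \<in> A \<Longrightarrow> homogeneous d (f x)) \<Longrightarrow> homogeneous d (sum f A)"
  by (induction A rule: infinite_finite_induct) (auto intro: homogeneous_add)

lemma homogeneous_mult:
  fixes f g :: "'a::comm_ring_1 mpoly"
  shows "homogeneous d f \<Longrightarrow> homogeneous k g \<Longrightarrow> homogeneous (d + k) (f * g)"
  unfolding homogeneous_def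
proof
  fix e
  assume f: "\<forall>e\<in>Poly_Mapping.keys f. mono_degree e = d"
    and g: "\<forall>e\<in>Poly_Mapping.keys g. mono_degree e = k"
    and "e \<in> Poly_Mapping.keys (f * g)"
  then obtain a b where "e = a + b" "a \<in> Poly_Mapping.keys f" "b \<in> Poly_Mapping.keys g"
    using keys_mult[of f g] by blast
  then show "mono_degree e = d + k"
    using f g by (simp add: mono_degree_add)
qed

lemma homogeneous_mconst_mult: "homogeneous d f \<Longrightarrow> homogeneous d (mconst c * f)"
  for f :: "'a::comm_ring_1 mpoly"
  using homogeneous_mult[of 0 "mconst c" d f] by simp

lemma homogeneous_uminus: "homogeneous d f \<Longrightarrow> homogeneous d (- f)"
  for f :: "'a::comm_ring_1 mpoly"
  using homogeneous_mconst_mult[of d f "-1"] by (simp add: mconst_uminus)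

lemma homogeneous_diff: "homogeneous d f \<Longrightarrow> homogeneous d g \<Longrightarrow> homogeneous d (f - g)"
  for f g :: "'a::comm_ring_1 mpoly"
  using homogeneous_add[of d f "- g"] homogeneous_uminus[of d g] by simp

lemma homogeneous_power: "homogeneous d f \<Longrightarrow> homogeneous (k * d) (f ^ k)"
  for f :: "'a::comm_ring_1 mpoly"
  by (induction k) (auto intro: homogeneous_mult)

lemma homogeneous_prod:
  fixes f :: "'b \<Rightarrow> 'a::comm_ring_1 mpoly"
  shows "(\<And>x. x \<in> A \<Longrightarrow> homogeneous (d x) (f x)) \<Longrightarrow> homogeneous (sum d A) (prod f A)"
  by (induction A rule: infinite_finite_induct) (auto intro: homogeneous_mult)

lemma homogeneous_subst:
  assumes "homogeneous d f" "\<And>i. homogeneous 1 (h i)"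
  shows "homogeneous d (subst h f)"
  unfolding subst_def mono_eval_def
proof (intro homogeneous_sum homogeneous_mconst_mult)
  fix e assume "e \<in> Poly_Mapping.keys f"
  then have d: "d = (\<Sum>j\<in>Poly_Mapping.keys e. Poly_Mapping.lookup e j * 1)"
    using assms(1) by (simp add: homogeneous_def mono_degree_def)
  show "homogeneous d (\<Prod>j\<in>Poly_Mapping.keys e. h j ^ Poly_Mapping.lookup e j)"
    unfolding d by (intro homogeneous_prod homogeneous_power assms)
qed

definition hom_part :: "nat \<Rightarrow> 'a::comm_ring_1 mpoly \<Rightarrow> 'a mpoly" where
  "hom_part d f = (\<Sum>e\<in>Poly_Mapping.keys f.
     if mono_degree e = d then Poly_Mapping.single e (Poly_Mapping.lookup f e) else 0)"

lemma lookup_hom_part: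
  "Poly_Mapping.lookup (hom_part d f) e = (if mono_degree e = d then Poly_Mapping.lookup f e else 0)"
proof -
  have "Poly_Mapping.lookup (hom_part d f) e = (\<Sum>e'\<in>Poly_Mapping.keys f.
      if e' = e then if mono_degree e = d then Poly_Mapping.lookup f e else 0 else 0)"
    unfolding hom_part_def lookup_sum by (rule sum.cong) (auto simp: lookup_single when_def)
  then show ?thesis
    by (simp add: not_in_keys_iff_lookup_eq_zero)
qed

lemma hom_part_add: "hom_part d (f + g) = hom_part d f + hom_part d g"
  by (rule poly_mapping_eqI) (simp add: lookup_hom_part lookup_add)

lemma hom_part_single:
  "hom_part d (Poly_Mapping.single e c) = (if mono_degree e = d then Poly_Mapping.single e c else 0)"
  by (rule poly_mapping_eqI) (auto simp: lookup_hom_part lookup_single when_def)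

lemma homogeneous_iff_hom_part: "homogeneous d f \<longleftrightarrow> hom_part d f = f"
proof
  assume "homogeneous d f"
  then show "hom_part d f = f"
    by (intro poly_mapping_eqI) (auto simp: lookup_hom_part homogeneous_def in_keys_iff)
next
  assume *: "hom_part d f = f"
  show "homogeneous d f"
    unfolding homogeneous_def
  proof
    fix e assume "e \<in> Poly_Mapping.keys f"
    then have "Poly_Mapping.lookup (hom_part d f) e \<noteq> 0"
      by (simp add: * in_keys_iff)
    then show "mono_degree e = d"
      by (simp add: lookup_hom_part split: if_splits)
  qed
qed

lemma hom_part_mult_single:
  "hom_part d (Poly_Mapping.single e c * g) =
    (if mono_degree e \<le> d then Poly_Mapping.single e c * hom_part (d - mono_degree e) g else 0)"
proof (induction g rule: poly_mapping_induct_single)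
  case (single e' c')
  show ?case
    by (auto simp: mult_single hom_part_single mono_degree_add)
qed (simp add: distrib_left hom_part_add)

lemma hom_part_mult:
  assumes "homogeneous k f"
  shows "hom_part d (f * g) = (if k \<le> d then f * hom_part (d - k) g else 0)"
proof -
  have "hom_part d ((\<Sum>e\<in>A. Poly_Mapping.single e (Poly_Mapping.lookup f e)) * g) =
     (if k \<le> d then (\<Sum>e\<in>A. Poly_Mapping.single e (Poly_Mapping.lookup f e)) * hom_part (d - k) g else 0)"
    if "A \<subseteq> Poly_Mapping.keys f" for A
    using finite_subset[OF that finite_keys] that
  proof (induction A rule: finite_induct)
    case empty
    then show ?case by (simp add: hom_part_def)
  next
    case (insert e A)
    then have "mono_degree e = k"
      using assms by (simp add: homogeneous_def)
    then show ?case
      using insert by (simp add: distrib_right hom_part_add hom_part_mult_single)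
  qed
  from this[of "Poly_Mapping.keys f"] show ?thesis
    by (simp add: sum_single_lookup)
qed

text \<open>Taking the component of degree \<open>d\<close> of \<open>f * g\<close> yields
  \<open>f * hom_part (d - k) g = f * g\<close>, and \<open>f\<close> cancels.\<close>

lemma homogeneous_cancel:
  fixes f g :: "'a::field mpoly"
  assumes "homogeneous d (f * g)" "homogeneous k f" "f \<noteq> 0"
  shows "g = 0 \<or> k \<le> d \<and> homogeneous (d - k) g"
proof -
  have *: "(if k \<le> d then f * hom_part (d - k) g else 0) = f * g"
    using assms(1) unfolding homogeneous_iff_hom_part hom_part_mult[OF assms(2)] .
  show ?thesis
  proof (cases "k \<le> d")
    case True
    then have "hom_part (d - k) g = g"
      using * assms(3) by simp
    then show ?thesis
      using True by (simp add: homogeneous_iff_hom_part)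
  qed (use * assms(3) in simp)
qed

section \<open>Divisibility by a product of primes\<close>

lemma prime_elem_power_dvd_mult:
  fixes p :: "'b::idom"
  assumes p: "prime_elem p" "\<not> p dvd a" and "p ^ k dvd a * b"
  shows "p ^ k dvd b"
  using assms(3)
proof (induction k arbitrary: b)
  case (Suc k)
  have "p dvd a * b"
    using Suc.prems dvd_mult_left[of p "p ^ k"] by simp
  then obtain c where c: "b = p * c"
    using p by (auto simp: prime_elem_dvd_mult_iff)
  then have "p * p ^ k dvd p * (a * c)"
    using Suc.prems by (simp add: ac_simps)
  moreover have "p \<noteq> 0"
    using p(1) by auto
  ultimately have "p ^ k dvd a * c"
    by (simp only: dvd_mult_cancel_left simp_thms)
  then have "p ^ k dvd c" by (rule Suc.IH)
  then show ?case by (simp add: c)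
qed simp

text \<open>Members of \<open>T\<close> may be associated, like the scalar multiples of a linear
  form. Between primes \<open>v dvd w\<close> means being associated, so the exponent in the
  hypothesis is the multiplicity of \<open>v\<close> in the product. The induction divides
  \<open>p\<close> by one member, which lowers the multiplicity of its associates by one.\<close>

lemma prod_primes_dvd:
  fixes p :: "'b::idom"
  assumes "finite T" "\<And>v. v \<in> T \<Longrightarrow> prime_elem v"
    and "\<And>v. v \<in> T \<Longrightarrow> v ^ card {w \<in> T. v dvd w} dvd p"
  shows "\<Prod>T dvd p"
  using assms
proof (induction T arbitrary: p rule: finite_induct)
  case (insert v T)
  have "v dvd v ^ card {w \<in> insert v T. v dvd w}"
    using insert.hyps by (intro dvd_power) (auto simp: card_gt_0_iff)
  also have "\<dots> dvd p"
    using insert.prems by blast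
  finally obtain p' where p': "p = v * p'" by blast
  have v: "prime_elem v" "v \<noteq> 0"
    using insert.prems(1)[of v] by auto
  have "\<Prod>T dvd p'"
  proof (rule insert.IH)
    fix w assume w: "w \<in> T"
    then have prime: "prime_elem w" and dvd: "w ^ card {u \<in> insert v T. w dvd u} dvd v * p'"
      using insert.prems p' by auto
    show "w ^ card {u \<in> T. w dvd u} dvd p'"
    proof (cases "w dvd v")
      case True
      have "{u \<in> insert v T. w dvd u} = insert v {u \<in> T. w dvd u}"
        using True by auto
      then have dvd': "w * w ^ card {u \<in> T. w dvd u} dvd v * p'"
        using dvd insert.hyps by simp
      obtain u where u: "v = w * u"
        using True by blast
      \<comment> \<open>Otherwise \<open>w\<close> would be a unit. Hence the prime \<open>v\<close>
        divides \<open>w\<close>, and a factor \<open>w\<close> can be traded for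
        \<open>v\<close>.\<close>
      have "\<not> v dvd u"
      proof
        assume "v dvd u"
        then obtain c where c: "u = v * c" by blast
        have "v * (w * c) = w * (v * c)" by (simp only: ac_simps)
        also have "\<dots> = v * 1"
          by (simp only: flip: c u) simp
        finally have "w * c = 1"
          using v by simp
        then show False
          using prime_elem_not_unit[OF prime] by (metis dvd_triv_left)
      qed
      then have "v dvd w"
        using prime_elem_dvd_multD[OF v(1), of w u] u by simp
      then have "v * w ^ card {u \<in> T. w dvd u} dvd w * w ^ card {u \<in> T. w dvd u}"
        by (rule mult_dvd_mono) simp
      then have "v * w ^ card {u \<in> T. w dvd u} dvd v * p'"
        using dvd' by (rule dvd_trans)
      then show ?thesis using v by simp
    next
      case False
      then have "{u \<in> insert v T. w dvd u} = {u \<in> T. w dvd u}"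
        by auto
      then have "w ^ card {u \<in> T. w dvd u} dvd v * p'"
        using dvd by simp
      then show ?thesis
        by (rule prime_elem_power_dvd_mult[OF prime False])
    qed
  qed (rule insert.prems(1), simp)
  then show ?case
    using insert.hyps by (simp add: p')
qed simp

section \<open>Linear forms and Dickson invariants over a finite field\<close>

lemma card_field_ge_2: "2 \<le> CARD('a::{field,finite})"
proof -
  have "card {0, 1 :: 'a} \<le> CARD('a)"
    by (intro card_mono) auto
  then show ?thesis by simp
qed

text \<open>Multiplication by \<open>c\<close> permutes the nonzero elements, so it leaves their
  product unchanged while multiplying it by \<open>c ^ (q - 1)\<close>.\<close>

lemma power_card_field_minus_1:
  fixes c :: "'a::{field,finite}"
  assumes "c \<noteq> 0"
  shows "c ^ (CARD('a) - 1) = 1"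
proof -
  let ?U = "UNIV - {0 :: 'a}"
  have "(*) c ` ?U = ?U"
  proof (rule endo_inj_surj)
    show "(*) c ` ?U \<subseteq> ?U" using assms by auto
    show "inj_on ((*) c) ?U" using assms by (simp add: inj_on_def)
  qed simp
  then have "\<Prod>?U = (\<Prod>x\<in>(*) c ` ?U. x)"
    by simp
  also have "\<dots> = (\<Prod>x\<in>?U. c * x)"
    using assms by (intro prod.reindex_cong[where l = "(*) c"]) (auto simp: inj_on_def)
  also have "\<dots> = c ^ (CARD('a) - 1) * \<Prod>?U"
    by (simp add: prod.distrib card_Diff_singleton)
  finally show ?thesis
    by simp
qed

lemma power_card_field:
  fixes c :: "'a::{field,finite}"
  shows "c ^ CARD('a) = c"
proof (cases "c = 0")
  case False
  have "c ^ CARD('a) = c ^ Suc (CARD('a) - 1)"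
    using card_field_ge_2[where 'a = 'a] by simp
  also have "\<dots> = c"
    unfolding power_Suc power_card_field_minus_1[OF False] by simp
  finally show ?thesis .
qed (use card_field_ge_2[where 'a = 'a] in \<open>simp add: power_0_left\<close>)

text \<open>All nonzero field elements are roots of the polynomial \<open>P\<close>, whose degree is
  at most \<open>k\<close>.\<close>

lemma power_eq_1_imp_card_le:
  assumes "0 < k" and "\<And>c :: 'a::{field,finite}. c \<noteq> 0 \<Longrightarrow> c ^ k = 1"
  shows "CARD('a) - 1 \<le> k"
proof -
  define P :: "'a poly" where "P = monom 1 k - 1"
  have "coeff P k \<noteq> 0"
    using assms(1) by (simp add: P_def)
  then have P: "P \<noteq> 0" by auto
  have "degree P \<le> k"
    unfolding P_def by (intro degree_diff_le) (auto simp: degree_monom_le)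
  have "UNIV - {0} \<subseteq> {x. poly P x = 0}"
    using assms(2) by (auto simp: P_def poly_monom)
  then have "card (UNIV - {0 :: 'a}) \<le> card {x. poly P x = 0}"
    by (intro card_mono poly_roots_finite P)
  also have "\<dots> \<le> degree P"
    by (rule card_poly_roots_bound[OF P])
  finally show ?thesis
    using \<open>degree P \<le> k\<close> by (simp add: card_Diff_singleton)
qed

text \<open>The polynomial \<open>(x + 1)\<^sup>q - x\<^sup>q - 1\<close> has degree less than \<open>q\<close> and vanishes on the field.\<close>

lemma of_nat_card_field_choose:
  assumes "0 < i" "i < CARD('a)"
  shows "of_nat (CARD('a) choose i) = (0 :: 'a::{field,finite})"
proof -
  define q where "q = CARD('a)"
  have q: "0 < q"
    using assms by (simp add: q_def)
  define P :: "'a poly" where "P = [:1, 1:] ^ q - monom 1 q - 1"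
  have coeff: "coeff ([:1, 1:] ^ q :: 'a poly) j = of_nat (q choose j)" for j
  proof -
    have "[:1, 1 :: 'a:] = monom 1 1 + 1"
      by (simp add: monom_Suc one_pCons)
    then have "[:1, 1:] ^ q = (\<Sum>k\<le>q. of_nat (q choose k) * monom (1 :: 'a) 1 ^ k)"
      by (simp add: binomial_ring)
    also have "\<dots> = (\<Sum>k\<le>q. monom (of_nat (q choose k)) k)"
      by (simp add: monom_power of_nat_poly smult_monom)
    finally have "coeff ([:1, 1:] ^ q) j =
        (\<Sum>k\<le>q. if k = j then of_nat (q choose j) else (0 :: 'a))"
      by (auto simp: coeff_sum intro!: sum.cong)
    then show ?thesis
      by (simp add: binomial_eq_0)
  qed
  have "P = 0"
  proof (rule ccontr)
    assume P: "P \<noteq> 0"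
    have "coeff P j = 0" if "q \<le> j" for j
      using that q by (cases "j = q") (simp_all add: P_def coeff binomial_eq_0)
    then have "degree P \<le> q - 1"
      by (intro degree_le) auto
    moreover have "poly P x = 0" for x
      using power_card_field[of x] power_card_field[of "1 + x"] by (simp add: P_def poly_monom q_def)
    then have "card {x. poly P x = 0} = q"
      by (simp add: q_def)
    ultimately show False
      using card_poly_roots_bound[OF P] q by simp
  qed
  then have "coeff P i = 0" by simp
  then show ?thesis
    using assms coeff[of i] by (simp add: P_def q_def)
qed

text \<open>Only the two outer terms of the binomial theorem survive. The general ring covers both
  \<open>mpoly\<close> and univariate polynomials over it.\<close>

lemma power_add_of_choose_eq_0:
  fixes a b :: "'b::comm_ring_1"
  assumes "0 < k" "\<And>i. 0 < i \<Longrightarrow> i < k \<Longrightarrow> of_nat (k choose i) = (0 :: 'b)"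
  shows "(a + b) ^ k = a ^ k + b ^ k"
proof -
  have "(a + b) ^ k = (\<Sum>i\<le>k. of_nat (k choose i) * a ^ i * b ^ (k - i))"
    by (rule binomial_ring)
  also have "\<dots> = (\<Sum>i\<in>{0, k}. of_nat (k choose i) * a ^ i * b ^ (k - i))"
  proof (rule sum.mono_neutral_right)
    show "\<forall>i\<in>{..k} - {0, k}. of_nat (k choose i) * a ^ i * b ^ (k - i) = 0"
      using assms(2) by auto
  qed auto
  also have "\<dots> = a ^ k + b ^ k"
    using assms(1) by simp
  finally show ?thesis .
qed

lemma of_nat_mpoly: "(of_nat k :: 'a::comm_ring_1 mpoly) = mconst (of_nat k)"
  by (simp add: mconst_def)

lemma mpoly_power_card_add:
  fixes f g :: "'a::{field,finite} mpoly"
  shows "(f + g) ^ CARD('a) = f ^ CARD('a) + g ^ CARD('a)"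
  by (rule power_add_of_choose_eq_0) (simp_all add: of_nat_mpoly of_nat_card_field_choose)

lemma mpoly_poly_power_card_add:
  fixes f g :: "'a::{field,finite} mpoly poly"
  shows "(f + g) ^ CARD('a) = f ^ CARD('a) + g ^ CARD('a)"
  by (rule power_add_of_choose_eq_0) (simp_all add: of_nat_poly of_nat_mpoly of_nat_card_field_choose)

lemma mpoly_power_card_sum:
  fixes f :: "'b \<Rightarrow> 'a::{field,finite} mpoly"
  shows "sum f A ^ CARD('a) = (\<Sum>x\<in>A. f x ^ CARD('a))"
  by (induction A rule: infinite_finite_induct) (simp_all add: mpoly_power_card_add)

lemma mconst_power_card: "mconst c ^ CARD('a) = mconst (c :: 'a::{field,finite})"
  by (simp add: power_card_field flip: mconst_power)

lemma mpoly_power_card_diff: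
  fixes f g :: "'a::{field,finite} mpoly"
  shows "(f - g) ^ CARD('a) = f ^ CARD('a) - g ^ CARD('a)"
  using mpoly_power_card_add[of "f - g" g] by simp

lemma mpoly_power_card_inj:
  fixes f g :: "'a::{field,finite} mpoly"
  assumes "f ^ CARD('a) = g ^ CARD('a)"
  shows "f = g"
proof -
  have "(f - g) ^ CARD('a) = 0"
    using assms by (simp add: mpoly_power_card_diff)
  then show ?thesis by simp
qed

text \<open>By additivity the q-th power acts on each term separately, so no other term reaches the
  exponent \<open>q * i\<close>.\<close>

lemma coeff_power_card:
  fixes P :: "'a::{field,finite} mpoly poly"
  shows "coeff (P ^ CARD('a)) (CARD('a) * i) = coeff P i ^ CARD('a)"
proof -
  have sum: "sum f A ^ CARD('a) = (\<Sum>x\<in>A. f x ^ CARD('a))"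
    for f :: "nat \<Rightarrow> 'a mpoly poly" and A
    by (induction A rule: infinite_finite_induct) (simp_all add: mpoly_poly_power_card_add)
  have "P ^ CARD('a) = (\<Sum>j\<le>degree P. monom (coeff P j) j) ^ CARD('a)"
    by (simp add: poly_as_sum_of_monoms)
  also have "\<dots> = (\<Sum>j\<le>degree P. monom (coeff P j ^ CARD('a)) (CARD('a) * j))"
    unfolding sum monom_power by (simp add: mult.commute)
  finally have "coeff (P ^ CARD('a)) (CARD('a) * i) =
      (\<Sum>j\<le>degree P. if j = i then coeff P i ^ CARD('a) else 0)"
    by (auto simp: coeff_sum intro!: sum.cong)
  also have "\<dots> = coeff P i ^ CARD('a)"
    by (auto simp: coeff_eq_0)
  finally show ?thesis .
qed

section \<open>Spaces of linear forms\<close>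

definition lin_forms :: "nat \<Rightarrow> 'a::field mpoly set" where
  "lin_forms m = mpoly.span (mvar ` {..<m})"

lemma mpoly_scale_eq: "mpoly_scale c f = mconst c * f"
  by (simp add: mpoly_scale_def)

lemma module_hom_subst: "module_hom mpoly_scale mpoly_scale (subst h)"
  by unfold_locales (simp_all add: subst_simps mpoly_scale_eq)

lemma subspace_poly_ring: "mpoly.subspace (poly_ring n)"
  by (auto simp: mpoly.subspace_def mpoly_scale_eq intro: poly_ring_add poly_ring_mult)

lemma subspace_homogeneous: "mpoly.subspace {f. homogeneous d f}"
  by (auto simp: mpoly.subspace_def mpoly_scale_eq intro: homogeneous_add homogeneous_mconst_mult)

lemma lin_forms_0 [simp]: "lin_forms 0 = {0}"
  by (simp add: lin_forms_def)

lemma zero_in_lin_forms [simp]: "0 \<in> lin_forms m"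
  by (simp add: lin_forms_def mpoly.span_zero)

lemma mvar_in_lin_forms: "i < m \<Longrightarrow> mvar i \<in> lin_forms m"
  by (simp add: lin_forms_def mpoly.span_base)

lemma lin_forms_add: "v \<in> lin_forms m \<Longrightarrow> w \<in> lin_forms m \<Longrightarrow> v + w \<in> lin_forms m"
  by (simp add: lin_forms_def mpoly.span_add)

lemma lin_forms_mconst_mult: "v \<in> lin_forms m \<Longrightarrow> mconst c * v \<in> lin_forms m"
  unfolding lin_forms_def mpoly_scale_eq[symmetric] by (rule mpoly.span_scale)

lemma lin_forms_sum: "(\<And>x. x \<in> A \<Longrightarrow> f x \<in> lin_forms m) \<Longrightarrow> sum f A \<in> lin_forms m"
  unfolding lin_forms_def by (rule mpoly.span_sum)

lemma lin_forms_subset_poly_ring: "lin_forms m \<subseteq> poly_ring m"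
  unfolding lin_forms_def by (intro mpoly.span_minimal subspace_poly_ring) auto

lemma homogeneous_lin_forms: "v \<in> lin_forms m \<Longrightarrow> homogeneous 1 v"
proof -
  have "lin_forms m \<subseteq> {f. homogeneous 1 f}"
    unfolding lin_forms_def by (intro mpoly.span_minimal subspace_homogeneous) auto
  then show "v \<in> lin_forms m \<Longrightarrow> homogeneous 1 v" by auto
qed

lemma subst_lin_forms:
  assumes "\<And>i. i < m \<Longrightarrow> h i \<in> lin_forms k" "v \<in> lin_forms m"
  shows "subst h v \<in> lin_forms k"
proof -
  have "mpoly.subspace {v. subst h v \<in> lin_forms k}"
    by (auto simp: mpoly.subspace_def mpoly_scale_eq subst_simps
      intro: lin_forms_add lin_forms_mconst_mult)
  then have "lin_forms m \<subseteq> {v. subst h v \<in> lin_forms k}"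
    unfolding lin_forms_def[of m] using assms(1) by (intro mpoly.span_minimal) auto
  then show ?thesis using assms(2) by blast
qed

text \<open>The specialization \<open>x_0 = 0\<close> together with a renumbering, so that the
  result again uses the variables from index 0 on.\<close>

definition drop_var :: "nat \<Rightarrow> 'a::comm_ring_1 mpoly" where
  "drop_var i = (case i of 0 \<Rightarrow> 0 | Suc j \<Rightarrow> mvar j)"

lemma drop_var_simps [simp]: "drop_var 0 = 0" "drop_var (Suc j) = mvar j"
  by (simp_all add: drop_var_def)

text \<open>Parametrizes the fibres of \<open>drop_var\<close> on linear forms: the first component
  is the coefficient of \<open>x_0\<close>, which \<open>drop_var\<close> forgets, so each fibre is
  a copy of the field.\<close>

definition cons_lin_form :: "'a \<times> 'a mpoly \<Rightarrow> 'a::field mpoly" where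
  "cons_lin_form = (\<lambda>(c, v). mconst c * mvar 0 + subst (\<lambda>i. mvar (Suc i)) v)"

lemma subst_drop_var_cons_lin_form [simp]: "subst drop_var (cons_lin_form x) = snd x"
  by (cases x) (simp add: cons_lin_form_def subst_simps subst_subst)

lemma inj_cons_lin_form: "inj_on (cons_lin_form :: 'a::field \<times> 'a mpoly \<Rightarrow> _) A"
proof (rule inj_onI, clarify)
  fix c c' :: 'a and v v' :: "'a mpoly"
  assume eq: "cons_lin_form (c, v) = cons_lin_form (c', v')"
  then have "v = v'"
    by (metis snd_conv subst_drop_var_cons_lin_form)
  then have "mconst c * mvar 0 = mconst c' * (mvar 0 :: 'a mpoly)"
    using eq by (simp add: cons_lin_form_def)
  then have "mconst c = mconst c'"
    using arg_cong[of _ _ "subst (\<lambda>i. 1)"] by (fastforce simp: subst_simps)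
  then have "c = c'" by simp
  with \<open>v = v'\<close> show "c = c' \<and> v = v'" by simp
qed

lemma lin_forms_Suc: "lin_forms (Suc m) = cons_lin_form ` (UNIV \<times> lin_forms m)"
proof -
  have "lin_forms (Suc m) = mpoly.span (insert (mvar 0) (subst (\<lambda>i. mvar (Suc i)) ` mvar ` {..<m}))"
    by (simp add: lin_forms_def lessThan_Suc_eq_insert_0 image_image)
  also have "\<dots> = {x. \<exists>k. x - mpoly_scale k (mvar 0) \<in> subst (\<lambda>i. mvar (Suc i)) ` lin_forms m}"
    unfolding mpoly.span_insert module_hom.span_image[OF module_hom_subst] lin_forms_def ..
  also have "\<dots> = cons_lin_form ` (UNIV \<times> lin_forms m)"
    by (auto simp: cons_lin_form_def mpoly_scale_eq image_iff algebra_simps)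
  finally show ?thesis .
qed

lemma finite_lin_forms [simp]: "finite (lin_forms m :: 'a::{field,finite} mpoly set)"
  by (induction m) (auto simp: lin_forms_Suc)

lemma card_lin_forms: "card (lin_forms m :: 'a::{field,finite} mpoly set) = CARD('a) ^ m"
  by (induction m) (simp_all add: lin_forms_Suc card_image inj_cons_lin_form card_cartesian_product)

text \<open>The coefficients of \<open>T\<^sup>i\<close> with \<open>i = q ^ k\<close> in the product of all \<open>T + v\<close> are, up to sign, the Dickson
  invariants of the first \<open>m\<close> variables.\<close>

definition lin_prod :: "'a mpoly set \<Rightarrow> 'a::field mpoly poly" where
  "lin_prod T = (\<Prod>v\<in>T. [:v, 1:])"

definition dickson :: "nat \<Rightarrow> nat \<Rightarrow> 'a::{field,finite} mpoly" where
  "dickson m k = coeff (lin_prod (lin_forms m)) (CARD('a) ^ k)"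

text \<open>The coefficient at exponent \<open>i\<close> is a sum of products of
  \<open>card T - i\<close> of the forms \<open>g v\<close>. The vanishing for larger
  \<open>i\<close> belongs to the induction because the step with \<open>d = 0\<close> uses
  it.\<close>

lemma coeff_prod_linear_homogeneous:
  fixes g :: "'b \<Rightarrow> 'a::field mpoly"
  assumes "finite T" "\<And>v. v \<in> T \<Longrightarrow> homogeneous 1 (g v)"
  shows "(card T < i \<longrightarrow> coeff (\<Prod>v\<in>T. [:g v, 1:]) i = 0) \<and>
    (d + i = card T \<longrightarrow> homogeneous d (coeff (\<Prod>v\<in>T. [:g v, 1:]) i))"
  using assms
proof (induction T arbitrary: i d rule: finite_induct)
  case empty
  then show ?case by (auto simp: coeff_1)
next
  case (insert v T)
  define P where "P = (\<Prod>v\<in>T. [:g v, 1:])"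
  have IH: "card T < i \<Longrightarrow> coeff P i = 0" "d + i = card T \<Longrightarrow> homogeneous d (coeff P i)" for i d
    using insert.IH[of i d] insert.prems by (auto simp: P_def)
  have eq: "coeff (\<Prod>v\<in>insert v T. [:g v, 1:]) i =
      g v * coeff P i + (case i of 0 \<Rightarrow> 0 | Suc j \<Rightarrow> coeff P j)" for i
    unfolding prod.insert[OF insert.hyps] P_def[symmetric] by (simp add: coeff_pCons)
  show ?case
  proof (intro conjI impI)
    assume "card (insert v T) < i"
    then show "coeff (\<Prod>v\<in>insert v T. [:g v, 1:]) i = 0"
      using insert.hyps unfolding eq by (cases i) (auto simp: IH)
  next
    assume d: "d + i = card (insert v T)"
    have "homogeneous d (g v * coeff P i)"
    proof (cases d)
      case 0
      then show ?thesis using d insert.hyps by (simp add: IH)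
    next
      case (Suc d')
      then have "homogeneous (1 + d') (g v * coeff P i)"
        using d insert.hyps insert.prems by (intro homogeneous_mult IH) auto
      then show ?thesis by (simp add: Suc)
    qed
    moreover have "homogeneous d (case i of 0 \<Rightarrow> 0 | Suc j \<Rightarrow> coeff P j)"
      using d insert.hyps by (auto split: nat.split intro: IH)
    ultimately show "homogeneous d (coeff (\<Prod>v\<in>insert v T. [:g v, 1:]) i)"
      unfolding eq by (rule homogeneous_add)
  qed
qed

lemma homogeneous_dickson:
  assumes "k \<le> m"
  shows "homogeneous (CARD('a) ^ m - CARD('a) ^ k) (dickson m k :: 'a::{field,finite} mpoly)"
proof -
  have "CARD('a) ^ k \<le> CARD('a) ^ m"
    using assms by (intro power_increasing) auto
  moreover have "homogeneous 1 v" if "v \<in> lin_forms m" for v :: "'a mpoly"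
    using that by (rule homogeneous_lin_forms)
  ultimately show ?thesis
    unfolding dickson_def lin_prod_def
    using coeff_prod_linear_homogeneous[of "lin_forms m :: 'a mpoly set" "\<lambda>v. v"
      "CARD('a) ^ k" "CARD('a) ^ m - CARD('a) ^ k"]
    by (simp add: card_lin_forms)
qed

text \<open>The product is indexed by \<open>v\<close> and not by its image, since
  \<open>subst h\<close> may identify several forms: \<open>drop_var\<close> makes each factor occur
  \<open>q\<close> times.\<close>

lemma subst_coeff_prod_linear:
  "subst h (coeff (\<Prod>v\<in>T. [:g v, 1:]) i) = coeff (\<Prod>v\<in>T. [:subst h (g v), 1:]) i"
proof (induction T arbitrary: i rule: infinite_finite_induct)
  case (insert v T)
  then show ?case
    by (cases i) (simp_all add: subst_simps coeff_pCons)
qed (simp_all add: coeff_1)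

text \<open>An injective map of the finite set \<open>lin_forms m\<close> into itself permutes the
  factors of the defining product.\<close>

lemma subst_dickson:
  fixes h :: "nat \<Rightarrow> 'a::{field,finite} mpoly"
  assumes "\<And>i. i < m \<Longrightarrow> h i \<in> lin_forms m" "inj_on (subst h) (lin_forms m)"
  shows "subst h (dickson m k) = dickson m k"
proof -
  have surj: "subst h ` lin_forms m = lin_forms m"
    using assms by (intro endo_inj_surj) (auto intro: subst_lin_forms)
  have "subst h (dickson m k) = coeff (\<Prod>v\<in>lin_forms m. [:subst h v, 1:]) (CARD('a) ^ k)"
    unfolding dickson_def lin_prod_def by (rule subst_coeff_prod_linear)
  also have "(\<Prod>v\<in>lin_forms m. [:subst h v, 1:]) = (\<Prod>v\<in>subst h ` lin_forms m. [:v, 1:])"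
    using assms(2) by (simp add: prod.reindex)
  finally show ?thesis
    by (simp add: surj dickson_def lin_prod_def)
qed

lemma dickson_in_poly_ring: "dickson m k \<in> poly_ring m"
proof -
  let ?h = "\<lambda>i. if i < m then mvar i else 0"
  have "subst ?h v = v" if "v \<in> lin_forms m" for v :: "'a mpoly"
    using that lin_forms_subset_poly_ring by (auto simp flip: poly_ring_iff_subst)
  then have "subst ?h (dickson m k :: 'a mpoly) = dickson m k"
    by (intro subst_dickson) (auto intro: inj_onI mvar_in_lin_forms)
  then show ?thesis
    by (simp add: poly_ring_iff_subst)
qed

text \<open>Each linear form in \<open>m\<close> variables has \<open>q\<close> preimages in
  \<open>m + 1\<close> variables, so the defining product becomes a q-th power, and its coefficients
  at multiples of \<open>q\<close> are q-th powers.\<close>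

lemma subst_drop_var_dickson:
  "subst drop_var (dickson (Suc m) (Suc k)) = (dickson m k :: 'a::{field,finite} mpoly) ^ CARD('a)"
proof -
  have "subst drop_var (dickson (Suc m) (Suc k) :: 'a mpoly) =
      coeff (\<Prod>v\<in>lin_forms (Suc m). [:subst drop_var v, 1:]) (CARD('a) ^ Suc k)"
    unfolding dickson_def lin_prod_def by (rule subst_coeff_prod_linear)
  also have "(\<Prod>v\<in>lin_forms (Suc m). [:subst drop_var v, 1 :: 'a mpoly:]) =
      (\<Prod>(c, v)\<in>(UNIV :: 'a set) \<times> lin_forms m. [:v, 1:])"
    unfolding lin_forms_Suc
    by (subst prod.reindex[OF inj_cons_lin_form]) (simp add: case_prod_unfold o_def)
  also have "(\<Prod>(c, v)\<in>(UNIV :: 'a set) \<times> lin_forms m. [:v, 1 :: 'a mpoly:]) =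
      lin_prod (lin_forms m :: 'a mpoly set) ^ CARD('a)"
    by (simp add: lin_prod_def flip: prod.cartesian_product)
  also have "coeff (lin_prod (lin_forms m) ^ CARD('a)) (CARD('a) ^ Suc k) =
      (dickson m k :: 'a mpoly) ^ CARD('a)"
    by (simp add: coeff_power_card dickson_def)
  finally show ?thesis .
qed

text \<open>The exponent is \<open>q ^ 0 = 1\<close>, and the zero form contributes the polynomial
  variable as a factor. For \<open>m = \<epsilon> 0\<close> this is the \<open>L\<close> of the
  overview.\<close>

lemma dickson_0_eq: "dickson m 0 = \<Prod>(lin_forms m - {0})"
proof -
  have "lin_prod (lin_forms m) = pCons 0 (\<Prod>v\<in>lin_forms m - {0}. [:v, 1 :: 'a mpoly:])"
    unfolding lin_prod_def by (subst prod.remove[of _ 0]) simp_all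
  then have "dickson m 0 = coeff (\<Prod>v\<in>lin_forms m - {0}. [:v, 1 :: 'a mpoly:]) 0"
    by (simp add: dickson_def)
  also have "\<dots> = \<Prod>(lin_forms m - {0})"
    by (simp add: poly_prod flip: poly_0_coeff_0)
  finally show ?thesis .
qed

section \<open>Stabilizers of flags of coordinate subspaces\<close>

text \<open>A flag of coordinate subspaces is encoded by the function that maps the index \<open>k\<close> of a variable to
  the dimension of the smallest member of the flag that contains \<open>x\<^sub>k\<close>.\<close>

definition flag :: "nat \<Rightarrow> (nat \<Rightarrow> nat) \<Rightarrow> bool" where
  "flag n \<epsilon> \<longleftrightarrow> (\<forall>k<n. k < \<epsilon> k \<and> \<epsilon> k \<le> n) \<and> (\<forall>k<n. \<forall>j<\<epsilon> k. \<epsilon> j \<le> \<epsilon> k)"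

lemma flag_bounds: "flag n \<epsilon> \<Longrightarrow> k < n \<Longrightarrow> k < \<epsilon> k" "flag n \<epsilon> \<Longrightarrow> k < n \<Longrightarrow> \<epsilon> k \<le> n"
  by (simp_all add: flag_def)

lemma flag_mono: "flag n \<epsilon> \<Longrightarrow> k < n \<Longrightarrow> j < \<epsilon> k \<Longrightarrow> \<epsilon> j \<le> \<epsilon> k"
  by (simp add: flag_def)

definition flag_group :: "nat \<Rightarrow> (nat \<Rightarrow> nat) \<Rightarrow> 'a::field mat set" where
  "flag_group n \<epsilon> = {g \<in> carrier_mat n n. invertible_mat g \<and>
     (\<forall>i<n. \<forall>j<n. \<epsilon> j \<le> i \<longrightarrow> g $$ (i, j) = 0)}"

text \<open>Variables from index \<open>n\<close> on are fixed, so that the identity matrix gives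
  the identity on all polynomials.\<close>

definition mat_subst :: "nat \<Rightarrow> 'a::field mat \<Rightarrow> nat \<Rightarrow> 'a mpoly" where
  "mat_subst n g j = (if j < n then \<Sum>i<n. mconst (g $$ (i, j)) * mvar i else mvar j)"

lemma lin_subst_eq_subst:
  assumes "f \<in> poly_ring n"
  shows "lin_subst n g f = subst (mat_subst n g) f"
  unfolding lin_subst_def subst_def
proof (intro sum.cong refl arg_cong2[of _ _ _ _ "(*)"])
  fix e assume "e \<in> Poly_Mapping.keys f"
  then have "Poly_Mapping.keys e \<subseteq> {..<n}"
    using assms by (auto simp: poly_ring_def)
  then have "mono_eval (mat_subst n g) e = (\<Prod>j<n. mat_subst n g j ^ Poly_Mapping.lookup e j)"
    by (intro mono_eval_superset) auto
  then show "(\<Prod>j<n. (\<Sum>i<n. mconst (g $$ (i, j)) * mvar i) ^ Poly_Mapping.lookup e j) =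
      mono_eval (mat_subst n g) e"
    by (simp add: mat_subst_def)
qed

definition flag_invariants :: "nat \<Rightarrow> (nat \<Rightarrow> nat) \<Rightarrow> 'a::field mpoly set" where
  "flag_invariants n \<epsilon> = {f \<in> poly_ring n. \<forall>g\<in>flag_group n \<epsilon>. subst (mat_subst n g) f = f}"

lemma invariants_flag_group: "invariants n (flag_group n \<epsilon>) = flag_invariants n \<epsilon>"
  by (auto simp: invariants_def flag_invariants_def lin_subst_eq_subst)

lemma mat_subst_mult:
  assumes "A \<in> carrier_mat n n" "B \<in> carrier_mat n n"
  shows "subst (mat_subst n A) (mat_subst n B j) = mat_subst n (A * B) j"
proof (cases "j < n")
  case True
  have "subst (mat_subst n A) (mat_subst n B j) =
      (\<Sum>i<n. \<Sum>l<n. mconst (B $$ (i, j)) * (mconst (A $$ (l, i)) * mvar l))"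
    using True by (simp add: mat_subst_def subst_simps sum_distrib_left)
  also have "\<dots> = (\<Sum>l<n. \<Sum>i<n. mconst (A $$ (l, i) * B $$ (i, j)) * mvar l)"
    by (subst sum.swap) (simp add: mconst_mult ac_simps)
  also have "\<dots> = (\<Sum>l<n. mconst ((A * B) $$ (l, j)) * mvar l)"
  proof (rule sum.cong[OF refl])
    fix l assume "l \<in> {..<n}"
    then have "(A * B) $$ (l, j) = (\<Sum>i<n. A $$ (l, i) * B $$ (i, j))"
      using True assms by (simp add: scalar_prod_def atLeast0LessThan)
    moreover have "mconst (sum f I) = (\<Sum>i\<in>I. mconst (f i))" for f :: "nat \<Rightarrow> 'a" and I
      by (induction I rule: infinite_finite_induct) (simp_all add: mconst_add)
    ultimately show "(\<Sum>i<n. mconst (A $$ (l, i) * B $$ (i, j)) * mvar l) =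
        mconst ((A * B) $$ (l, j)) * mvar l"
      by (simp add: sum_distrib_right)
  qed
  finally show ?thesis
    using True by (simp add: mat_subst_def)
qed (simp add: mat_subst_def)

lemma mat_subst_one: "mat_subst n (1\<^sub>m n) j = (mvar j :: 'a::field mpoly)"
proof (cases "j < n")
  case True
  have "(\<Sum>i<n. mconst (if i = j then 1 else 0) * mvar i) =
      (\<Sum>i<n. if i = j then mvar j else (0 :: 'a mpoly))"
    by (rule sum.cong) auto
  then have "mat_subst n (1\<^sub>m n) j = (\<Sum>i<n. if i = j then mvar j else (0 :: 'a mpoly))"
    using True by (simp add: mat_subst_def)
  then show ?thesis using True by simp
qed (simp add: mat_subst_def)

text \<open>\<open>invertible_mat\<close> leaves the dimensions of the inverse open; they are read
  off from the two products. The inverse serves to show that the substitution is injective.\<close>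

lemma flag_group_inverse:
  assumes "g \<in> flag_group n \<epsilon>"
  obtains h where "h \<in> carrier_mat n n" "h * g = 1\<^sub>m n" "g * h = 1\<^sub>m n"
proof -
  from assms obtain h where g: "g \<in> carrier_mat n n" and h: "inverts_mat g h" "inverts_mat h g"
    by (auto simp: flag_group_def invertible_mat_def)
  have gh: "g * h = 1\<^sub>m n"
    using g h(1) by (simp add: inverts_mat_def)
  then have "dim_col h = n"
    by (metis index_mult_mat(3) index_one_mat(3))
  moreover have hg: "h * g = 1\<^sub>m (dim_row h)"
    using h(2) by (simp add: inverts_mat_def)
  then have "dim_row h = n"
    using g by (metis carrier_matD(2) index_mult_mat(3) index_one_mat(3))
  ultimately show ?thesis
    using gh hg by (intro that[of h]) auto
qed

lemma inj_subst_mat_subst: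
  assumes "g \<in> flag_group n \<epsilon>"
  shows "inj (subst (mat_subst n g :: nat \<Rightarrow> 'a::field mpoly))"
proof -
  obtain h where "h \<in> carrier_mat n n" "h * g = 1\<^sub>m n"
    using assms by (rule flag_group_inverse)
  moreover have "g \<in> carrier_mat n n"
    using assms by (simp add: flag_group_def)
  ultimately have "subst (mat_subst n h) (subst (mat_subst n g) f) = f" for f :: "'a mpoly"
    by (simp add: subst_subst mat_subst_mult mat_subst_one)
  then show ?thesis
    by (rule inj_on_inverseI)
qed

lemma mat_subst_in_lin_forms:
  assumes "flag n \<epsilon>" "g \<in> flag_group n \<epsilon>" "k < n" "j < \<epsilon> k"
  shows "mat_subst n g j \<in> lin_forms (\<epsilon> k)"
proof -
  have j: "j < n" "\<epsilon> j \<le> \<epsilon> k"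
    using assms flag_bounds(2)[of n \<epsilon> k] flag_mono[of n \<epsilon> k j] by auto
  have "mconst (g $$ (i, j)) * mvar i \<in> lin_forms (\<epsilon> k)" if "i < n" for i
  proof (cases "i < \<epsilon> k")
    case False
    then have "g $$ (i, j) = 0"
      using assms(2) that j by (auto simp: flag_group_def)
    then show ?thesis by simp
  qed (auto intro: lin_forms_mconst_mult mvar_in_lin_forms)
  then show ?thesis
    using j by (auto simp: mat_subst_def intro: lin_forms_sum)
qed

lemma dickson_in_flag_invariants:
  assumes "flag n \<epsilon>" "k < n"
  shows "(dickson (\<epsilon> k) i :: 'a::{field,finite} mpoly) \<in> flag_invariants n \<epsilon>"
proof -
  have "poly_ring (\<epsilon> k) \<subseteq> poly_ring n"
    using assms by (intro poly_ring_mono) (auto simp: flag_def)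
  moreover have "subst (mat_subst n g) (dickson (\<epsilon> k) i :: 'a mpoly) = dickson (\<epsilon> k) i"
    if "g \<in> flag_group n \<epsilon>" for g :: "'a mat"
    using mat_subst_in_lin_forms[OF assms(1) that assms(2)] inj_subst_mat_subst[OF that]
    by (intro subst_dickson) (auto intro: inj_on_subset)
  ultimately show ?thesis
    using dickson_in_poly_ring[of "\<epsilon> k" i] by (auto simp: flag_invariants_def)
qed

lemma one_in_flag_invariants: "1 \<in> flag_invariants n \<epsilon>"
  by (simp add: flag_invariants_def)

lemma flag_invariants_mult:
  "f \<in> flag_invariants n \<epsilon> \<Longrightarrow> g \<in> flag_invariants n \<epsilon> \<Longrightarrow> f * g \<in> flag_invariants n \<epsilon>"
  by (auto simp: flag_invariants_def subst_simps intro: poly_ring_mult)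

lemma flag_invariants_cancel:
  assumes "f * g \<in> flag_invariants n \<epsilon>" "f \<in> flag_invariants n \<epsilon>" "f \<noteq> 0"
  shows "g \<in> flag_invariants n \<epsilon>"
proof -
  have "subst (mat_subst n h) g = g" if "h \<in> flag_group n \<epsilon>" for h
  proof -
    have "f * subst (mat_subst n h) g = f * g"
      using assms(1,2) that by (auto simp: flag_invariants_def subst_simps)
    then show ?thesis using assms(3) by simp
  qed
  then show ?thesis
    using assms by (auto simp: flag_invariants_def intro: poly_ring_cancel)
qed

lemma subspace_flag_invariants: "mpoly.subspace (flag_invariants n \<epsilon>)"
  by (auto simp: mpoly.subspace_def flag_invariants_def mpoly_scale_eq subst_simps
    intro: poly_ring_add poly_ring_mult)

section \<open>Group elements that change a single variable\<close>

text \<open>The substitution that changes only \<open>x_j\<close>. Scalings, translations and the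
  moves of \<open>x_0\<close> to other linear forms are obtained from it.\<close>

definition col_mat :: "nat \<Rightarrow> nat \<Rightarrow> (nat \<Rightarrow> 'a) \<Rightarrow> 'a::field mat" where
  "col_mat n j a = mat n n (\<lambda>(i, l). if l = j then a i else if i = l then 1 else 0)"

lemma col_mat_mult:
  assumes "j < n"
  shows "col_mat n j a * col_mat n j b = col_mat n j (\<lambda>i. a i * b j + (if i = j then 0 else b i))"
proof (rule eq_matI)
  fix i l
  assume "i < dim_row (col_mat n j (\<lambda>i. a i * b j + (if i = j then 0 else b i)))"
    "l < dim_col (col_mat n j (\<lambda>i. a i * b j + (if i = j then 0 else b i)))"
  then have il: "i < n" "l < n"
    by (simp_all add: col_mat_def)
  have "(col_mat n j a * col_mat n j b) $$ (i, l) =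
      (\<Sum>r<n. (if r = j then a i else if i = r then 1 else 0) *
        (if l = j then b r else if r = l then 1 else 0))"
    using il by (simp add: col_mat_def scalar_prod_def atLeast0LessThan)
  also have "\<dots> = (if l = j then a i * b j + (if i = j then 0 else b i)
      else if i = l then 1 else 0)"
  proof (cases "l = j")
    case True
    have "(\<Sum>r<n. (if r = j then a i else if i = r then 1 else 0) * b r) =
        (\<Sum>r<n. (if r = j then a i * b j else 0) + (if r = i then if i = j then 0 else b i else 0))"
      by (rule sum.cong) auto
    also have "\<dots> = a i * b j + (if i = j then 0 else b i)"
      using assms il by (simp add: sum.distrib)
    finally show ?thesis using True by simp
  next
    case False
    have "(\<Sum>r<n. (if r = j then a i else if i = r then 1 else 0) * (if r = l then 1 else 0)) =
        (\<Sum>r<n. if r = l then if i = l then 1 else 0 else 0)"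
      using False by (intro sum.cong) auto
    then show ?thesis using False il by simp
  qed
  finally show "(col_mat n j a * col_mat n j b) $$ (i, l) =
      col_mat n j (\<lambda>i. a i * b j + (if i = j then 0 else b i)) $$ (i, l)"
    using il by (simp add: col_mat_def)
qed (simp_all add: col_mat_def)

lemma col_mat_one: "col_mat n j (\<lambda>i. if i = j then 1 else 0) = 1\<^sub>m n"
  by (rule eq_matI) (auto simp: col_mat_def)

lemma col_mat_in_flag_group:
  assumes "flag n \<epsilon>" "j < n" "a j \<noteq> 0" "\<And>i. \<epsilon> j \<le> i \<Longrightarrow> a i = 0"
  shows "col_mat n j a \<in> flag_group n \<epsilon>"
proof -
  \<comment> \<open>The column of the inverse, found by solving the equation
    \<open>y = lin_comb n a\<close> for \<open>x_j\<close>.\<close>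
  define b where "b = (\<lambda>i. if i = j then inverse (a j) else - a i / a j)"
  have "col_mat n j a * col_mat n j b = 1\<^sub>m n" "col_mat n j b * col_mat n j a = 1\<^sub>m n"
    unfolding col_mat_mult[OF assms(2)] col_mat_one[of n j, symmetric]
    by (rule arg_cong[of _ _ "col_mat n j"], use assms(3) in \<open>auto simp: b_def field_simps\<close>)+
  then have "invertible_mat (col_mat n j a)"
    unfolding invertible_mat_def inverts_mat_def by (auto simp: col_mat_def)
  moreover have "i \<noteq> l" if "l < n" "\<epsilon> l \<le> i" for i l
    using flag_bounds(1)[OF assms(1) that(1)] that(2) by auto
  ultimately show ?thesis
    using assms(4) by (auto simp: flag_group_def col_mat_def)
qed

definition lin_comb :: "nat \<Rightarrow> (nat \<Rightarrow> 'a) \<Rightarrow> 'a::field mpoly" where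
  "lin_comb n a = (\<Sum>i<n. mconst (a i) * mvar i)"

lemma mat_subst_col_mat:
  fixes a :: "nat \<Rightarrow> 'a::field"
  assumes "j < n"
  shows "mat_subst n (col_mat n j a) = mvar(j := lin_comb n a)"
proof
  fix l
  show "mat_subst n (col_mat n j a) l = (mvar(j := lin_comb n a)) l"
  proof (cases "l < n \<and> l \<noteq> j")
    case True
    have "(\<Sum>i<n. mconst (if i = l then 1 else 0) * mvar i) =
        (\<Sum>i<n. if i = l then mvar l else (0 :: 'a mpoly))"
      by (rule sum.cong) auto
    then have "mat_subst n (col_mat n j a) l = (\<Sum>i<n. if i = l then mvar l else 0)"
      using True assms by (simp add: mat_subst_def col_mat_def)
    then show ?thesis using True by simp
  next
    case False
    then show ?thesis
      using assms by (cases "l = j") (simp_all add: mat_subst_def col_mat_def lin_comb_def)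
  qed
qed

lemma flag_invariants_col:
  assumes "flag n \<epsilon>" "j < n" "a j \<noteq> 0" "\<And>i. \<epsilon> j \<le> i \<Longrightarrow> a i = 0"
    and "f \<in> flag_invariants n \<epsilon>"
  shows "subst (mvar(j := lin_comb n a)) f = f"
proof -
  have "col_mat n j a \<in> flag_group n \<epsilon>"
    using assms(1-4) by (rule col_mat_in_flag_group)
  then have "subst (mat_subst n (col_mat n j a)) f = f"
    using assms(5) by (simp add: flag_invariants_def)
  then show ?thesis
    unfolding mat_subst_col_mat[OF assms(2)] .
qed

lemma lin_comb_mono:
  assumes "m \<le> n" "\<And>i. m \<le> i \<Longrightarrow> a i = 0"
  shows "lin_comb n a = lin_comb m a"
  unfolding lin_comb_def using assms by (intro sum.mono_neutral_right) auto

lemma lin_comb_nonzeroE: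
  assumes "lin_comb m a \<noteq> 0"
  obtains i where "i < m" "a i \<noteq> 0"
proof -
  have "\<exists>i<m. a i \<noteq> 0"
  proof (rule ccontr)
    assume "\<not> (\<exists>i<m. a i \<noteq> 0)"
    then have "lin_comb m a = 0"
      by (simp add: lin_comb_def)
    then show False
      using assms by simp
  qed
  then show ?thesis
    using that by blast
qed

lemma lin_forms_imp_lin_comb:
  fixes v :: "'a::field mpoly"
  assumes "v \<in> lin_forms m"
  obtains a where "v = lin_comb m a" "\<And>i. m \<le> i \<Longrightarrow> a i = 0"
proof -
  have "mpoly.subspace (range (lin_comb m) :: 'a mpoly set)"
  proof (unfold mpoly.subspace_def, intro conjI ballI allI)
    have "0 = lin_comb m (\<lambda>_. 0)"
      by (simp add: lin_comb_def)
    then show "0 \<in> range (lin_comb m)" by blast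
  next
    fix x y :: "'a mpoly" assume "x \<in> range (lin_comb m)" "y \<in> range (lin_comb m)"
    then obtain a b where "x = lin_comb m a" "y = lin_comb m b" by blast
    then have "x + y = lin_comb m (\<lambda>i. a i + b i)"
      by (simp add: lin_comb_def mconst_add distrib_right sum.distrib)
    then show "x + y \<in> range (lin_comb m)" by blast
  next
    fix c and x :: "'a mpoly" assume "x \<in> range (lin_comb m)"
    then obtain a where "x = lin_comb m a" by blast
    then have "mpoly_scale c x = lin_comb m (\<lambda>i. c * a i)"
      by (simp add: lin_comb_def mpoly_scale_eq mconst_mult sum_distrib_left mult.assoc)
    then show "mpoly_scale c x \<in> range (lin_comb m)" by blast
  qed
  moreover have "(mvar i :: 'a mpoly) \<in> range (lin_comb m)" if "i < m" for i
  proof -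
    have "lin_comb m (\<lambda>j. if j = i then 1 else 0) = (\<Sum>j<m. if j = i then mvar i else (0 :: 'a mpoly))"
      unfolding lin_comb_def by (rule sum.cong) auto
    then show ?thesis using that by (auto intro: range_eqI[OF sym])
  qed
  ultimately have "lin_forms m \<subseteq> (range (lin_comb m) :: 'a mpoly set)"
    unfolding lin_forms_def by (intro mpoly.span_minimal) auto
  then obtain a where "v = lin_comb m a"
    using assms by blast
  then have "v = lin_comb m (\<lambda>i. if i < m then a i else 0)"
    by (simp add: lin_comb_def)
  then show ?thesis
    by (rule that) simp
qed

section \<open>Linear forms as prime elements\<close>

lemma subst_lin_comb: "subst h (lin_comb m a) = (\<Sum>i<m. mconst (a i) * h i)"
  by (simp add: lin_comb_def subst_simps)

lemma subst_update_lin_comb: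
  assumes "i < m"
  shows "subst (mvar(i := w)) (lin_comb m a) = lin_comb m a + mconst (a i) * (w - mvar i)"
proof -
  have "subst (mvar(i := w)) (lin_comb m a) =
      (\<Sum>l<m. mconst (a l) * mvar l + (if l = i then mconst (a i) * (w - mvar i) else 0))"
    unfolding subst_lin_comb by (rule sum.cong) (auto simp: algebra_simps)
  then show ?thesis
    using assms by (simp add: sum.distrib lin_comb_def)
qed

text \<open>Solving \<open>v = 0\<close> for the variable \<open>x\<^sub>i\<close> yields a retraction whose kernel is generated by \<open>v\<close>.\<close>

lemma lin_form_retraction:
  fixes v :: "'a::field mpoly"
  assumes "v \<in> lin_forms m" "v \<noteq> 0"
  obtains h where "subst h v = 0" "\<And>f. v dvd f \<longleftrightarrow> subst h f = 0"
    "\<And>w. w \<in> lin_forms m \<Longrightarrow> subst h w = 0 \<Longrightarrow> \<exists>c. w = mconst c * v"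
proof -
  obtain a where a: "v = lin_comb m a"
    using assms(1) by (rule lin_forms_imp_lin_comb)
  obtain i where i: "i < m" "a i \<noteq> 0"
    using assms(2) unfolding a by (rule lin_comb_nonzeroE)
  define y where "y = mvar i - mconst (inverse (a i)) * v"
  define h where "h = mvar(i := y)"
  have y: "y - mvar i = - (mconst (inverse (a i)) * v)"
    by (simp add: y_def)
  have sub: "subst h (lin_comb m b) = lin_comb m b - mconst (b i * inverse (a i)) * v" for b
    unfolding h_def subst_update_lin_comb[OF i(1)] y by (simp add: mconst_mult mult.assoc)
  have v: "subst h v = 0"
    using sub[of a] i by (simp add: a[symmetric])
  have "v dvd h l - mvar l" for l
    by (simp add: h_def y)
  then have diff: "v dvd subst h f - f" for f
    by (rule dvd_subst_self_diff)
  have "v dvd f \<longleftrightarrow> subst h f = 0" for f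
  proof
    assume "v dvd f"
    then show "subst h f = 0"
      by (auto simp: subst_mult v)
  next
    assume "subst h f = 0"
    then show "v dvd f"
      using diff[of f] by simp
  qed
  moreover have "\<exists>c. w = mconst c * v" if "w \<in> lin_forms m" "subst h w = 0" for w
  proof -
    obtain b where "w = lin_comb m b"
      using \<open>w \<in> lin_forms m\<close> by (rule lin_forms_imp_lin_comb)
    then show ?thesis
      using sub[of b] that(2) by auto
  qed
  ultimately show ?thesis
    using v that by blast
qed

text \<open>The multiples of \<open>v\<close> are the kernel of a homomorphism into a domain, hence
  a prime ideal.\<close>

lemma prime_elem_lin_form:
  fixes v :: "'a::field mpoly"
  assumes "v \<in> lin_forms m" "v \<noteq> 0"
  shows "prime_elem v"
proof -
  obtain h where "\<And>f. v dvd f \<longleftrightarrow> subst h f = 0"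
    using assms by (rule lin_form_retraction) blast
  then show ?thesis
    using assms(2) by (intro prime_elemI) (auto simp: subst_mult)
qed

lemma lin_form_dvd_lin_form:
  fixes v :: "'a::field mpoly"
  assumes "v \<in> lin_forms m" "v \<noteq> 0" "w \<in> lin_forms m" "v dvd w"
  obtains c where "w = mconst c * v"
proof -
  obtain h where "\<And>f. v dvd f \<longleftrightarrow> subst h f = 0"
    "\<And>w. w \<in> lin_forms m \<Longrightarrow> subst h w = 0 \<Longrightarrow> \<exists>c. w = mconst c * v"
    using assms(1,2) by (rule lin_form_retraction) blast
  note h = this
  have "subst h w = 0"
    using h(1) assms(4) by simp
  then obtain c where "w = mconst c * v"
    using h(2)[OF assms(3)] by blast
  then show ?thesis by (rule that)
qed

lemma subst_dvd: "f dvd g \<Longrightarrow> subst h f dvd subst h g"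
  by (metis dvdE dvd_triv_left subst_mult)

text \<open>A substitution from the group that sends \<open>x_0\<close> to \<open>v\<close> fixes
  \<open>f\<close> and turns \<open>x_0 ^ k dvd f\<close> into the claim. Changing
  \<open>x_0\<close> alone achieves this only if \<open>x_0\<close> occurs in \<open>v\<close>;
  otherwise two changes are combined.\<close>

lemma power_dvd_transport:
  fixes f :: "'a::field mpoly"
  assumes flag: "flag n \<epsilon>" "0 < n" and f: "f \<in> flag_invariants n \<epsilon>"
    and dvd: "mvar 0 ^ k dvd f" and v: "v \<in> lin_forms (\<epsilon> 0)" "v \<noteq> 0"
  shows "v ^ k dvd f"
proof -
  let ?m = "\<epsilon> 0"
  have m: "0 < ?m" "?m \<le> n"
    by (rule flag_bounds[OF flag])+
  have col: "lin_comb n a ^ k dvd f" if "a 0 \<noteq> 0" "\<And>i. ?m \<le> i \<Longrightarrow> a i = 0" for a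
  proof -
    have "subst (mvar(0 := lin_comb n a)) f = f"
      using flag that f by (rule flag_invariants_col)
    then show ?thesis
      using subst_dvd[OF dvd, of "mvar(0 := lin_comb n a)"] by (simp add: subst_power)
  qed
  obtain a where a: "v = lin_comb ?m a" "\<And>i. ?m \<le> i \<Longrightarrow> a i = 0"
    using v(1) by (rule lin_forms_imp_lin_comb) blast
  have vn: "v = lin_comb n a"
    using a m by (simp add: lin_comb_mono)
  show ?thesis
  proof (cases "a 0 = 0")
    case False
    then show ?thesis
      unfolding vn using a(2) by (rule col)
  next
    case True
    obtain i where i: "i < ?m" "a i \<noteq> 0"
      using v(2) unfolding a(1) by (rule lin_comb_nonzeroE)
    have "i \<noteq> 0"
      using i True by metis
    \<comment> \<open>First \<open>x_0\<close> goes to \<open>v + x_0\<close>, in which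
      \<open>x_0\<close> has coefficient 1.\<close>
    define a' where "a' = a(0 := 1)"
    have "lin_comb n a' = (\<Sum>l<n. mconst (a l) * mvar l + (if l = 0 then mvar 0 else 0))"
      unfolding lin_comb_def by (rule sum.cong) (auto simp: a'_def True)
    then have a': "lin_comb n a' = v + mvar 0"
      using flag by (simp add: vn lin_comb_def sum.distrib)
    \<comment> \<open>Then \<open>x_i\<close> goes to \<open>x_i - x_0 / a i\<close>, which turns
      \<open>v + x_0\<close> into \<open>v\<close>.\<close>
    define b where "b = (\<lambda>_. 0)(i := 1, 0 := - inverse (a i))"
    have "lin_comb n b = (\<Sum>l<n. (if l = i then mvar i else 0) +
        (if l = 0 then mconst (- inverse (a i)) * mvar 0 else 0))"
      unfolding lin_comb_def using \<open>i \<noteq> 0\<close> by (intro sum.cong) (auto simp: b_def)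
    then have b: "lin_comb n b = mvar i + mconst (- inverse (a i)) * mvar 0"
      using flag i m by (simp add: sum.distrib)
    have "i < \<epsilon> i"
      using flag i m flag_bounds[of n \<epsilon> i] by auto
    then have "subst (mvar(i := lin_comb n b)) f = f"
      using flag i m \<open>i \<noteq> 0\<close> f by (intro flag_invariants_col) (auto simp: b_def)
    moreover have "subst (mvar(i := lin_comb n b)) (lin_comb n a') =
        lin_comb n a' + mconst (a i) * (lin_comb n b - mvar i)"
      using i m \<open>i \<noteq> 0\<close> by (subst subst_update_lin_comb) (auto simp: a'_def)
    then have "subst (mvar(i := lin_comb n b)) (lin_comb n a') = v"
      using i by (simp add: a' b mconst_uminus flip: mconst_mult mult.assoc)
    moreover have "lin_comb n a' ^ k dvd f"
      using a m by (intro col) (auto simp: a'_def)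
    ultimately show ?thesis
      using subst_dvd[of "lin_comb n a' ^ k" f "mvar(i := lin_comb n b)"] by (simp add: subst_power)
  qed
qed

section \<open>Invariants that vanish at x_0 = 0\<close>

lemma mvar_neq_0 [simp]: "mvar i \<noteq> (0 :: 'a::comm_ring_1 mpoly)"
proof
  assume "mvar i = (0 :: 'a mpoly)"
  then have "subst (\<lambda>_. 1) (mvar i) = subst (\<lambda>_. 1) (0 :: 'a mpoly)" by simp
  then show False by simp
qed

lemma mvar_dvd_subst_diff: "mvar i dvd subst (mvar(i := 0)) f - f"
  by (rule dvd_subst_self_diff) simp

lemma mvar_dvd_iff: "mvar i dvd f \<longleftrightarrow> subst (mvar(i := 0)) f = 0"
proof
  assume "mvar i dvd f"
  then have "subst (mvar(i := 0)) (mvar i) dvd subst (mvar(i := 0)) f"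
    by (rule subst_dvd)
  then show "subst (mvar(i := 0)) f = 0" by simp
next
  assume "subst (mvar(i := 0)) f = 0"
  then show "mvar i dvd f"
    using mvar_dvd_subst_diff[of i f] by simp
qed

lemma subst_drop_var_eq_0_iff: "subst drop_var f = 0 \<longleftrightarrow> mvar 0 dvd f"
proof
  assume "subst drop_var f = 0"
  moreover have "subst (\<lambda>i. mvar (Suc i)) (subst drop_var f) = subst (mvar(0 := 0)) f"
  proof (rule subst_subst_eq)
    fix i show "subst (\<lambda>i. mvar (Suc i)) (drop_var i) = (mvar(0 := 0)) i"
      by (cases i) simp_all
  qed
  ultimately show "mvar 0 dvd f"
    by (simp add: mvar_dvd_iff)
next
  assume "mvar 0 dvd f"
  then have "subst drop_var (mvar 0) dvd subst drop_var f"
    by (rule subst_dvd)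
  then show "subst drop_var f = 0" by simp
qed

text \<open>Let \<open>k\<close> be the exact exponent of \<open>x_0\<close> in \<open>f\<close>,
  which exists since homogeneity bounds it. The scalings \<open>x_0 \<mapsto> c x_0\<close> belong
  to the group, and invariance forces \<open>c ^ k = 1\<close> for all nonzero \<open>c\<close>; as
  \<open>0 < k\<close>, this gives \<open>q - 1 \<le> k\<close>.\<close>

lemma mvar_0_power_dvd:
  fixes f :: "'a::{field,finite} mpoly"
  assumes flag: "flag n \<epsilon>" "0 < n" and f: "f \<in> flag_invariants n \<epsilon>" "homogeneous d f"
    and dvd: "mvar 0 dvd f"
  shows "mvar 0 ^ (CARD('a) - 1) dvd f"
proof (cases "f = 0")
  case False
  have bound: "k \<le> d" if k: "mvar 0 ^ k dvd f" for k
  proof -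
    obtain g where g: "f = mvar 0 ^ k * g"
      using k by (elim dvdE)
    have "homogeneous k (mvar 0 ^ k :: 'a mpoly)"
      using homogeneous_power[OF homogeneous_mvar, of k 0] by simp
    then show ?thesis
      using homogeneous_cancel[of d "mvar 0 ^ k" g k] f(2) False by (auto simp: g)
  qed
  obtain k where k: "mvar 0 ^ k dvd f" "\<And>j. mvar 0 ^ j dvd f \<Longrightarrow> j \<le> k"
    using Nat.ex_has_greatest_nat[of "\<lambda>k. mvar 0 ^ k dvd f" 1 d] dvd bound by auto
  then obtain r where r: "f = mvar 0 ^ k * r"
    by (elim dvdE)
  have nr: "\<not> mvar 0 dvd r"
  proof
    assume "mvar 0 dvd r"
    then have "mvar 0 ^ k * mvar 0 dvd f"
      unfolding r by (rule mult_dvd_mono[OF dvd_refl])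
    then have "mvar 0 ^ Suc k dvd f"
      by (simp only: power_Suc2)
    then show False using k(2)[of "Suc k"] by simp
  qed
  \<comment> \<open>\<open>Z r\<close> is the part of \<open>r\<close> free of \<open>x_0\<close>.
    The scaling does not affect it, so only the factor \<open>c ^ k\<close> remains.\<close>
  define Z where "Z = subst (mvar(0 := (0 :: 'a mpoly)))"
  have Zr: "Z r \<noteq> 0"
    using nr by (simp add: Z_def mvar_dvd_iff)
  have "c ^ k = 1" if "c \<noteq> 0" for c :: 'a
  proof -
    define a where "a = (\<lambda>i :: nat. if i = 0 then c else 0)"
    have "lin_comb n a = (\<Sum>i<n. if i = 0 then mconst c * mvar 0 else 0)"
      unfolding lin_comb_def by (rule sum.cong) (auto simp: a_def)
    then have lin: "lin_comb n a = mconst c * mvar 0"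
      using flag(2) by simp
    have T: "subst (mvar(0 := lin_comb n a)) f = f"
      using flag that flag_bounds(1)[OF flag] f(1)
      by (intro flag_invariants_col) (auto simp: a_def)
    then have "mvar 0 ^ k * (mconst (c ^ k) * subst (mvar(0 := mconst c * mvar 0)) r) = mvar 0 ^ k * r"
      unfolding lin r by (simp add: subst_simps power_mult_distrib mconst_power ac_simps)
    then have eq: "mconst (c ^ k) * subst (mvar(0 := mconst c * mvar 0)) r = r"
      by simp
    have "Z r = Z (mconst (c ^ k) * subst (mvar(0 := mconst c * mvar 0)) r)"
      by (simp only: eq)
    also have "\<dots> = mconst (c ^ k) * Z r"
    proof -
      have "Z (subst (mvar(0 := mconst c * mvar 0)) r) = Z r"
        unfolding Z_def by (rule subst_subst_eq) (simp add: subst_simps)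
      then show ?thesis
        by (simp add: Z_def subst_mult)
    qed
    finally show ?thesis
      using Zr by simp
  qed
  then have "CARD('a) - 1 \<le> k"
    using k(2)[of 1] dvd by (intro power_eq_1_imp_card_le) auto
  then show ?thesis
    using k(1) by (meson dvd_trans le_imp_power_dvd)
qed simp

lemma dickson_0_neq_0: "dickson m 0 \<noteq> (0 :: 'a::{field,finite} mpoly)"
  by (simp add: dickson_0_eq)

text \<open>The associates of \<open>v\<close> among the linear forms are its nonzero scalar
  multiples, at most \<open>q - 1\<close> in number, and the power of \<open>v\<close> with this
  exponent divides \<open>f\<close>.\<close>

lemma dickson_0_dvd:
  fixes f :: "'a::{field,finite} mpoly"
  assumes flag: "flag n \<epsilon>" "0 < n" and f: "f \<in> flag_invariants n \<epsilon>" "homogeneous d f"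
    and dvd: "mvar 0 dvd f"
  shows "dickson (\<epsilon> 0) 0 dvd f"
  unfolding dickson_0_eq
proof (rule prod_primes_dvd)
  show "finite (lin_forms (\<epsilon> 0) - {0 :: 'a mpoly})" by simp
  fix v :: "'a mpoly" assume v: "v \<in> lin_forms (\<epsilon> 0) - {0}"
  then show "prime_elem v"
    by (intro prime_elem_lin_form) auto
  have "{w \<in> lin_forms (\<epsilon> 0) - {0}. v dvd w} \<subseteq> (\<lambda>c. mconst c * v) ` (UNIV - {0})"
  proof
    fix w assume "w \<in> {w \<in> lin_forms (\<epsilon> 0) - {0}. v dvd w}"
    then have w: "w \<in> lin_forms (\<epsilon> 0)" "w \<noteq> 0" "v dvd w" by auto
    obtain c where c: "w = mconst c * v"
      using lin_form_dvd_lin_form[of v "\<epsilon> 0" w] v w by blast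
    with w(2) have "c \<noteq> 0" by auto
    with c show "w \<in> (\<lambda>c. mconst c * v) ` (UNIV - {0})" by blast
  qed
  then have "card {w \<in> lin_forms (\<epsilon> 0) - {0}. v dvd w} \<le> card ((\<lambda>c. mconst c * v) ` (UNIV - {0}))"
    by (intro card_mono) auto
  also have "\<dots> \<le> card (UNIV - {0 :: 'a})"
    by (rule card_image_le) simp
  also have "\<dots> = CARD('a) - 1"
    by (simp add: card_Diff_singleton)
  finally have "v ^ card {w \<in> lin_forms (\<epsilon> 0) - {0}. v dvd w} dvd v ^ (CARD('a) - 1)"
    by (rule le_imp_power_dvd)
  also have "\<dots> dvd f"
    using v by (intro power_dvd_transport[OF flag f(1) mvar_0_power_dvd[OF assms]]) auto
  finally show "v ^ card {w \<in> lin_forms (\<epsilon> 0) - {0}. v dvd w} dvd f" .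
qed

lemma kernel_drop_var:
  fixes f :: "'a::{field,finite} mpoly"
  assumes flag: "flag n \<epsilon>" "0 < n" and f: "f \<in> flag_invariants n \<epsilon>" "homogeneous d f" "f \<noteq> 0"
    and "subst drop_var f = 0"
  obtains g where "f = dickson (\<epsilon> 0) 0 * g" "g \<in> flag_invariants n \<epsilon>"
    "CARD('a) ^ \<epsilon> 0 - 1 \<le> d" "homogeneous (d - (CARD('a) ^ \<epsilon> 0 - 1)) g"
proof -
  have "mvar 0 dvd f"
    using assms(6) by (simp only: subst_drop_var_eq_0_iff)
  with flag f(1,2) have "dickson (\<epsilon> 0) 0 dvd f"
    by (rule dickson_0_dvd)
  then obtain g where g: "f = dickson (\<epsilon> 0) 0 * g" by (elim dvdE)
  have "g \<in> flag_invariants n \<epsilon>"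
    using f(1)[unfolded g] dickson_in_flag_invariants[OF flag] dickson_0_neq_0
    by (rule flag_invariants_cancel)
  moreover have "homogeneous (CARD('a) ^ \<epsilon> 0 - 1) (dickson (\<epsilon> 0) 0 :: 'a mpoly)"
    using homogeneous_dickson[of 0 "\<epsilon> 0", where 'a = 'a] by simp
  from homogeneous_cancel[OF f(2)[unfolded g] this dickson_0_neq_0]
  have "CARD('a) ^ \<epsilon> 0 - 1 \<le> d \<and> homogeneous (d - (CARD('a) ^ \<epsilon> 0 - 1)) g"
    using f(3) g by fastforce
  ultimately show ?thesis
    using that[OF g] by blast
qed

section \<open>Exponents divisible by q\<close>

text \<open>With \<open>k = q\<close> and for all \<open>j\<close> at once, this makes a polynomial
  over the field a q-th power.\<close>

definition exps_dvd :: "nat \<Rightarrow> nat \<Rightarrow> 'a::comm_ring_1 mpoly \<Rightarrow> bool" where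
  "exps_dvd k j f \<longleftrightarrow> (\<forall>e\<in>Poly_Mapping.keys f. k dvd Poly_Mapping.lookup e j)"

lemma exps_dvd_0 [simp]: "exps_dvd k j 0"
  by (simp add: exps_dvd_def)

lemma exps_dvd_add: "exps_dvd k j f \<Longrightarrow> exps_dvd k j g \<Longrightarrow> exps_dvd k j (f + g)"
  using keys_add[of f g] by (auto simp: exps_dvd_def)

lemma exps_dvd_sum: "(\<And>x. x \<in> A \<Longrightarrow> exps_dvd k j (f x)) \<Longrightarrow> exps_dvd k j (sum f A)"
  by (induction A rule: infinite_finite_induct) (auto intro: exps_dvd_add)

lemma exps_dvd_mconst [simp]: "exps_dvd k j (mconst c)"
  by (simp add: exps_dvd_def mconst_def)

lemma exps_dvd_1 [simp]: "exps_dvd k j 1"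
  using exps_dvd_mconst[of k j 1] by simp

lemma exps_dvd_mult: "exps_dvd k j f \<Longrightarrow> exps_dvd k j g \<Longrightarrow> exps_dvd k j (f * g)"
  unfolding exps_dvd_def
proof
  fix e
  assume f: "\<forall>e\<in>Poly_Mapping.keys f. k dvd Poly_Mapping.lookup e j"
    and g: "\<forall>e\<in>Poly_Mapping.keys g. k dvd Poly_Mapping.lookup e j"
    and "e \<in> Poly_Mapping.keys (f * g)"
  then obtain a b where "e = a + b" "a \<in> Poly_Mapping.keys f" "b \<in> Poly_Mapping.keys g"
    using keys_mult[of f g] by blast
  then show "k dvd Poly_Mapping.lookup e j"
    using f g by (simp add: lookup_add)
qed

lemma exps_dvd_power: "exps_dvd k j f \<Longrightarrow> exps_dvd k j (f ^ l)"
  by (induction l) (auto intro: exps_dvd_mult)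

lemma exps_dvd_prod: "(\<And>x. x \<in> A \<Longrightarrow> exps_dvd k j (f x)) \<Longrightarrow> exps_dvd k j (prod f A)"
  by (induction A rule: infinite_finite_induct) (auto intro: exps_dvd_mult)

lemma exps_dvd_mvar: "i \<noteq> j \<Longrightarrow> exps_dvd k j (mvar i :: 'a::comm_ring_1 mpoly)"
  by (simp add: exps_dvd_def mvar_def lookup_single_not_eq)

lemma exps_dvd_mvar_power: "exps_dvd k j (mvar j ^ k :: 'a::comm_ring_1 mpoly)"
proof -
  have "mvar j ^ k = mono_eval mvar (Poly_Mapping.single j k)" by simp
  also have "\<dots> = (Poly_Mapping.single (Poly_Mapping.single j k) 1 :: 'a mpoly)"
    by (rule mono_eval_mvar)
  finally show ?thesis
    by (simp add: exps_dvd_def)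
qed

lemma exps_dvd_subst: "(\<And>i. exps_dvd k j (h i)) \<Longrightarrow> exps_dvd k j (subst h f)"
  unfolding subst_def mono_eval_def
  by (intro exps_dvd_sum exps_dvd_mult exps_dvd_prod exps_dvd_power exps_dvd_mconst)

text \<open>A polynomial invariant under all \<open>x\<^sub>j \<mapsto> x\<^sub>j + c x\<^sub>0\<close> is a polynomial in \<open>\<Prod>\<^sub>c (x\<^sub>j + c x\<^sub>0)\<close> and
  the other variables, and this product becomes \<open>x\<^sub>j ^ q\<close> when \<open>x\<^sub>0\<close> is set to zero.\<close>

lemma exps_dvd_of_translation_invariant:
  fixes f :: "'a::{field,finite} mpoly"
  assumes "homogeneous d f" "\<And>c. subst (mvar(Suc j := mvar (Suc j) + mconst c * mvar 0)) f = f"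
  shows "exps_dvd CARD('a) j (subst drop_var f)"
  using assms
proof (induction d arbitrary: f rule: less_induct)
  case (less d)
  define l :: "'a \<Rightarrow> 'a mpoly" where "l c = mvar (Suc j) + mconst c * mvar 0" for c
  define T where "T c = subst (mvar(Suc j := l c))" for c
  \<comment> \<open>The part of \<open>f\<close> free of \<open>mvar (Suc j)\<close>. All
    \<open>T c\<close> fix it, so \<open>f - g\<close> is divisible by every translate
    \<open>l c\<close> and not only by \<open>l 0\<close>.\<close>
  define g where "g = subst (mvar(Suc j := 0)) f"
  define w where "w = (\<Prod>c\<in>UNIV. l c)"
  have Tf: "T c f = f" for c
    unfolding T_def l_def by (rule less.prems(2))
  have Tg: "T c g = g" for c
    unfolding T_def g_def by (rule subst_subst_eq) simp
  have Tl: "T c (l c') = l (c + c')" for c c'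
    by (simp add: T_def l_def subst_simps mconst_add algebra_simps)
  \<comment> \<open>The scalar \<open>b\<close> excludes that different \<open>l c\<close> are
    associated; then each has multiplicity 1 in \<open>prod_primes_dvd\<close>.\<close>
  have l_inj: "c = c'" if "mconst b * l c = l c'" for b c c'
  proof -
    have "subst (mvar(0 := 0)) (mconst b * l c) = subst (mvar(0 := 0)) (l c')"
      by (simp only: that)
    then have "mconst b * mvar (Suc j) = (1 :: 'a mpoly) * mvar (Suc j)"
      by (simp add: l_def subst_simps)
    then have b: "mconst b = (1 :: 'a mpoly)"
      by (simp only: mult_cancel_right mvar_neq_0 simp_thms)
    then have "mconst c * mvar 0 = (mconst c' * mvar 0 :: 'a mpoly)"
      using that by (simp add: l_def)
    then show "c = c'" by simp
  qed
  have l_form: "l c \<in> lin_forms (Suc (Suc j))" for c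
    unfolding l_def by (intro lin_forms_add lin_forms_mconst_mult mvar_in_lin_forms) auto
  have l_neq_0: "l c \<noteq> 0" for c
    using l_inj[of 0 "c + 1" c] by auto
  have inj: "inj l"
  proof (rule injI)
    fix c c' assume "l c = l c'"
    then show "c = c'"
      using l_inj[of 1 c c'] by simp
  qed
  have "w = \<Prod>(range l)"
    unfolding w_def using prod.reindex[OF inj, of "\<lambda>x. x"] by simp
  also have "\<dots> dvd f - g"
  proof (rule prod_primes_dvd)
    fix v assume "v \<in> range l"
    then obtain c where c: "v = l c" by blast
    show "prime_elem v"
      unfolding c using l_form l_neq_0 by (rule prime_elem_lin_form)
    have "{u \<in> range l. v dvd u} \<subseteq> {v}"
    proof
      fix u assume "u \<in> {u \<in> range l. v dvd u}"
      then obtain c' where u: "u = l c'" and "l c dvd l c'"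
        using c by blast
      obtain b where "l c' = mconst b * l c"
        using l_form l_neq_0 l_form \<open>l c dvd l c'\<close> by (rule lin_form_dvd_lin_form)
      then have "c = c'"
        by (rule l_inj[OF sym])
      then show "u \<in> {v}"
        using c u by simp
    qed
    then have "card {u \<in> range l. v dvd u} \<le> card {v}"
      by (intro card_mono) auto
    then have "v ^ card {u \<in> range l. v dvd u} dvd v ^ 1"
      by (intro le_imp_power_dvd) simp
    also have "v ^ 1 dvd f - g"
    proof -
      have "mvar (Suc j) dvd g - f"
        unfolding g_def by (rule mvar_dvd_subst_diff)
      then have "T c (mvar (Suc j)) dvd T c (g - f)"
        unfolding T_def by (rule subst_dvd)
      moreover have "T c (g - f) = g - f"
        using Tf Tg by (simp add: T_def subst_diff)
      ultimately have "l c dvd g - f"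
        by (simp add: T_def)
      then have "v dvd - (g - f)"
        unfolding dvd_minus_iff c .
      then show ?thesis by simp
    qed
    finally show "v ^ card {u \<in> range l. v dvd u} dvd f - g" .
  qed simp
  finally obtain r where "f - g = w * r"
    by (elim dvdE)
  then have r: "f = g + w * r"
    by (simp add: diff_eq_eq add.commute)
  have "w \<noteq> 0"
    using l_neq_0 by (simp add: w_def)
  have w_hom: "homogeneous CARD('a) w"
  proof -
    have "homogeneous (\<Sum>c\<in>(UNIV :: 'a set). 1) w"
      unfolding w_def by (intro homogeneous_prod homogeneous_lin_forms[OF l_form])
    then show ?thesis by simp
  qed
  have Tw: "T c w = w" for c
  proof -
    have "T c w = (\<Prod>c'\<in>UNIV. l (c + c'))"
      by (simp add: w_def T_def subst_prod flip: Tl)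
    also have "\<dots> = (\<Prod>c'\<in>range ((+) c). l c')"
      by (subst prod.reindex) auto
    also have "range ((+) c) = UNIV"
      by (simp add: surj_plus)
    finally show ?thesis by (simp add: w_def)
  qed
  have g_hom: "homogeneous d g"
    unfolding g_def by (rule homogeneous_subst[OF less.prems(1)]) simp
  \<comment> \<open>The cofactor \<open>r\<close> inherits the hypotheses, in degree
    \<open>d - q\<close>.\<close>
  have "exps_dvd CARD('a) j (subst drop_var r)"
  proof (cases "r = 0")
    case False
    have "homogeneous d (w * r)"
      using homogeneous_diff[OF less.prems(1) g_hom] by (simp add: r)
    then have "CARD('a) \<le> d" "homogeneous (d - CARD('a)) r"
      using homogeneous_cancel[of d w r "CARD('a)"] w_hom \<open>w \<noteq> 0\<close> False by auto
    moreover have "T c r = r" for c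
    proof -
      have "g + w * T c r = g + w * r"
        using Tf[of c] Tg[of c] Tw[of c] by (simp add: r T_def subst_simps)
      then show ?thesis using \<open>w \<noteq> 0\<close> by simp
    qed
    moreover have "d - CARD('a) < d"
      using \<open>CARD('a) \<le> d\<close> card_field_ge_2[where 'a = 'a] by linarith
    ultimately show ?thesis
      unfolding T_def l_def by (intro less.IH[of "d - CARD('a)"])
  qed simp
  moreover have "subst drop_var w = mvar j ^ CARD('a)"
    by (simp add: w_def subst_simps l_def)
  moreover have "exps_dvd CARD('a) j (subst drop_var g)"
    unfolding g_def subst_subst
  proof (rule exps_dvd_subst)
    fix i
    show "exps_dvd CARD('a) j (subst drop_var ((mvar(Suc j := 0)) i) :: 'a mpoly)"
      by (cases i) (auto intro: exps_dvd_mvar)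
  qed
  ultimately show ?case
    by (simp add: r subst_simps exps_dvd_add exps_dvd_mult exps_dvd_mvar_power)
qed

section \<open>The invariants and their Hilbert series\<close>

text \<open>The root is taken monomial by monomial and keeps the coefficients, since
  \<open>c ^ q = c\<close>; additivity of the q-th power reassembles it. The last alternative
  excludes that \<open>d div q\<close> rounds down for a nonzero root.\<close>

lemma card_power_root:
  fixes f :: "'a::{field,finite} mpoly"
  assumes dvd: "\<And>j. exps_dvd CARD('a) j f" and f: "f \<in> poly_ring n" "homogeneous d f"
  obtains g where "f = g ^ CARD('a)" "g \<in> poly_ring n" "homogeneous (d div CARD('a)) g"
    "g = 0 \<or> CARD('a) dvd d"
proof -
  let ?q = "CARD('a)"
  define r :: "(nat \<Rightarrow>\<^sub>0 nat) \<Rightarrow> 'a mpoly" where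
    "r e = (\<Prod>j\<in>Poly_Mapping.keys e. mvar j ^ (Poly_Mapping.lookup e j div ?q))" for e
  define g where "g = (\<Sum>e\<in>Poly_Mapping.keys f. mconst (Poly_Mapping.lookup f e) * r e)"
  have deg: "d = ?q * (\<Sum>j\<in>Poly_Mapping.keys e. Poly_Mapping.lookup e j div ?q)"
    if "e \<in> Poly_Mapping.keys f" for e
  proof -
    have "d = (\<Sum>j\<in>Poly_Mapping.keys e. Poly_Mapping.lookup e j)"
      using f(2) that by (simp add: homogeneous_def mono_degree_def)
    also have "\<dots> = (\<Sum>j\<in>Poly_Mapping.keys e. ?q * (Poly_Mapping.lookup e j div ?q))"
      using dvd that by (intro sum.cong) (auto simp: exps_dvd_def)
    finally show ?thesis by (simp add: sum_distrib_left)
  qed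
  have "r e ^ ?q = mono_eval mvar e" if "e \<in> Poly_Mapping.keys f" for e
    unfolding r_def mono_eval_def prod_power_distrib power_mult[symmetric]
    using dvd that by (intro prod.cong) (auto simp: exps_dvd_def)
  then have "g ^ ?q = subst mvar f"
    by (simp add: g_def mpoly_power_card_sum power_mult_distrib mconst_power_card subst_def)
  then have "f = g ^ ?q" by simp
  moreover have "g \<in> poly_ring n"
    unfolding g_def r_def
  proof (intro poly_ring_sum poly_ring_mult poly_ring_mconst poly_ring_prod poly_ring_power)
    fix e j assume "e \<in> Poly_Mapping.keys f" "j \<in> Poly_Mapping.keys e"
    then show "(mvar j :: 'a mpoly) \<in> poly_ring n"
      using f(1) by (intro poly_ring_mvar) (auto simp: poly_ring_def)
  qed
  moreover have "homogeneous (d div ?q) g"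
    unfolding g_def
  proof (intro homogeneous_sum homogeneous_mconst_mult)
    fix e assume "e \<in> Poly_Mapping.keys f"
    then have eq: "d div ?q = (\<Sum>j\<in>Poly_Mapping.keys e. Poly_Mapping.lookup e j div ?q * Suc 0)"
      using deg[of e] card_field_ge_2[where 'a = 'a] by simp
    show "homogeneous (d div ?q) (r e)"
      unfolding r_def eq by (intro homogeneous_prod homogeneous_power homogeneous_mvar)
  qed
  moreover have "g = 0 \<or> ?q dvd d"
  proof (cases "f = 0")
    case True
    then show ?thesis by (simp add: g_def)
  next
    case False
    then have "Poly_Mapping.lookup f \<noteq> Poly_Mapping.lookup 0"
      unfolding poly_mapping_eq_iff .
    then obtain e where "e \<in> Poly_Mapping.keys f"
      by (auto simp: fun_eq_iff in_keys_iff)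
    then show ?thesis
      using deg[of e] dvd_triv_left[of ?q] by simp
  qed
  ultimately show ?thesis by (rule that)
qed

section \<open>Removing the first variable\<close>

text \<open>Without \<open>x_0\<close>, indices and dimensions both drop by one; for a composition,
  the first part is lowered by one.\<close>

definition tail_flag :: "(nat \<Rightarrow> nat) \<Rightarrow> nat \<Rightarrow> nat" where
  "tail_flag \<epsilon> k = \<epsilon> (Suc k) - 1"

lemma Suc_tail_flag: "flag (Suc n) \<epsilon> \<Longrightarrow> k < n \<Longrightarrow> Suc (tail_flag \<epsilon> k) = \<epsilon> (Suc k)"
  using flag_bounds(1)[of "Suc n" \<epsilon> "Suc k"] by (simp add: tail_flag_def)

lemma flag_tail_flag:
  assumes "flag (Suc n) \<epsilon>"
  shows "flag n (tail_flag \<epsilon>)"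
  unfolding flag_def
proof (intro conjI allI impI)
  fix k assume k: "k < n"
  show "k < tail_flag \<epsilon> k" "tail_flag \<epsilon> k \<le> n"
    using flag_bounds[OF assms, of "Suc k"] k by (auto simp: tail_flag_def)
  fix j assume j: "j < tail_flag \<epsilon> k"
  then have "Suc j < \<epsilon> (Suc k)"
    using Suc_tail_flag[OF assms k] by simp
  then show "tail_flag \<epsilon> j \<le> tail_flag \<epsilon> k"
    using flag_mono[OF assms, of "Suc k" "Suc j"] k by (simp add: tail_flag_def diff_le_mono)
qed

text \<open>Extends a matrix for the smaller flag by a leading 1, so that the two actions are
  compatible with \<open>drop_var\<close>.\<close>

definition cons_mat :: "nat \<Rightarrow> 'a mat \<Rightarrow> 'a::field mat" where
  "cons_mat n g = mat (Suc n) (Suc n) (\<lambda>(i, j). case i of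
     0 \<Rightarrow> (case j of 0 \<Rightarrow> 1 | Suc _ \<Rightarrow> 0)
   | Suc i' \<Rightarrow> (case j of 0 \<Rightarrow> 0 | Suc j' \<Rightarrow> g $$ (i', j')))"

lemma cons_mat_mult:
  assumes "g \<in> carrier_mat n n" "h \<in> carrier_mat n n"
  shows "cons_mat n g * cons_mat n h = cons_mat n (g * h)"
proof (rule eq_matI)
  fix i j assume "i < dim_row (cons_mat n (g * h))" "j < dim_col (cons_mat n (g * h))"
  then have ij: "i < Suc n" "j < Suc n"
    by (simp_all add: cons_mat_def)
  have "(cons_mat n g * cons_mat n h) $$ (i, j) =
      (\<Sum>l<Suc n. cons_mat n g $$ (i, l) * cons_mat n h $$ (l, j))"
    using ij by (simp add: cons_mat_def scalar_prod_def atLeast0LessThan del: sum.lessThan_Suc)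
  also have "\<dots> = cons_mat n (g * h) $$ (i, j)"
    unfolding sum.lessThan_Suc_shift using ij assms
    by (cases i; cases j) (simp_all add: cons_mat_def scalar_prod_def atLeast0LessThan)
  finally show "(cons_mat n g * cons_mat n h) $$ (i, j) = cons_mat n (g * h) $$ (i, j)" .
qed (simp_all add: cons_mat_def)

lemma cons_mat_one: "cons_mat n (1\<^sub>m n) = 1\<^sub>m (Suc n)"
  by (rule eq_matI) (auto simp: cons_mat_def split: nat.split)

lemma cons_mat_in_flag_group:
  assumes flag: "flag (Suc n) \<epsilon>" and g: "g \<in> flag_group n (tail_flag \<epsilon>)"
  shows "cons_mat n g \<in> flag_group (Suc n) \<epsilon>"
proof -
  obtain h where "h \<in> carrier_mat n n" "h * g = 1\<^sub>m n" "g * h = 1\<^sub>m n"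
    using g by (rule flag_group_inverse)
  moreover have "g \<in> carrier_mat n n"
    using g by (simp add: flag_group_def)
  ultimately have "cons_mat n g * cons_mat n h = 1\<^sub>m (Suc n)" "cons_mat n h * cons_mat n g = 1\<^sub>m (Suc n)"
    by (simp_all add: cons_mat_mult cons_mat_one)
  then have "invertible_mat (cons_mat n g)"
    unfolding invertible_mat_def inverts_mat_def by (auto simp: cons_mat_def)
  moreover have "cons_mat n g $$ (i, j) = 0" if ij: "i < Suc n" "j < Suc n" "\<epsilon> j \<le> i" for i j
  proof -
    have "j < i"
      using flag_bounds(1)[OF flag ij(2)] ij(3) by simp
    then obtain i' where i': "i = Suc i'" by (cases i) auto
    show ?thesis
    proof (cases j)
      case (Suc j')
      then have "g $$ (i', j') = 0"
        using g ij Suc_tail_flag[OF flag, of j'] by (auto simp: flag_group_def i')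
      then show ?thesis
        using ij by (simp add: cons_mat_def i' Suc)
    qed (use ij in \<open>simp add: cons_mat_def i'\<close>)
  qed
  ultimately show ?thesis
    by (simp add: flag_group_def cons_mat_def)
qed

lemma subst_drop_var_mat_subst:
  "subst drop_var (mat_subst (Suc n) (cons_mat n g) j) = subst (mat_subst n g) (drop_var j)"
proof (cases "j < Suc n")
  case True
  then show ?thesis
    by (cases j) (simp_all add: mat_subst_def cons_mat_def subst_simps sum.lessThan_Suc_shift
      del: sum.lessThan_Suc)
next
  case False
  then show ?thesis
    by (cases j) (simp_all add: mat_subst_def)
qed

lemma subst_drop_var_invariant:
  fixes f :: "'a::{field,finite} mpoly"
  assumes flag: "flag (Suc n) \<epsilon>" and f: "f \<in> flag_invariants (Suc n) \<epsilon>" "homogeneous d f"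
  obtains g where "subst drop_var f = g ^ CARD('a)" "g \<in> flag_invariants n (tail_flag \<epsilon>)"
    "homogeneous (d div CARD('a)) g" "g = 0 \<or> CARD('a) dvd d"
proof -
  have ring: "f \<in> poly_ring (Suc n)"
    using f(1) by (simp add: flag_invariants_def)
  have ring': "subst drop_var f \<in> poly_ring n"
    using ring by (rule poly_ring_subst) (auto simp: drop_var_def split: nat.split)
  have "homogeneous 1 (drop_var i :: 'a mpoly)" for i
    by (cases i) simp_all
  with f(2) have hom: "homogeneous d (subst drop_var f)"
    by (rule homogeneous_subst)
  have "exps_dvd CARD('a) j (subst drop_var f)" for j
  proof (cases "j < n")
    case True
    show ?thesis
    proof (rule exps_dvd_of_translation_invariant[OF f(2)])
      fix c :: 'a
      \<comment> \<open>The translation is in the group because index 0 lies below every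
        \<open>\<epsilon> (Suc j)\<close>.\<close>
      define a where "a = (\<lambda>_ :: nat. 0)(0 := c, Suc j := 1)"
      have "lin_comb (Suc n) a = (\<Sum>i<Suc n. (if i = Suc j then mvar (Suc j) else 0) +
          (if i = 0 then mconst c * mvar 0 else 0))"
        unfolding lin_comb_def by (rule sum.cong) (auto simp: a_def)
      also have "\<dots> = mvar (Suc j) + mconst c * mvar 0"
        unfolding sum.distrib using True by simp
      finally have "lin_comb (Suc n) a = mvar (Suc j) + mconst c * mvar 0" .
      moreover have "subst (mvar(Suc j := lin_comb (Suc n) a)) f = f"
      proof (rule flag_invariants_col[OF flag _ _ _ f(1)])
        show "a i = 0" if "\<epsilon> (Suc j) \<le> i" for i
          using flag_bounds(1)[OF flag, of "Suc j"] True that by (auto simp: a_def)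
      qed (use True in \<open>simp_all add: a_def\<close>)
      ultimately show "subst (mvar(Suc j := mvar (Suc j) + mconst c * mvar 0)) f = f" by simp
    qed
  next
    case False
    then have "Poly_Mapping.lookup e j = 0" if "e \<in> Poly_Mapping.keys (subst drop_var f)" for e
      using ring' that unfolding poly_ring_def by (auto simp: not_in_keys_iff_lookup_eq_zero[symmetric])
    then show ?thesis by (simp add: exps_dvd_def)
  qed
  from this ring' hom obtain g where g: "subst drop_var f = g ^ CARD('a)" "g \<in> poly_ring n"
    "homogeneous (d div CARD('a)) g" "g = 0 \<or> CARD('a) dvd d"
    by (rule card_power_root) blast
  have "subst (mat_subst n h) g = g" if h: "h \<in> flag_group n (tail_flag \<epsilon>)" for h
  proof -
    \<comment> \<open>Invariance is checked on q-th powers, where \<open>h\<close> lifts through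
      \<open>drop_var\<close>, and descends to \<open>g\<close> because the q-th power is
      injective.\<close>
    have "subst (mat_subst n h) g ^ CARD('a) = subst (mat_subst n h) (subst drop_var f)"
      by (simp add: g(1) subst_power)
    also have "\<dots> = subst drop_var (subst (mat_subst (Suc n) (cons_mat n h)) f)"
      unfolding subst_subst by (simp only: subst_drop_var_mat_subst)
    also have "\<dots> = g ^ CARD('a)"
      using f(1) cons_mat_in_flag_group[OF flag h] by (simp add: flag_invariants_def g(1))
    finally show ?thesis by (rule mpoly_power_card_inj)
  qed
  then have "g \<in> flag_invariants n (tail_flag \<epsilon>)"
    using g(2) by (simp add: flag_invariants_def)
  with g show ?thesis by (intro that)
qed

section \<open>Monomials in Dickson invariants\<close>

text \<open>One generator \<open>dickson (\<epsilon> k) k\<close> for each variable; the degree is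
  recorded in place of an exponent vector.\<close>

inductive flag_monomial :: "nat \<Rightarrow> (nat \<Rightarrow> nat) \<Rightarrow> nat \<Rightarrow> 'a::{field,finite} mpoly \<Rightarrow> bool"
  for n \<epsilon> where
  one: "flag_monomial n \<epsilon> 0 1"
| mult: "flag_monomial n \<epsilon> d w \<Longrightarrow> k < n \<Longrightarrow>
    flag_monomial n \<epsilon> (CARD('a) ^ \<epsilon> k - CARD('a) ^ k + d) (dickson (\<epsilon> k) k * w)"

lemma flag_monomial_invariant:
  assumes "flag n \<epsilon>" "flag_monomial n \<epsilon> d w"
  shows "w \<in> flag_invariants n \<epsilon>" "homogeneous d w"
proof -
  have "w \<in> flag_invariants n \<epsilon> \<and> homogeneous d w"
    using assms(2)
  proof (induction rule: flag_monomial.induct)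
    case one
    then show ?case by (simp add: one_in_flag_invariants)
  next
    case (mult d w k)
    then show ?case
      using assms(1) flag_bounds(1)[OF assms(1), of k]
      by (auto intro!: flag_invariants_mult dickson_in_flag_invariants homogeneous_mult homogeneous_dickson)
  qed
  then show "w \<in> flag_invariants n \<epsilon>" "homogeneous d w" by auto
qed

text \<open>Each generator of index \<open>k\<close> is replaced by the one of index
  \<open>k + 1\<close>, which \<open>drop_var\<close> maps to the q-th power of the former.\<close>

lemma flag_monomial_lift:
  fixes w :: "'a::{field,finite} mpoly"
  assumes flag: "flag (Suc n) \<epsilon>" and "flag_monomial n (tail_flag \<epsilon>) d w"
  shows "\<exists>w'. flag_monomial (Suc n) \<epsilon> (CARD('a) * d) w' \<and> subst drop_var w' = w ^ CARD('a)"
  using assms(2)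
proof (induction rule: flag_monomial.induct)
  case one
  show ?case
    using flag_monomial.one[of "Suc n" \<epsilon>] by (intro exI[of _ 1]) simp
next
  case (mult d w k)
  then obtain w' where w': "flag_monomial (Suc n) \<epsilon> (CARD('a) * d) w'"
    "subst drop_var w' = w ^ CARD('a)" by blast
  have \<epsilon>: "\<epsilon> (Suc k) = Suc (tail_flag \<epsilon> k)"
    using Suc_tail_flag[OF flag mult.hyps(2)] by simp
  have "flag_monomial (Suc n) \<epsilon> (CARD('a) ^ \<epsilon> (Suc k) - CARD('a) ^ Suc k + CARD('a) * d)
      (dickson (\<epsilon> (Suc k)) (Suc k) * w')"
    using w'(1) mult.hyps(2) by (intro flag_monomial.mult) auto
  also have "CARD('a) ^ \<epsilon> (Suc k) - CARD('a) ^ Suc k + CARD('a) * d =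
      CARD('a) * (CARD('a) ^ tail_flag \<epsilon> k - CARD('a) ^ k + d)"
    by (simp add: \<epsilon> right_diff_distrib' distrib_left)
  finally show ?case
    using w'(2) unfolding \<epsilon>
    by (intro exI[of _ "dickson (Suc (tail_flag \<epsilon> k)) (Suc k) * w'"])
      (simp add: subst_mult subst_drop_var_dickson power_mult_distrib)
qed

section \<open>Recursion for the product formula\<close>

text \<open>The Hilbert series of a polynomial ring whose generators have the degrees of the
  \<open>dickson (\<epsilon> k) k\<close>.\<close>

definition flag_series :: "nat \<Rightarrow> nat \<Rightarrow> (nat \<Rightarrow> nat) \<Rightarrow> int fps" where
  "flag_series q n \<epsilon> = (\<Prod>k<n. fps_recip (1 - fps_X ^ (q ^ \<epsilon> k - q ^ k)))"

lemma one_minus_X_power_compose: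
  "0 < s \<Longrightarrow> (1 - fps_X ^ k :: int fps) oo fps_X ^ s = 1 - fps_X ^ (s * k)"
  by (simp add: fps_compose_sub_distrib power_mult flip: fps_compose_power)

lemma flag_series_compose:
  assumes q: "2 \<le> q" and flag: "flag (Suc n) \<epsilon>"
  shows "flag_series q n (tail_flag \<epsilon>) oo fps_X ^ q =
    (\<Prod>k<n. fps_recip (1 - fps_X ^ (q ^ \<epsilon> (Suc k) - q ^ Suc k)))"
proof -
  have "fps_recip (1 - fps_X ^ (q ^ tail_flag \<epsilon> k - q ^ k)) oo fps_X ^ q =
      fps_recip (1 - fps_X ^ (q ^ \<epsilon> (Suc k) - q ^ Suc k))" if "k < n" for k
  proof -
    define e where "e = q ^ tail_flag \<epsilon> k - q ^ k"
    have "0 < e"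
      unfolding e_def using flag_bounds(1)[OF flag_tail_flag[OF flag] that] by (intro power_diff_pos q)
    have "q * e = q ^ Suc (tail_flag \<epsilon> k) - q ^ Suc k"
      by (simp add: e_def right_diff_distrib')
    then have e: "q * e = q ^ \<epsilon> (Suc k) - q ^ Suc k"
      by (simp only: Suc_tail_flag[OF flag that])
    have "((1 - fps_X ^ e) * fps_recip (1 - fps_X ^ e)) oo fps_X ^ q = (1 :: int fps) oo fps_X ^ q"
      using \<open>0 < e\<close> by (subst fps_recip) simp_all
    then have "(1 - fps_X ^ (q * e)) * (fps_recip (1 - fps_X ^ e) oo fps_X ^ q) = 1"
      using q by (simp add: fps_compose_mult_distrib one_minus_X_power_compose)
    then show ?thesis
      unfolding e_def[symmetric] e[symmetric] using \<open>0 < e\<close> q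
      by (intro fps_recip_unique) simp_all
  qed
  then show ?thesis
    using q by (simp add: flag_series_def fps_compose_prod_distrib)
qed

lemma fps_nth_compose_fps_X_power:
  fixes f :: "int fps"
  assumes "0 < q"
  shows "fps_nth (f oo fps_X ^ q) d = (if q dvd d then fps_nth f (d div q) else 0)"
proof -
  have "fps_nth (f oo fps_X ^ q) d = (\<Sum>i=0..d. if d = q * i then fps_nth f i else 0)"
    unfolding fps_compose_nth by (rule sum.cong) (simp_all flip: power_mult)
  also have "\<dots> = (if q dvd d then fps_nth f (d div q) else 0)"
  proof (cases "q dvd d")
    case True
    then obtain i where i: "d = q * i" by blast
    have "(\<Sum>i=0..d. if d = q * i then fps_nth f i else 0) =
        (\<Sum>j=0..d. if j = i then fps_nth f i else 0)"
      using assms by (intro sum.cong) (auto simp: i)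
    then show ?thesis
      using assms by (simp add: i)
  qed (auto intro!: sum.neutral)
  finally show ?thesis .
qed

text \<open>Coefficients in \<open>(1 - t ^ D) * F = F'(t ^ q)\<close>, where \<open>F'\<close>
  belongs to \<open>tail_flag \<epsilon>\<close>. The first summand will count the kernel of
  \<open>drop_var\<close>, the second its image.\<close>

lemma flag_series_Suc_nth:
  assumes q: "2 \<le> q" and flag: "flag (Suc n) \<epsilon>"
  shows "fps_nth (flag_series q (Suc n) \<epsilon>) d =
    (if q ^ \<epsilon> 0 - 1 \<le> d then fps_nth (flag_series q (Suc n) \<epsilon>) (d - (q ^ \<epsilon> 0 - 1)) else 0) +
    (if q dvd d then fps_nth (flag_series q n (tail_flag \<epsilon>)) (d div q) else 0)"
proof -
  define D where "D = q ^ \<epsilon> 0 - 1"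
  have "0 < D"
    using power_diff_pos[OF q, of 0 "\<epsilon> 0"] flag_bounds(1)[OF flag, of 0] by (simp add: D_def)
  have "flag_series q (Suc n) \<epsilon> =
      fps_recip (1 - fps_X ^ D) * (flag_series q n (tail_flag \<epsilon>) oo fps_X ^ q)"
    unfolding flag_series_compose[OF assms] flag_series_def[of q "Suc n"] prod.lessThan_Suc_shift D_def
    by simp
  then have "(1 - fps_X ^ D) * flag_series q (Suc n) \<epsilon> =
      ((1 - fps_X ^ D) * fps_recip (1 - fps_X ^ D)) * (flag_series q n (tail_flag \<epsilon>) oo fps_X ^ q)"
    by (simp only: mult.assoc)
  also have "(1 - fps_X ^ D) * fps_recip (1 - fps_X ^ D) = 1"
    using \<open>0 < D\<close> by (intro fps_recip) simp
  finally have "flag_series q (Suc n) \<epsilon> =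
      fps_X ^ D * flag_series q (Suc n) \<epsilon> + (flag_series q n (tail_flag \<epsilon>) oo fps_X ^ q)"
    by (simp add: left_diff_distrib diff_eq_eq add.commute)
  from arg_cong[OF this, of "\<lambda>f. fps_nth f d"]
  have "fps_nth (flag_series q (Suc n) \<epsilon>) d =
      fps_nth (fps_X ^ D * flag_series q (Suc n) \<epsilon>) d +
      fps_nth (flag_series q n (tail_flag \<epsilon>) oo fps_X ^ q) d"
    by (simp only: fps_add_nth)
  also have "fps_nth (fps_X ^ D * flag_series q (Suc n) \<epsilon>) d =
      (if D \<le> d then fps_nth (flag_series q (Suc n) \<epsilon>) (d - D) else 0)"
    by (simp add: fps_X_power_mult_nth)
  also have "fps_nth (flag_series q n (tail_flag \<epsilon>) oo fps_X ^ q) d =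
      (if q dvd d then fps_nth (flag_series q n (tail_flag \<epsilon>)) (d div q) else 0)"
    using q by (intro fps_nth_compose_fps_X_power) simp
  finally show ?thesis
    unfolding D_def .
qed

section \<open>Bases of the homogeneous invariants\<close>

lemma mpoly_independent_finiteI:
  fixes B :: "'a::field mpoly set"
  assumes "finite B"
    and "\<And>u w. (\<Sum>v\<in>B. mconst (u v) * v) = 0 \<Longrightarrow> w \<in> B \<Longrightarrow> u w = 0"
  shows "mpoly.independent B"
  using assms unfolding mpoly.dependent_finite[OF assms(1)] mpoly_scale_eq by blast

lemma mpoly_independent_finiteD:
  fixes B :: "'a::field mpoly set"
  assumes "mpoly.independent B" "finite B" "(\<Sum>v\<in>B. mconst (u v) * v) = 0" "w \<in> B"
  shows "u w = 0"
  using assms unfolding mpoly.dependent_finite[OF assms(2)] mpoly_scale_eq by blast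

lemma mpoly_span_finiteE:
  fixes B :: "'a::field mpoly set"
  assumes "f \<in> mpoly.span B" "finite B"
  obtains u where "f = (\<Sum>v\<in>B. mconst (u v) * v)"
  using assms unfolding mpoly.span_finite[OF assms(2)] mpoly_scale_eq by blast

lemma mpoly_span_sumI:
  fixes B :: "'a::field mpoly set"
  shows "(\<And>v. v \<in> A \<Longrightarrow> g v \<in> B) \<Longrightarrow> (\<Sum>v\<in>A. mconst (u v) * g v) \<in> mpoly.span B"
  unfolding mpoly_scale_eq[symmetric]
  by (intro mpoly.span_sum mpoly.span_scale mpoly.span_base)

definition hom_invariants :: "nat \<Rightarrow> (nat \<Rightarrow> nat) \<Rightarrow> nat \<Rightarrow> 'a::field mpoly set" where
  "hom_invariants n \<epsilon> d = {f \<in> flag_invariants n \<epsilon>. homogeneous d f}"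

lemma subspace_hom_invariants: "mpoly.subspace (hom_invariants n \<epsilon> d :: 'a::field mpoly set)"
proof -
  have "(hom_invariants n \<epsilon> d :: 'a mpoly set) = flag_invariants n \<epsilon> \<inter> {f. homogeneous d f}"
    by (auto simp: hom_invariants_def)
  then show ?thesis
    by (simp add: mpoly.subspace_inter subspace_flag_invariants subspace_homogeneous)
qed

text \<open>That \<open>B\<close> consists of invariants follows from
  \<open>flag_monomial_invariant\<close>; the monomial form of its members is what allows them to be
  lifted.\<close>

definition monomial_basis :: "nat \<Rightarrow> (nat \<Rightarrow> nat) \<Rightarrow> nat \<Rightarrow> 'a::{field,finite} mpoly set \<Rightarrow> bool" where
  "monomial_basis n \<epsilon> d B \<longleftrightarrow> finite B \<and> (\<forall>w\<in>B. flag_monomial n \<epsilon> d w) \<and>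
     mpoly.independent B \<and> hom_invariants n \<epsilon> d \<subseteq> mpoly.span B"

text \<open>Since field elements are their own q-th powers, \<open>drop_var\<close> maps a
  combination of lifts to the q-th power of the same combination of \<open>B2\<close>. Relations and
  representations therefore transfer between \<open>B2\<close> and its lifts, while
  \<open>B1\<close> accounts for the kernel. The conditionals cover degrees in which one of the two
  contributions is absent.\<close>

lemma monomial_basis_Suc:
  fixes B1 B2 :: "'a::{field,finite} mpoly set"
  assumes flag: "flag (Suc n) \<epsilon>"
    and B1: "if CARD('a) ^ \<epsilon> 0 - 1 \<le> d
      then monomial_basis (Suc n) \<epsilon> (d - (CARD('a) ^ \<epsilon> 0 - 1)) B1 else B1 = {}"
    and B2: "if CARD('a) dvd d then monomial_basis n (tail_flag \<epsilon>) (d div CARD('a)) B2 else B2 = {}"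
  shows "\<exists>B :: 'a mpoly set. monomial_basis (Suc n) \<epsilon> d B \<and> card B = card B1 + card B2"
proof -
  let ?q = "CARD('a)"
  let ?D = "?q ^ \<epsilon> 0 - 1"
  let ?L = "dickson (\<epsilon> 0) 0 :: 'a mpoly"
  have fin: "finite B1" "finite B2" and ind: "mpoly.independent B1" "mpoly.independent B2"
    using B1 B2 by (auto simp: monomial_basis_def mpoly.independent_empty split: if_splits)
  have "\<exists>w'. flag_monomial (Suc n) \<epsilon> d w' \<and> subst drop_var w' = w ^ ?q" if "w \<in> B2" for w
  proof -
    have "?q dvd d" "flag_monomial n (tail_flag \<epsilon>) (d div ?q) w"
      using B2 that by (auto simp: monomial_basis_def split: if_splits)
    then show ?thesis
      using flag_monomial_lift[OF flag, of "d div ?q" w] by simp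
  qed
  then obtain s where s: "\<And>w. w \<in> B2 \<Longrightarrow> flag_monomial (Suc n) \<epsilon> d (s w)"
    "\<And>w. w \<in> B2 \<Longrightarrow> subst drop_var (s w) = w ^ ?q" by metis
  have L: "subst drop_var ?L = 0"
  proof -
    have "mvar 0 \<in> lin_forms (\<epsilon> 0) - {0 :: 'a mpoly}"
      using flag_bounds(1)[OF flag, of 0] by (simp add: mvar_in_lin_forms)
    then have "mvar 0 dvd ?L"
      unfolding dickson_0_eq by (intro dvd_prodI) auto
    then show ?thesis
      by (simp only: subst_drop_var_eq_0_iff)
  qed
  have inj1: "inj_on ((*) ?L) B1"
    by (rule inj_onI) (simp add: dickson_0_neq_0)
  have inj2: "inj_on s B2"
    using s(2) mpoly_power_card_inj by (metis inj_onI)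
  have disj: "(*) ?L ` B1 \<inter> s ` B2 = {}"
  proof -
    \<comment> \<open>\<open>drop_var\<close> kills multiples of \<open>L\<close> but maps a lift to
      the q-th power of its nonzero original.\<close>
    have "w = 0" if "w \<in> B2" "?L * v = s w" for v w
      using s(2)[OF that(1)] by (simp add: subst_mult L flip: that(2))
    moreover have "0 \<notin> B2"
      using ind(2) mpoly.dependent_zero by blast
    ultimately show ?thesis by (fastforce simp: disjoint_iff)
  qed
  define B where "B = (*) ?L ` B1 \<union> s ` B2"
  have sum_B: "(\<Sum>v\<in>B. h v) = (\<Sum>v\<in>B1. h (?L * v)) + (\<Sum>w\<in>B2. h (s w))" for h :: "'a mpoly \<Rightarrow> 'a mpoly"
    unfolding B_def using fin disj
    by (simp add: sum.union_disjoint sum.reindex[OF inj1] sum.reindex[OF inj2])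
  have drop: "subst drop_var (\<Sum>w\<in>B2. mconst (u w) * s w) = (\<Sum>w\<in>B2. mconst (u w) * w) ^ ?q" for u
  proof -
    have "subst drop_var (\<Sum>w\<in>B2. mconst (u w) * s w) = (\<Sum>w\<in>B2. (mconst (u w) * w) ^ ?q)"
      using s(2) by (simp add: subst_simps power_mult_distrib mconst_power_card)
    then show ?thesis
      by (simp add: mpoly_power_card_sum)
  qed
  have "finite B"
    using fin by (simp add: B_def)
  moreover have mono: "flag_monomial (Suc n) \<epsilon> d w" if w: "w \<in> B" for w
  proof -
    consider v where "v \<in> B1" "w = ?L * v" | "w \<in> s ` B2"
      using w unfolding B_def by blast
    then show ?thesis
    proof cases
      case 1
      then have "?D \<le> d" "flag_monomial (Suc n) \<epsilon> (d - ?D) v"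
        using B1 by (auto simp: monomial_basis_def split: if_splits)
      then show ?thesis
        using flag_monomial.mult[of "Suc n" \<epsilon> "d - ?D" v 0] by (simp add: 1)
    qed (use s(1) in auto)
  qed
  moreover have "mpoly.independent B"
  proof (rule mpoly_independent_finiteI[OF \<open>finite B\<close>])
    fix u w assume sum: "(\<Sum>v\<in>B. mconst (u v) * v) = 0" and w: "w \<in> B"
    \<comment> \<open>Applying \<open>drop_var\<close> kills the first sum and forces the
      coefficients of the lifts to vanish; then \<open>L\<close> cancels from what is left.\<close>
    have *: "?L * (\<Sum>v\<in>B1. mconst (u (?L * v)) * v) + (\<Sum>w\<in>B2. mconst (u (s w)) * s w) = 0"
      using sum unfolding sum_B by (simp add: sum_distrib_left ac_simps)
    from arg_cong[OF *, of "subst drop_var"]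
    have "subst drop_var (\<Sum>w\<in>B2. mconst (u (s w)) * s w) = 0"
      unfolding subst_add subst_mult[of _ ?L] L by simp
    then have "(\<Sum>w\<in>B2. mconst (u (s w)) * w) = 0"
      unfolding drop by simp
    then have u2: "u (s w) = 0" if "w \<in> B2" for w
      using mpoly_independent_finiteD[OF ind(2) fin(2), of "\<lambda>w. u (s w)"] that by blast
    then have "(\<Sum>v\<in>B1. mconst (u (?L * v)) * v) = 0"
      using * by (simp add: dickson_0_neq_0)
    then have "u (?L * v) = 0" if "v \<in> B1" for v
      using mpoly_independent_finiteD[OF ind(1) fin(1), of "\<lambda>v. u (?L * v)"] that by blast
    with u2 w show "u w = 0"
      by (auto simp: B_def)
  qed
  moreover have "f \<in> mpoly.span B" if f: "f \<in> hom_invariants (Suc n) \<epsilon> d" for f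
  proof -
    have fi: "f \<in> flag_invariants (Suc n) \<epsilon>" "homogeneous d f"
      using f by (auto simp: hom_invariants_def)
    then obtain g where g: "subst drop_var f = g ^ ?q" "g \<in> flag_invariants n (tail_flag \<epsilon>)"
      "homogeneous (d div ?q) g" "g = 0 \<or> ?q dvd d"
      by (rule subst_drop_var_invariant[OF flag])
    have "g \<in> mpoly.span B2"
    proof (cases "g = 0")
      case False
      then have "hom_invariants n (tail_flag \<epsilon>) (d div ?q) \<subseteq> mpoly.span B2"
        using g(4) B2 by (auto simp: monomial_basis_def)
      then show ?thesis
        using g(2,3) by (auto simp: hom_invariants_def)
    qed (simp add: mpoly.span_zero)
    then obtain u where u: "g = (\<Sum>w\<in>B2. mconst (u w) * w)"
      using fin(2) by (rule mpoly_span_finiteE)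
    \<comment> \<open>Lifting the coordinates of \<open>g\<close> gives an invariant with the same
      image as \<open>f\<close>, so \<open>f - r\<close> lies in the kernel.\<close>
    define r where "r = (\<Sum>w\<in>B2. mconst (u w) * s w)"
    have r_span: "r \<in> mpoly.span B"
      unfolding r_def by (rule mpoly_span_sumI) (simp add: B_def)
    have "mpoly.span B \<subseteq> hom_invariants (Suc n) \<epsilon> d"
    proof (intro mpoly.span_minimal subspace_hom_invariants subsetI)
      fix w assume "w \<in> B"
      then show "w \<in> hom_invariants (Suc n) \<epsilon> d"
        using flag_monomial_invariant[OF flag mono] by (simp add: hom_invariants_def)
    qed
    with f r_span have "f - r \<in> hom_invariants (Suc n) \<epsilon> d"
      by (intro mpoly.subspace_diff subspace_hom_invariants) auto
    then have fr: "f - r \<in> flag_invariants (Suc n) \<epsilon>" "homogeneous d (f - r)"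
      by (auto simp: hom_invariants_def)
    have fr0: "subst drop_var (f - r) = 0"
      by (simp add: subst_diff g(1) r_def drop u)
    have "f - r \<in> mpoly.span B"
    proof (cases "f - r = 0")
      case False
      obtain h where h: "f - r = ?L * h" "h \<in> flag_invariants (Suc n) \<epsilon>" "?D \<le> d" "homogeneous (d - ?D) h"
        using kernel_drop_var[OF flag zero_less_Suc fr False fr0] by blast
      then have "h \<in> mpoly.span B1"
        using B1 by (auto simp: monomial_basis_def hom_invariants_def)
      then obtain c where "h = (\<Sum>v\<in>B1. mconst (c v) * v)"
        using fin(1) by (rule mpoly_span_finiteE)
      then have "f - r = (\<Sum>v\<in>B1. mconst (c v) * (?L * v))"
        by (simp add: h(1) sum_distrib_left ac_simps)
      also have "\<dots> \<in> mpoly.span B"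
        by (rule mpoly_span_sumI) (auto simp: B_def)
      finally show ?thesis .
    qed (simp add: mpoly.span_zero)
    from mpoly.span_add[OF this r_span] show ?thesis by simp
  qed
  ultimately have "monomial_basis (Suc n) \<epsilon> d B"
    unfolding monomial_basis_def by blast
  moreover have "card B = card B1 + card B2"
    unfolding B_def using fin disj by (simp add: card_Un_disjoint card_image inj1 inj2)
  ultimately show ?thesis by blast
qed

lemma subst_zero_mconst: "\<exists>c. subst (\<lambda>_. 0) f = mconst c"
proof (induction f rule: mpoly_induct)
  case (var i)
  show ?case by (intro exI[of _ 0]) simp
next
  case (add f g)
  then show ?case
    by (auto simp: subst_add simp flip: mconst_add)
next
  case (mult f g)
  then show ?case
    by (auto simp: subst_mult simp flip: mconst_mult)
qed auto

lemma monomial_basis_0: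
  "\<exists>B. monomial_basis 0 \<epsilon> d (B :: 'a::{field,finite} mpoly set) \<and>
    int (card B) = fps_nth (flag_series CARD('a) 0 \<epsilon>) d"
proof -
  have const: "\<exists>c. f = mconst c" if f: "f \<in> poly_ring 0" for f :: "'a mpoly"
    using poly_ring_subst_cong[OF f, of mvar "\<lambda>_. 0"] subst_zero_mconst[of f] by simp
  show ?thesis
  proof (cases "d = 0")
    case True
    have "mconst c \<in> mpoly.span {1 :: 'a mpoly}" for c
      using mpoly.span_scale[OF mpoly.span_base, of 1 "{1}" c] by (simp add: mpoly_scale_eq)
    then have "hom_invariants 0 \<epsilon> 0 \<subseteq> mpoly.span {1 :: 'a mpoly}"
      using const by (auto simp: hom_invariants_def flag_invariants_def)
    then have "monomial_basis 0 \<epsilon> d {1 :: 'a mpoly}"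
      using flag_monomial.one by (simp add: monomial_basis_def True)
    then show ?thesis
      by (intro exI[of _ "{1}"]) (simp add: True flag_series_def)
  next
    case False
    have "f = 0" if "f \<in> hom_invariants 0 \<epsilon> d" for f :: "'a mpoly"
    proof -
      have "homogeneous d f" and "f \<in> poly_ring 0"
        using that by (auto simp: hom_invariants_def flag_invariants_def)
      then obtain c where c: "f = mconst c" "homogeneous d f"
        using const by blast
      have "hom_part d f = f" "hom_part d (mconst c) = 0"
        using c(2) False by (auto simp: homogeneous_iff_hom_part mconst_def hom_part_single)
      then show ?thesis by (simp add: c)
    qed
    then have "hom_invariants 0 \<epsilon> d \<subseteq> {0 :: 'a mpoly}" by blast
    then have "monomial_basis 0 \<epsilon> d ({} :: 'a mpoly set)"
      by (simp add: monomial_basis_def mpoly.independent_empty)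
    then show ?thesis
      using False by (intro exI[of _ "{}"]) (simp add: flag_series_def)
  qed
qed

text \<open>The induction is nested: the image part has one variable less, whereas the kernel part
  keeps the flag and lowers the degree by \<open>q ^ \<epsilon> 0 - 1\<close>, which is
  positive.\<close>

lemma monomial_basis_exists:
  "flag n \<epsilon> \<Longrightarrow> \<exists>B. monomial_basis n \<epsilon> d (B :: 'a::{field,finite} mpoly set) \<and>
    int (card B) = fps_nth (flag_series CARD('a) n \<epsilon>) d"
proof (induction n arbitrary: \<epsilon> d)
  case 0
  show ?case by (rule monomial_basis_0)
next
  case (Suc n)
  note flag = Suc.prems
  let ?q = "CARD('a)"
  let ?D = "?q ^ \<epsilon> 0 - 1"
  have D: "0 < ?D"
    using power_diff_pos[OF card_field_ge_2[where 'a = 'a], of 0 "\<epsilon> 0"] flag_bounds(1)[OF flag, of 0]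
    by simp
  show ?case
  proof (induction d rule: less_induct)
    case (less d)
    have "\<exists>B1 :: 'a mpoly set. (if ?D \<le> d then monomial_basis (Suc n) \<epsilon> (d - ?D) B1 else B1 = {}) \<and>
      int (card B1) = (if ?D \<le> d then fps_nth (flag_series ?q (Suc n) \<epsilon>) (d - ?D) else 0)"
      using less.IH[of "d - ?D"] D by auto
    then obtain B1 :: "'a mpoly set" where
      B1: "if ?D \<le> d then monomial_basis (Suc n) \<epsilon> (d - ?D) B1 else B1 = {}"
        "int (card B1) = (if ?D \<le> d then fps_nth (flag_series ?q (Suc n) \<epsilon>) (d - ?D) else 0)"
      by blast
    have "\<exists>B2 :: 'a mpoly set. (if ?q dvd d then monomial_basis n (tail_flag \<epsilon>) (d div ?q) B2 else B2 = {}) \<and>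
      int (card B2) = (if ?q dvd d then fps_nth (flag_series ?q n (tail_flag \<epsilon>)) (d div ?q) else 0)"
      using Suc.IH[OF flag_tail_flag[OF flag], of "d div ?q"] by auto
    then obtain B2 :: "'a mpoly set" where
      B2: "if ?q dvd d then monomial_basis n (tail_flag \<epsilon>) (d div ?q) B2 else B2 = {}"
        "int (card B2) = (if ?q dvd d then fps_nth (flag_series ?q n (tail_flag \<epsilon>)) (d div ?q) else 0)"
      by blast
    obtain B :: "'a mpoly set" where B: "monomial_basis (Suc n) \<epsilon> d B" "card B = card B1 + card B2"
      using monomial_basis_Suc[OF flag B1(1) B2(1)] by blast
    show ?case
      unfolding flag_series_Suc_nth[OF card_field_ge_2[where 'a = 'a] flag, of d]
      using B B1(2) B2(2) by (intro exI[of _ B]) simp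
  qed
qed

lemma hilbert_series_flag_invariants:
  assumes flag: "flag n \<epsilon>"
  shows "hilbert_series (flag_invariants n \<epsilon> :: 'a::{field,finite} mpoly set) =
    flag_series CARD('a) n \<epsilon>"
proof (rule fps_ext)
  fix d
  obtain B :: "'a mpoly set" where B: "monomial_basis n \<epsilon> d B"
    "int (card B) = fps_nth (flag_series CARD('a) n \<epsilon>) d"
    using monomial_basis_exists[OF flag] by blast
  have mono: "flag_monomial n \<epsilon> d w" if "w \<in> B" for w
    using B(1) that by (simp add: monomial_basis_def)
  have "B \<subseteq> hom_invariants n \<epsilon> d"
    using flag_monomial_invariant[OF flag mono] unfolding hom_invariants_def by blast
  moreover have "hom_invariants n \<epsilon> d \<subseteq> mpoly.span B" "mpoly.independent B"
    using B(1) by (simp_all add: monomial_basis_def)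
  ultimately have "card B = mpoly.dim (hom_invariants n \<epsilon> d :: 'a mpoly set)"
    by (rule mpoly.basis_card_eq_dim)
  then show "fps_nth (hilbert_series (flag_invariants n \<epsilon> :: 'a mpoly set)) d =
      fps_nth (flag_series CARD('a) n \<epsilon>) d"
    using B(2) by (simp add: hilbert_series_def hom_invariants_def)
qed

section \<open>From compositions to flags\<close>

text \<open>The dimension function of the flag stabilized by \<open>parabolic \<alpha>\<close>: the
  end of the block that contains \<open>k\<close>.\<close>

definition block_end :: "nat list \<Rightarrow> nat \<Rightarrow> nat" where
  "block_end \<alpha> k = psum \<alpha> (LEAST i. k < psum \<alpha> i)"

lemma psum_mono: "i \<le> j \<Longrightarrow> psum \<alpha> i \<le> psum \<alpha> j"
proof -
  assume "i \<le> j"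
  then have "take j \<alpha> = take i \<alpha> @ take (j - i) (drop i \<alpha>)"
    by (metis le_add_diff_inverse take_add)
  then show ?thesis by (simp add: psum_def)
qed

lemma block_end_eq:
  assumes "k \<in> block \<alpha> u"
  shows "block_end \<alpha> k = psum \<alpha> (Suc u)"
proof -
  have "(LEAST i. k < psum \<alpha> i) = Suc u"
  proof (rule Least_equality)
    show "k < psum \<alpha> (Suc u)"
      using assms by (simp add: block_def)
    fix i assume "k < psum \<alpha> i"
    then show "Suc u \<le> i"
      using psum_mono[of i u \<alpha>] assms by (force simp: block_def)
  qed
  then show ?thesis by (simp add: block_end_def)
qed

lemma block_exists:
  assumes "k < sum_list \<alpha>"
  obtains u where "u < length \<alpha>" "k \<in> block \<alpha> u"
proof -
  have "k < psum \<alpha> (length \<alpha>)" using assms by simp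
  define v where "v = (LEAST i. k < psum \<alpha> i)"
  have v: "k < psum \<alpha> v" "v \<le> length \<alpha>"
    using LeastI[of "\<lambda>i. k < psum \<alpha> i", OF \<open>k < psum \<alpha> (length \<alpha>)\<close>]
      Least_le[of "\<lambda>i. k < psum \<alpha> i", OF \<open>k < psum \<alpha> (length \<alpha>)\<close>]
    by (simp_all add: v_def)
  then obtain u where u: "v = Suc u"
    by (cases v) auto
  have "\<not> k < psum \<alpha> u"
    using not_less_Least[of u "\<lambda>i. k < psum \<alpha> i"] u by (simp add: v_def)
  then show ?thesis
    using u v by (intro that[of u]) (auto simp: block_def)
qed

lemma psum_le_sum_list: "psum \<alpha> i \<le> sum_list \<alpha>"
proof -
  have "sum_list \<alpha> = sum_list (take i \<alpha>) + sum_list (drop i \<alpha>)"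
    by (metis append_take_drop_id sum_list_append)
  then show ?thesis by (simp add: psum_def)
qed

lemma flag_block_end: "flag (sum_list \<alpha>) (block_end \<alpha>)"
  unfolding flag_def
proof (intro conjI allI impI)
  fix k assume "k < sum_list \<alpha>"
  then obtain u where u: "u < length \<alpha>" "k \<in> block \<alpha> u"
    by (rule block_exists)
  show "k < block_end \<alpha> k" "block_end \<alpha> k \<le> sum_list \<alpha>"
    using u(2) psum_le_sum_list by (auto simp: block_end_eq[OF u(2)] block_def)
  fix j assume j: "j < block_end \<alpha> k"
  then have "j < sum_list \<alpha>"
    using \<open>block_end \<alpha> k \<le> sum_list \<alpha>\<close> by simp
  then obtain v where v: "v < length \<alpha>" "j \<in> block \<alpha> v"
    by (rule block_exists)
  have "v \<le> u"
  proof (rule ccontr)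
    assume "\<not> v \<le> u"
    then have "psum \<alpha> (Suc u) \<le> psum \<alpha> v"
      by (intro psum_mono) simp
    then show False
      using j v(2) by (simp add: block_end_eq[OF u(2)] block_def)
  qed
  then show "block_end \<alpha> j \<le> block_end \<alpha> k"
    unfolding block_end_eq[OF u(2)] block_end_eq[OF v(2)] by (intro psum_mono) simp
qed

text \<open>A position lies below the diagonal blocks exactly when its row index is at or beyond the
  end of the block of its column index.\<close>

lemma parabolic_eq_flag_group: "parabolic \<alpha> = flag_group (sum_list \<alpha>) (block_end \<alpha>)"
proof -
  have "(\<exists>u v. u < v \<and> v < length \<alpha> \<and> i \<in> block \<alpha> v \<and> j \<in> block \<alpha> u) \<longleftrightarrow>
      i < sum_list \<alpha> \<and> j < sum_list \<alpha> \<and> block_end \<alpha> j \<le> i" for i j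
  proof
    assume "\<exists>u v. u < v \<and> v < length \<alpha> \<and> i \<in> block \<alpha> v \<and> j \<in> block \<alpha> u"
    then obtain u v where uv: "u < v" "v < length \<alpha>" "i \<in> block \<alpha> v" "j \<in> block \<alpha> u" by blast
    have "block_end \<alpha> j \<le> i"
      using psum_mono[of "Suc u" v \<alpha>] uv by (auto simp: block_end_eq[OF uv(4)] block_def)
    moreover have "i < sum_list \<alpha>" "j < sum_list \<alpha>"
      using uv psum_le_sum_list[of \<alpha> "Suc u"] psum_le_sum_list[of \<alpha> "Suc v"] by (auto simp: block_def)
    ultimately show "i < sum_list \<alpha> \<and> j < sum_list \<alpha> \<and> block_end \<alpha> j \<le> i" by simp
  next
    assume ij: "i < sum_list \<alpha> \<and> j < sum_list \<alpha> \<and> block_end \<alpha> j \<le> i"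
    obtain u where u: "u < length \<alpha>" "j \<in> block \<alpha> u"
      using ij block_exists[of j \<alpha>] by blast
    obtain v where v: "v < length \<alpha>" "i \<in> block \<alpha> v"
      using ij block_exists[of i \<alpha>] by blast
    note uv = u v
    have "u < v"
    proof (rule ccontr)
      assume "\<not> u < v"
      then have "psum \<alpha> (Suc v) \<le> psum \<alpha> (Suc u)"
        by (intro psum_mono) simp
      then show False
        using ij uv(4) by (simp add: block_end_eq[OF uv(2)] block_def)
    qed
    then show "\<exists>u v. u < v \<and> v < length \<alpha> \<and> i \<in> block \<alpha> v \<and> j \<in> block \<alpha> u"
      using uv by blast
  qed
  then have "(\<forall>u v i j. u < v \<and> v < length \<alpha> \<and> i \<in> block \<alpha> v \<and> j \<in> block \<alpha> u \<longrightarrow> g $$ (i, j) = 0) \<longleftrightarrow>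
      (\<forall>i<sum_list \<alpha>. \<forall>j<sum_list \<alpha>. block_end \<alpha> j \<le> i \<longrightarrow> g $$ (i, j) = 0)" for g :: "'a mat"
    by meson
  then show ?thesis
    by (simp add: parabolic_def flag_group_def)
qed

lemma hilbert_product_eq_flag_series:
  "hilbert_product q \<alpha> = flag_series q (sum_list \<alpha>) (block_end \<alpha>)"
proof -
  have "flag_series q (sum_list \<alpha>) (block_end \<alpha>) = (\<Prod>i<length \<alpha>. \<Prod>j<\<alpha> ! i.
      fps_recip (1 - fps_X ^ (q ^ block_end \<alpha> (psum \<alpha> i + j) - q ^ (psum \<alpha> i + j))))"
    using prod_lessThan_psum[of "length \<alpha>" \<alpha>] by (simp add: flag_series_def)
  also have "\<dots> = hilbert_product q \<alpha>"
    unfolding hilbert_product_def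
  proof (intro prod.cong refl)
    fix i j assume "i \<in> {..<length \<alpha>}" "j \<in> {..<\<alpha> ! i}"
    then have "psum \<alpha> i + j \<in> block \<alpha> i"
      by (simp add: block_def psum_Suc)
    then show "fps_recip (1 - fps_X ^ (q ^ block_end \<alpha> (psum \<alpha> i + j) - q ^ (psum \<alpha> i + j))) =
        fps_recip (1 - fps_X ^ (q ^ psum \<alpha> (Suc i) - q ^ (psum \<alpha> i + j)))"
      by (simp add: block_end_eq)
  qed
  finally show ?thesis by simp
qed

theorem proposition2p1:
  fixes q n m :: nat and \<alpha> :: "nat list"
  assumes "card (UNIV :: 'a::{field,finite} set) = q"
    and "n \<ge> 1"
    and "composition \<alpha> n"
  shows "hilbert_series (invariants n (parabolic \<alpha> :: 'a mat set)) = hilbert_product q \<alpha>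
    \<and> fps_X ^ (q ^ m) dvd
        (hilbert_series (invariants n (parabolic \<alpha> :: 'a mat set)) - fps_of_poly (C_poly q \<alpha> m))"
proof -
  have n: "n = sum_list \<alpha>"
    using assms(3) by (simp add: composition_def)
  have q: "2 \<le> q"
    using card_field_ge_2[where 'a = 'a] assms(1) by simp
  have "hilbert_series (invariants n (parabolic \<alpha> :: 'a mat set)) = hilbert_product q \<alpha>"
    unfolding n parabolic_eq_flag_group invariants_flag_group
      hilbert_series_flag_invariants[OF flag_block_end] hilbert_product_eq_flag_series
    by (simp add: assms(1))
  with hilbert_product_cong_C_poly[OF q assms(3)] show ?thesis by simp
qed

end
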